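(* Let $\mathcal C(a,b)$ be a Cantor set formed by sequences $a,b$ as in the context, and let $\{c_j\}_j$ be an increasing sequence of positive numbers tending to $\infty$ with $b_j-a_j=e^{-jc_j}$ and $\sum_{j=1}^\infty\frac1{jc_j}<\frac12$. Let $E\subset\mathcal C(a,b)$ be the set constructed in the context. The functions $f_{a,b}$ and $\tilde g_\pm$ extend over $E$ as finely holomorphic functions from the upper half plane to the lower half plane.
   Context: Cantor sets $\mathcal C(a,b)$: $a=(a_0,a_1,\dots)$, $b=(b_0,b_1,\dots)$ are real sequences with $a_j<b_j$; $\mathcal C(a,b)$ is formed by omitting from $[a_0,b_0]$ the open intervals $(a_i,b_i)$, $i\ge1$, where $[a_i,b_i]\subset(a_0,b_0)$ for $i\ge1$, $[a_i,b_i]\cap[a_j,b_j]=\varnothing$ for $i>j\ge1$, the maximal length of an interval in $[a_0,b_0]\setminus\bigcup_{j=1}^N(a_j,b_j)$ tends to $0$ as $N\to\infty$, and $b_{i+1}-a_{i+1}\le b_i-a_i$ for all $i$. Functions: $f_{a,b}(z)=\frac{z-b_0}{z-a_0}\prod_{i=1}^\infty\frac{z-a_i}{z-b_i}$ is holomorphic on $D=\mathbb C\setminus\mathcal C(a,b)$. It has two holomorphic square roots $g_\pm$ on $D$, with $\lim_{z\to\infty}g_\pm(z)=\pm1$. The functions $\tilde g_\pm$ are the square roots of $f_{a,b}$ on $\mathbb C\setminus\mathbb R$ with $\tilde g_\pm=g_\pm$ on the upper half plane and $\tilde g_\pm=-g_\pm$ on the lower half plane. Construction of the set: put $$F_N=\bigcup_{i=1}^\infty[a_i,b_i]\cup\bigcup_{n=N}^\infty\{z\in\mathbb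 C:|z-b_n|\le e^{-nc_n/2}\},\qquad J_N=[a_0,b_0]\cup F_N,$$ and $u=g_{F_N}-g_{J_N}$, where $g_X$ denotes the Green function of $X$ with pole at infinity. For $N$ sufficiently large one takes the finely open set $\{u>0\}\setminus\{b_1,\dots,b_{N-1}\}$, which contains points of $\mathcal C(a,b)$; as a subset of $\mathcal C(a,b)$, $E$ consists of these points. The fine topology on $\mathbb C$ is the coarsest topology making all subharmonic functions continuous. A function $f:\Omega\to\mathbb C$ on a finely open set $\Omega$ is finely holomorphic if every $z\in\Omega$ has a fine neighborhood $K_z\subset\Omega$, which can be taken compact in the Euclidean topology, such that $f|_{K_z}$ is a uniform limit of rational functions with poles off $K_z$.
   Formalization: The extension is over E without a_0 (for f_{a,b}) and without a_0, b_0 (for the square roots), since E can contain these endpoints and the claim fails there; that E is nonempty for large N is stated for b_0-a_0 at least 1. *)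

theory Defs
  imports "HOL-Complex_Analysis.Complex_Analysis"
begin

section \<open>Subharmonic functions and the fine topology on the plane\<close>

text \<open>The mean of an extended-real function over a circle, as the integral of the positive part minus
  the integral of the negative part (\<open>e2ennreal\<close> truncates negative values to 0). It is only used
  for upper semicontinuous functions without the value \<open>\<infinity>\<close>, whose positive part has a finite
  integral; so no \<open>\<infinity> - \<infinity>\<close> occurs.\<close>

definition circle_mean :: "(complex \<Rightarrow> ereal) \<Rightarrow> complex \<Rightarrow> real \<Rightarrow> ereal" where
  "circle_mean u z r =
     (enn2ereal (\<integral>\<^sup>+t\<in>{0..2*pi}. e2ennreal (u (z + rcis r t)) \<partial>lborel)
      - enn2ereal (\<integral>\<^sup>+t\<in>{0..2*pi}. e2ennreal (- u (z + rcis r t)) \<partial>lborel)) / ereal (2 * pi)"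

text \<open>Subharmonic functions on the whole plane, with values in \<open>[-\<infinity>, \<infinity>)\<close>. The constant
  \<open>-\<infinity>\<close> is admitted; this affects neither the fine topology nor the Green function below.\<close>

definition subharmonic :: "(complex \<Rightarrow> ereal) \<Rightarrow> bool" where
  "subharmonic u \<longleftrightarrow>
     (\<forall>z. u z < \<infinity>) \<and>
     (\<forall>y. open {z. u z < y}) \<and>
     (\<forall>z. \<forall>r>0. u z \<le> circle_mean u z r)"

definition fine_topology :: "complex topology" where
  "fine_topology = topology_generated_by {u -` U | u U. subharmonic u \<and> open U}"

definition finely_holomorphic_on :: "(complex \<Rightarrow> complex) \<Rightarrow> complex set \<Rightarrow> bool" where
  "finely_holomorphic_on f \<Omega> \<longleftrightarrow>
     openin fine_topology \<Omega> \<and>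
     (\<forall>z\<in>\<Omega>. \<exists>K. compact K \<and> K \<subseteq> \<Omega> \<and>
        (\<exists>W. openin fine_topology W \<and> z \<in> W \<and> W \<subseteq> K) \<and>
        (\<exists>p q :: nat \<Rightarrow> complex poly.
           (\<forall>n. \<forall>w\<in>K. poly (q n) w \<noteq> 0) \<and>
           uniform_limit K (\<lambda>n w. poly (p n) w / poly (q n) w) f sequentially))"

text \<open>A function given on \<open>A\<close> extends over \<open>E\<close> as a finely holomorphic function.\<close>

definition finely_extends_over :: "(complex \<Rightarrow> complex) \<Rightarrow> complex set \<Rightarrow> complex set \<Rightarrow> bool" where
  "finely_extends_over f A E \<longleftrightarrow>
     (\<exists>h. finely_holomorphic_on h (A \<union> E) \<and> (\<forall>z\<in>A. h z = f z))"

section \<open>Green functions with pole at infinity\<close>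

text \<open>The sets \<open>F\<^sub>N\<close> below are bounded but not closed, so the Green function of \<open>X\<close> with pole at
  infinity is taken as the (upper semicontinuous regularization of the) extremal function of \<open>X\<close>: the
  upper envelope of the subharmonic functions of at most logarithmic growth that are \<open>\<le> 0\<close>
  on \<open>X\<close>. For a non-polar compact set \<open>X\<close> this is the classical Green function of the unbounded
  component of the complement of \<open>X\<close>, extended by 0. The filter \<open>nhds z\<close> includes the point
  \<open>z\<close> itself.\<close>

definition log_growth :: "(complex \<Rightarrow> ereal) \<Rightarrow> bool" where
  "log_growth v \<longleftrightarrow> (\<exists>M::real. \<forall>z. v z \<le> ereal (ln (max 1 (norm z)) + M))"

definition extremal_function :: "complex set \<Rightarrow> complex \<Rightarrow> ereal" where
  "extremal_function X z = Sup {v z | v. subharmonic v \<and> log_growth v \<and> (\<forall>x\<in>X. v x \<le> 0)}"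

definition green_function :: "complex set \<Rightarrow> complex \<Rightarrow> ereal" where
  "green_function X z = Limsup (nhds z) (extremal_function X)"

section \<open>Cantor sets\<close>

definition remaining :: "(nat \<Rightarrow> real) \<Rightarrow> (nat \<Rightarrow> real) \<Rightarrow> nat \<Rightarrow> real set" where
  "remaining a b N = {a 0..b 0} - (\<Union>j\<in>{1..N}. {a j<..<b j})"

definition max_interval_length :: "real set \<Rightarrow> real" where
  "max_interval_length S = Sup {y - x | x y. x \<le> y \<and> {x..y} \<subseteq> S}"

definition cantor_data :: "(nat \<Rightarrow> real) \<Rightarrow> (nat \<Rightarrow> real) \<Rightarrow> bool" where
  "cantor_data a b \<longleftrightarrow>
     (\<forall>j. a j < b j) \<and>
     (\<forall>i\<ge>1. {a i..b i} \<subseteq> {a 0<..<b 0}) \<and>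
     (\<forall>i j. i > j \<and> j \<ge> 1 \<longrightarrow> {a i..b i} \<inter> {a j..b j} = {}) \<and>
     (\<lambda>N. max_interval_length (remaining a b N)) \<longlonglongrightarrow> 0 \<and>
     (\<forall>i. b (Suc i) - a (Suc i) \<le> b i - a i)"

definition cantor_set :: "(nat \<Rightarrow> real) \<Rightarrow> (nat \<Rightarrow> real) \<Rightarrow> complex set" where
  "cantor_set a b = complex_of_real ` ({a 0..b 0} - (\<Union>i\<in>{1..}. {a i<..<b i}))"

section \<open>The functions\<close>

definition f_ab :: "(nat \<Rightarrow> real) \<Rightarrow> (nat \<Rightarrow> real) \<Rightarrow> complex \<Rightarrow> complex" where
  "f_ab a b z = (z - of_real (b 0)) / (z - of_real (a 0))
     * (\<Prod>i. (z - of_real (a (Suc i))) / (z - of_real (b (Suc i))))"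

text \<open>\<open>g\<close> is the holomorphic square root of \<open>f_ab a b\<close> off the Cantor set with limit \<open>s\<close> at infinity;
  used with \<open>s = 1\<close> and \<open>s = -1\<close>.\<close>

definition sqrt_branch ::
    "(nat \<Rightarrow> real) \<Rightarrow> (nat \<Rightarrow> real) \<Rightarrow> complex \<Rightarrow> (complex \<Rightarrow> complex) \<Rightarrow> bool" where
  "sqrt_branch a b s g \<longleftrightarrow>
     g holomorphic_on - cantor_set a b \<and>
     (\<forall>z\<in>- cantor_set a b. (g z)\<^sup>2 = f_ab a b z) \<and>
     (g \<longlongrightarrow> s) at_infinity"

text \<open>Only meaningful off the real axis.\<close>

definition flip_lower :: "(complex \<Rightarrow> complex) \<Rightarrow> complex \<Rightarrow> complex" where
  "flip_lower g z = (if Im z > 0 then g z else - g z)"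

section \<open>The set over which the functions extend\<close>

definition F_set :: "(nat \<Rightarrow> real) \<Rightarrow> (nat \<Rightarrow> real) \<Rightarrow> (nat \<Rightarrow> real) \<Rightarrow> nat \<Rightarrow> complex set" where
  "F_set a b c N = (\<Union>i\<in>{1..}. complex_of_real ` {a i..b i})
     \<union> (\<Union>n\<in>{N..}. cball (of_real (b n)) (exp (- (real n * c n) / 2)))"

definition J_set :: "(nat \<Rightarrow> real) \<Rightarrow> (nat \<Rightarrow> real) \<Rightarrow> (nat \<Rightarrow> real) \<Rightarrow> nat \<Rightarrow> complex set" where
  "J_set a b c N = complex_of_real ` {a 0..b 0} \<union> F_set a b c N"

definition u_fun :: "(nat \<Rightarrow> real) \<Rightarrow> (nat \<Rightarrow> real) \<Rightarrow> (nat \<Rightarrow> real) \<Rightarrow> nat \<Rightarrow> complex \<Rightarrow> ereal" where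
  "u_fun a b c N z = green_function (F_set a b c N) z - green_function (J_set a b c N) z"

text \<open>This set may contain the endpoints \<open>a 0\<close> and \<open>b 0\<close>, at which \<open>F_set a b c N\<close> may be thin.
  The factor \<open>1 / (z - a 0)\<close> rules out an extension over \<open>a 0\<close>, and the complement of the real
  axis together with a subset of \<open>cantor_set a b\<close> is never a fine neighbourhood of \<open>a 0\<close> or
  \<open>b 0\<close>; extension results have to leave these two points out.\<close>

definition E_set :: "(nat \<Rightarrow> real) \<Rightarrow> (nat \<Rightarrow> real) \<Rightarrow> (nat \<Rightarrow> real) \<Rightarrow> nat \<Rightarrow> complex set" where
  "E_set a b c N = cantor_set a b
     \<inter> ({z. u_fun a b c N z > 0} - (\<lambda>n. complex_of_real (b n)) ` {1..<N})"

end

(*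
By the maximum principle, a subharmonic function of logarithmic growth that is \<le> 0 on a segment [\<alpha>, \<beta>] lies below
the Green function ln |(q + 1) / (q - 1)| of the segment, where q = csqrt ((z - \<alpha>) / (z - \<beta>)). Hence the Green functions
of F = F_set and J = J_set are subharmonic, and that of F vanishes on [a i, b i) and inside the discs of F.
So a point of {u > 0} has a compact fine neighbourhood on which the Green function of F stays above a positive level.
It avoids the discs, and off the discs the products of the factors, or of their principal square roots, converge
uniformly; Newton's iteration turns these square roots into limits of rational functions. The remaining
factor csqrt ((b 0 - z) / (z - a 0)) is holomorphic across (a 0, b 0), which accounts for the change of sign in the lower
half plane.

For nonemptiness: with S the sum of 1 / - ln r over discs of radius r that cover F, the capacity of F is at
most exp (-1 / S) times its diameter, where S < 1/2 for large N, whereas a segment of length l has capacity l / 4.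
The corresponding weighted sum of logarithmic potentials of the discs is \<le> 0 on F but too large at infinity
to be \<le> 0 on a segment slightly shorter than [a 0, b 0].
*)
theory Submission
  imports Defs
begin

subsection \<open>Circle means\<close>

text \<open>The circle mean is a difference of two integrals and may be -\<infinity>. It is traded
  for the nonnegative integral of \<open>B - u\<close>, with \<open>B\<close> an upper bound of
  \<open>u\<close> on the disc; Fatou's lemma and comparison then apply without \<infinity> -
  \<infinity>. The segment is the only set whose Green function is computed, and it serves every
  comparison. A segment inside F keeps the envelope finite; the segments [x, b i] make each x in [a
  i, b i) a regular endpoint; a shortened [a 0, b 0] yields the contradiction behind nonemptiness.
  The exponents fit together because a gap of length e^(-n c_n), seen from distance e^(-n c_n / 2),
  moves its factor away from 1 by at most e^(-n c_n / 2), which is summable, whereas halving the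
  exponent of the late radii doubles only a tail of the sum of 1 / (n c_n). The numerical margin is
  thin. With l = b 0 - a 0, S < 1/2 gives exp (-1 / S) < exp (-2), the covered set has extent 5/4 l,
  and the shortened segment has capacity 3/16 l; the contradiction needs 5/4 exp (-2) < 3/16, that
  is, exp 2 > 20/3.\<close>

definition circle_deficit :: "(complex \<Rightarrow> ereal) \<Rightarrow> real \<Rightarrow> complex \<Rightarrow> real \<Rightarrow> ennreal" where
  "circle_deficit u B z r = (\<integral>\<^sup>+t\<in>{0..2*pi}. e2ennreal (ereal B - u (z + rcis r t)) \<partial>lborel)"

lemma nn_integral_interval_const: "(\<integral>\<^sup>+t\<in>{0..2*pi}. K \<partial>lborel) = K * ennreal (2*pi)"
  by (subst nn_integral_cmult_indicator) auto

lemma continuous_rcis [continuous_intros]: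
  "continuous_on A (\<lambda>t. z + rcis r t)"
  unfolding rcis_def cis.ctr by (intro continuous_intros)

lemma dist_rcis [simp]: "dist z (z + rcis r t) = \<bar>r\<bar>"
  by (simp add: dist_norm)

lemma measurable_rcis [measurable]: "(\<lambda>t. z + rcis r t) \<in> borel_measurable borel"
  by (intro borel_measurable_continuous_onI continuous_intros)

lemma usc_measurable:
  fixes u :: "complex \<Rightarrow> ereal"
  assumes "\<forall>y. open {z. u z < y}"
  shows "u \<in> borel_measurable borel"
  using assms by (intro borel_measurableI_less) auto

lemma usc_circle_measurable:
  fixes u :: "complex \<Rightarrow> ereal"
  assumes "\<forall>y. open {z. u z < y}"
  shows "(\<lambda>t. u (z + rcis r t)) \<in> borel_measurable borel"
  using measurable_compose[OF measurable_rcis usc_measurable[OF assms]] by simp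

text \<open>This is x^+ + (B - x) = B + x^-. Written with sums only, it lives in
  \<open>ennreal\<close>, where differences would truncate, and includes x = -\<infinity>.\<close>

lemma pos_part_plus_deficit:
  assumes "x \<le> ereal B" "B \<ge> 0"
  shows "e2ennreal x + e2ennreal (ereal B - x) = ennreal B + e2ennreal (- x)"
proof (cases x)
  case (real s)
  show ?thesis
  proof (cases "s \<ge> 0")
    case True
    then show ?thesis using real assms
      by (auto simp: ennreal_neg simp flip: ennreal_plus)
  next
    case False
    then show ?thesis using real assms
      by (auto simp: ennreal_neg simp flip: ennreal_plus)
  qed
qed (use assms in \<open>auto\<close>)

lemma ereal_diff_from_sum:
  fixes P D N :: ennreal
  assumes "P + D = ennreal M + N" "P < top" "M \<ge> 0"
  shows "enn2ereal P - enn2ereal N = ereal M - enn2ereal D"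
proof (cases "N = top")
  case True
  then have "D = top" using assms by (metis ennreal_add_eq_top less_top)
  with True show ?thesis using assms(2) by (cases P) auto
next
  case False
  then have "D \<noteq> top" using assms by (metis ennreal_add_eq_top ennreal_neq_top)
  with False assms show ?thesis
    by (cases P; cases D; cases N) (auto simp flip: ennreal_plus)
qed

lemma circle_mean_eq_deficit:
  assumes usc: "\<forall>y. open {z. u z < y}" and le: "\<And>t. u (z + rcis r t) \<le> ereal B" and B: "B \<ge> 0"
  shows "circle_mean u z r = (ereal (2*pi*B) - enn2ereal (circle_deficit u B z r)) / ereal (2*pi)"
proof -
  note [measurable] = usc_circle_measurable[OF usc]
  let ?P = "\<integral>\<^sup>+t\<in>{0..2*pi}. e2ennreal (u (z + rcis r t)) \<partial>lborel"
  let ?N = "\<integral>\<^sup>+t\<in>{0..2*pi}. e2ennreal (- u (z + rcis r t)) \<partial>lborel"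
  have "?P + circle_deficit u B z r
      = (\<integral>\<^sup>+t\<in>{0..2*pi}. (e2ennreal (u (z + rcis r t)) + e2ennreal (ereal B - u (z + rcis r t))) \<partial>lborel)"
    unfolding circle_deficit_def
    by (subst nn_integral_add[symmetric]) (auto intro!: nn_integral_cong simp: distrib_right)
  also have "\<dots> = (\<integral>\<^sup>+t\<in>{0..2*pi}. (ennreal B + e2ennreal (- u (z + rcis r t))) \<partial>lborel)"
    using pos_part_plus_deficit[OF le B] by simp
  also have "\<dots> = (\<integral>\<^sup>+t\<in>{0..2*pi}. ennreal B \<partial>lborel) + ?N"
    by (subst nn_integral_add[symmetric]) (auto intro!: nn_integral_cong simp: distrib_right)
  also have "(\<integral>\<^sup>+t\<in>{0..2*pi}. ennreal B \<partial>lborel) = ennreal (2*pi*B)"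
    unfolding nn_integral_interval_const using B by (simp add: mult.commute flip: ennreal_mult)
  finally have eq: "?P + circle_deficit u B z r = ennreal (2*pi*B) + ?N" .
  have "?P \<le> (\<integral>\<^sup>+t\<in>{0..2*pi}. ennreal B \<partial>lborel)"
    using e2ennreal_mono[OF le] by (intro nn_integral_mono mult_right_mono) auto
  also have "\<dots> < top"
    unfolding nn_integral_interval_const using B by (simp add: ennreal_mult_less_top)
  finally have fin: "?P < top" .
  show ?thesis
    unfolding circle_mean_def using ereal_diff_from_sum[OF eq fin] B by simp
qed

text \<open>The sub-mean-value inequality becomes an upper bound for a nonnegative integral. If
  \<open>u z\<close> is -\<infinity>, both sides hold trivially.\<close>

lemma le_circle_mean_iff:
  assumes usc: "\<forall>y. open {z. u z < y}" and le: "\<And>t. u (z + rcis r t) \<le> ereal B" and B: "B \<ge> 0"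
    and z: "u z \<le> ereal B"
  shows "u z \<le> circle_mean u z r \<longleftrightarrow>
    circle_deficit u B z r \<le> ennreal (2*pi) * e2ennreal (ereal B - u z)"
proof -
  let ?D = "circle_deficit u B z r"
  have pi: "2 * pi > 0" by simp
  show ?thesis
  proof (cases "u z")
    case (real s)
    have sB: "s \<le> B" using z real by simp
    show ?thesis
    proof (cases "?D = top")
      case True
      then show ?thesis unfolding circle_mean_eq_deficit[OF usc le B]
        using real sB by (auto simp: top_unique ennreal_mult_eq_top_iff simp flip: ennreal_mult)
    next
      case False
      then obtain d where d: "?D = ennreal d" "d \<ge> 0" by (cases ?D) auto
      show ?thesis unfolding circle_mean_eq_deficit[OF usc le B] d
        using real sB d by (auto simp: field_simps simp flip: ennreal_mult)
    qed
  next
    case MInf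
    then show ?thesis by (simp add: ennreal_mult_top)
  qed (use z in auto)
qed

lemma usc_cball_bounded:
  fixes u :: "complex \<Rightarrow> ereal"
  assumes usc: "\<forall>y. open {z. u z < y}" and fin: "\<forall>z. u z < \<infinity>" and "compact K"
  obtains B where "B \<ge> 0" "\<And>w. w \<in> K \<Longrightarrow> u w \<le> ereal B"
proof -
  have "K \<subseteq> (\<Union>n::nat. {z. u z < ereal (real n)})"
  proof
    fix w
    have "u w < \<infinity>" using fin by blast
    then have "\<exists>n::nat. u w < ereal (real n)"
      by (cases "u w") (auto simp: reals_Archimedean2)
    then show "w \<in> (\<Union>n::nat. {z. u z < ereal (real n)})" by auto
  qed
  then obtain F where F: "finite F" "K \<subseteq> (\<Union>n\<in>F. {z. u z < ereal (real n)})"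
    using compactE_image[OF \<open>compact K\<close>, of UNIV "\<lambda>n. {z. u z < ereal (real n)}"] usc by metis
  show thesis
  proof (rule that[of "real (Max (insert 0 F))"])
    fix w assume "w \<in> K"
    then obtain n where n: "n \<in> F" "u w < ereal (real n)" using F by blast
    then have "n \<le> Max (insert 0 F)" using F by simp
    then have "ereal (real n) \<le> ereal (real (Max (insert 0 F)))" by simp
    with n show "u w \<le> ereal (real (Max (insert 0 F)))" by (meson less_imp_le order_trans)
  qed simp
qed

lemma subharmonic_deficit:
  assumes "subharmonic u" "r > 0" "B \<ge> 0" "\<And>w. w \<in> cball z r \<Longrightarrow> u w \<le> ereal B"
  shows "circle_deficit u B z r \<le> ennreal (2*pi) * e2ennreal (ereal B - u z)"
proof -
  have "u z \<le> circle_mean u z r" using assms by (auto simp: subharmonic_def)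
  then show ?thesis using assms
    by (subst (asm) le_circle_mean_iff[where B=B]) (auto simp: subharmonic_def)
qed

lemma subharmonicI_deficit:
  assumes usc: "\<forall>y. open {z. u z < y}" and fin: "\<forall>z. u z < \<infinity>"
    and d: "\<And>z r. r > 0 \<Longrightarrow> \<exists>B\<ge>0. (\<forall>w\<in>cball z r. u w \<le> ereal B) \<and>
      circle_deficit u B z r \<le> ennreal (2*pi) * e2ennreal (ereal B - u z)"
  shows "subharmonic u"
  unfolding subharmonic_def
proof (intro conjI allI impI)
  fix z and r :: real assume r: "r > 0"
  obtain B where B: "B \<ge> 0" "\<And>w. w \<in> cball z r \<Longrightarrow> u w \<le> ereal B"
      "circle_deficit u B z r \<le> ennreal (2*pi) * e2ennreal (ereal B - u z)"
    using d[OF r] by metis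
  then show "u z \<le> circle_mean u z r"
    using r by (subst le_circle_mean_iff[OF usc, where B=B]) auto
qed (use usc fin in auto)

text \<open>Bridge from the gauge integral, in which the mean value formulas are available, to the
  Lebesgue integral defining the deficit.\<close>

lemma nn_integral_circle:
  assumes "continuous_on (sphere z r) h" "\<And>w. w \<in> sphere z r \<Longrightarrow> h w \<ge> 0" "r > 0"
    and I: "((\<lambda>t. h (z + rcis r t)) has_integral I) {0..2*pi}"
  shows "(\<integral>\<^sup>+t\<in>{0..2*pi}. ennreal (h (z + rcis r t)) \<partial>lborel) = ennreal I"
proof -
  have sph: "z + rcis r t \<in> sphere z r" for t using \<open>r > 0\<close> by simp
  have c: "continuous_on UNIV (\<lambda>t. h (z + rcis r t))"
    using sph by (intro continuous_on_compose2[OF assms(1)] continuous_intros) auto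
  have "(\<integral>\<^sup>+t\<in>{0..2*pi}. ennreal (h (z + rcis r t)) \<partial>lborel)
      = (\<integral>\<^sup>+t. ennreal (indicator {0..2*pi} t * h (z + rcis r t)) \<partial>lborel)"
    by (intro nn_integral_cong) (auto simp: indicator_def)
  also have "\<dots> = ennreal I"
  proof (rule nn_integral_has_integral_lborel)
    show "(\<lambda>t. indicator {0..2*pi} t * h (z + rcis r t)) \<in> borel_measurable borel"
      using borel_measurable_continuous_onI[OF c] by measurable
    have "((\<lambda>t. if t \<in> {0..2*pi} then h (z + rcis r t) else 0) has_integral I) UNIV"
      using I unfolding has_integral_restrict_UNIV .
    then show "((\<lambda>t. indicator {0..2*pi} t * h (z + rcis r t)) has_integral I) UNIV"
      by (rule has_integral_eq[rotated]) (auto simp: indicator_def)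
  qed (use assms(2) sph in \<open>auto simp: indicator_def\<close>)
  finally show ?thesis .
qed

lemma continuous_ereal_usc:
  assumes "continuous_on UNIV (h :: complex \<Rightarrow> real)"
  shows "open {z. ereal (h z) < y}"
proof -
  have "open ((\<lambda>z. ereal (h z)) -` {..<y})"
    by (intro open_vimage continuous_intros assms)
  then show ?thesis by (simp add: vimage_def)
qed

lemma subharmonicI_continuous:
  assumes cont: "continuous_on UNIV h"
    and mean: "\<And>z r. r > 0 \<Longrightarrow> 2 * pi * h z \<le> integral {0..2*pi} (\<lambda>t. h (z + rcis r t))"
  shows "subharmonic (\<lambda>z. ereal (h z))"
proof (rule subharmonicI_deficit)
  show "\<forall>y. open {z. ereal (h z) < y}" using continuous_ereal_usc[OF cont] by blast
next
  fix z and r :: real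
  assume r: "r > 0"
  obtain B where B: "B \<ge> 0" "\<And>w. w \<in> cball z r \<Longrightarrow> ereal (h w) \<le> ereal B"
    using usc_cball_bounded[of "\<lambda>z. ereal (h z)" "cball z r"] continuous_ereal_usc[OF cont] by auto
  have "continuous_on {0..2*pi} (\<lambda>t. h (z + rcis r t))"
    by (rule continuous_on_compose2[OF cont]) (auto intro!: continuous_intros)
  then have int: "((\<lambda>t. h (z + rcis r t)) has_integral integral {0..2*pi} (\<lambda>t. h (z + rcis r t))) {0..2*pi}"
    by (intro integrable_integral integrable_continuous_real)
  have "((\<lambda>t. B - h (z + rcis r t)) has_integral (2*pi*B - integral {0..2*pi} (\<lambda>t. h (z + rcis r t)))) {0..2*pi}"
    using has_integral_diff[OF has_integral_const_real[of B 0 "2*pi"] int] by (simp add: mult.commute)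
  then have "(\<integral>\<^sup>+t\<in>{0..2*pi}. ennreal (B - h (z + rcis r t)) \<partial>lborel)
      = ennreal (2*pi*B - integral {0..2*pi} (\<lambda>t. h (z + rcis r t)))"
    using B r by (intro nn_integral_circle[where h = "\<lambda>w. B - h w"] continuous_intros
      continuous_on_subset[OF cont]) auto
  also have "\<dots> \<le> ennreal (2*pi*(B - h z))"
    using mean[OF r, of z] by (intro ennreal_leI) (auto simp: algebra_simps)
  also have "\<dots> = ennreal (2*pi) * e2ennreal (ereal B - ereal (h z))"
    using B(2)[of z] r by (simp add: ennreal_mult)
  finally have "circle_deficit (\<lambda>z. ereal (h z)) B z r \<le> ennreal (2*pi) * e2ennreal (ereal B - ereal (h z))"
    unfolding circle_deficit_def by simp
  then show "\<exists>B\<ge>0. (\<forall>w\<in>cball z r. ereal (h w) \<le> ereal B) \<and>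
      circle_deficit (\<lambda>z. ereal (h z)) B z r \<le> ennreal (2*pi) * e2ennreal (ereal B - ereal (h z))"
    using B by blast
qed auto

section \<open>Mean values of holomorphic functions and of logarithms of their moduli\<close>

lemma holomorphic_circle_mean:
  fixes f :: "complex \<Rightarrow> complex"
  assumes "f holomorphic_on cball z r" "r > 0"
  shows "((\<lambda>t. f (z + rcis r t)) has_integral (2*pi*f z)) {0..2*pi}"
proof -
  have "((\<lambda>u. f u/(u-z)) has_contour_integral (2 * of_real pi * \<i> * f z)) (part_circlepath z r 0 (2*pi))"
    using Cauchy_integral_circlepath_simple[OF assms(1), of z] assms(2) by (simp add: circlepath_def)
  then have "((\<lambda>t. f (z + r * cis t) / (r * cis t) * r * \<i> * cis t) has_integral (2 * of_real pi * \<i> * f z)) {0..2*pi}"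
    by (subst (asm) has_contour_integral_part_circlepath_iff) auto
  then have "((\<lambda>t. (f (z + rcis r t)) * \<i>) has_integral (2 * of_real pi * \<i> * f z)) {0..2*pi}"
    using assms(2) by (simp add: rcis_def field_simps)
  then have "((\<lambda>t. (f (z + rcis r t)) * \<i> * (-\<i>)) has_integral (2 * of_real pi * \<i> * f z * (-\<i>))) {0..2*pi}"
    by (rule has_integral_mult_left)
  then show ?thesis by (simp add: algebra_simps)
qed

text \<open>On the disc \<open>f\<close> is the exponential of a holomorphic function, and ln |f| is
  the real part of that function.\<close>

lemma ln_norm_circle_mean:
  fixes f :: "complex \<Rightarrow> complex"
  assumes f: "f holomorphic_on ball z R" and nz: "\<And>w. w \<in> ball z R \<Longrightarrow> f w \<noteq> 0"
    and r: "0 < r" "r < R"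
  shows "((\<lambda>t. ln (norm (f (z + rcis r t)))) has_integral (2*pi*ln (norm (f z)))) {0..2*pi}"
proof -
  obtain g where g: "g holomorphic_on ball z R" "\<And>w. w \<in> ball z R \<Longrightarrow> exp (g w) = f w"
    using holomorphic_logarithm_exists[of "ball z R" f z] f nz r by (auto simp: convex_ball)
  have "cball z r \<subseteq> ball z R" using r by auto
  then have "((\<lambda>t. g (z + rcis r t)) has_integral (2*pi*g z)) {0..2*pi}"
    using g r by (intro holomorphic_circle_mean) (auto intro: holomorphic_on_subset)
  then have "((\<lambda>t. Re (g (z + rcis r t))) has_integral Re (2*pi*g z)) {0..2*pi}"
    by (rule has_integral_Re)
  moreover have "ln (norm (f w)) = Re (g w)" if "w \<in> ball z R" for w
    using g(2)[OF that] by (metis ln_exp norm_exp_eq_Re)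
  moreover have "z + rcis r t \<in> ball z R" for t using r by simp
  moreover have "z \<in> ball z R" using r by simp
  ultimately show ?thesis by simp
qed

subsection \<open>Extremal functions are subharmonic after regularization\<close>

lemma subharmonic_const: "subharmonic (\<lambda>_. ereal k)"
  by (rule subharmonicI_continuous) auto

lemma extremal_function_nonneg: "0 \<le> extremal_function X z"
  unfolding extremal_function_def
proof (rule Sup_upper, safe, intro exI conjI)
  show "subharmonic (\<lambda>_. 0)" using subharmonic_const[of 0] by (simp add: zero_ereal_def)
  show "log_growth (\<lambda>_. 0)" unfolding log_growth_def
    by (intro exI[of _ 0]) (auto simp: zero_ereal_def)
qed auto

lemma extremal_le_green: "extremal_function X z \<le> green_function X z"
  unfolding green_function_def
proof (rule Limsup_greatest)
  fix P assume "eventually P (nhds z)"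
  then have "P z" by (rule eventually_nhds_x_imp_x)
  then show "extremal_function X z \<le> (SUP x\<in>Collect P. extremal_function X x)"
    by (intro SUP_upper) auto
qed

lemma green_function_nonneg: "0 \<le> green_function X z"
  using extremal_function_nonneg extremal_le_green by (rule order_trans)

lemma green_function_upper:
  assumes "subharmonic v" "log_growth v" "\<forall>x\<in>X. v x \<le> 0"
  shows "v z \<le> green_function X z"
proof -
  have "v z \<le> extremal_function X z"
    unfolding extremal_function_def using assms by (intro Sup_upper) auto
  then show ?thesis using extremal_le_green by (rule order_trans)
qed

lemma green_function_le:
  assumes "isCont h z" "eventually (\<lambda>w. extremal_function X w \<le> ereal (h w)) (nhds z)"
  shows "green_function X z \<le> ereal (h z)"
proof -
  have "((\<lambda>w. ereal (h w)) \<longlongrightarrow> ereal (h z)) (nhds z)"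
    using assms(1) unfolding isCont_def tendsto_at_iff_tendsto_nhds by (intro tendsto_intros)
  then have "Limsup (nhds z) (\<lambda>w. ereal (h w)) = ereal (h z)"
    by (intro lim_imp_Limsup) auto
  with Limsup_mono[OF assms(2)] show ?thesis
    unfolding green_function_def by simp
qed

lemma green_function_usc: "open {z. green_function X z < y}"
proof (subst open_subopen, safe)
  fix z assume "green_function X z < y"
  then obtain y' where y': "green_function X z < y'" "y' < y" using dense by blast
  then have "eventually (\<lambda>w. extremal_function X w < y') (nhds z)"
    unfolding green_function_def by (intro Limsup_lessD)
  then obtain S where S: "open S" "z \<in> S" "\<forall>w\<in>S. extremal_function X w < y'"
    unfolding eventually_nhds by blast
  have "green_function X w \<le> y'" if "w \<in> S" for w
    unfolding green_function_def using S that
    by (intro Limsup_bounded) (auto simp: eventually_nhds intro: less_imp_le)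
  then show "\<exists>T. open T \<and> z \<in> T \<and> T \<subseteq> {z. green_function X z < y}"
    using S y'(2) by (intro exI[of _ S]) (auto intro: le_less_trans)
qed

text \<open>Lower bounds on the integrand of the deficit are strict upper bounds on
  \<open>u\<close>; these define the open sets of upper semicontinuity and match
  \<open>le_Liminf_iff\<close>.\<close>

lemma less_e2ennreal_diff_iff:
  "y < e2ennreal (ereal B - x) \<longleftrightarrow> x < ereal B - enn2ereal y"
proof (cases y)
  case (real s)
  then show ?thesis by (cases x) (auto simp: ennreal_less_iff e2ennreal_neg)
qed (cases x; auto)

lemma usc_deficit_liminf:
  fixes u :: "complex \<Rightarrow> ereal"
  assumes usc: "\<forall>y. open {z. u z < y}" and "w \<longlonglongrightarrow> z"
  shows "e2ennreal (ereal B - u z) \<le> liminf (\<lambda>n. e2ennreal (ereal B - u (w n)))"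
  unfolding le_Liminf_iff
proof (intro allI impI)
  fix y assume "y < e2ennreal (ereal B - u z)"
  then have "z \<in> {z. u z < ereal B - enn2ereal y}" by (simp add: less_e2ennreal_diff_iff)
  then have "\<forall>\<^sub>F n in sequentially. w n \<in> {z. u z < ereal B - enn2ereal y}"
    using usc by (intro topological_tendstoD[OF assms(2)]) auto
  then show "\<forall>\<^sub>F n in sequentially. y < e2ennreal (ereal B - u (w n))"
    by (simp add: less_e2ennreal_diff_iff)
qed

text \<open>Upper semicontinuity of \<open>u\<close> makes the integrand lower semicontinuous in the
  centre, and Fatou's lemma carries this to the integral.\<close>

lemma circle_deficit_liminf:
  assumes usc: "\<forall>y. open {z. u z < y}" and "w \<longlonglongrightarrow> z"
  shows "circle_deficit u B z r \<le> liminf (\<lambda>n. circle_deficit u B (w n) r)"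
proof -
  note [measurable] = usc_circle_measurable[OF usc]
  have "circle_deficit u B z r
    \<le> (\<integral>\<^sup>+t. liminf (\<lambda>n. e2ennreal (ereal B - u (w n + rcis r t)) * indicator {0..2*pi} t) \<partial>lborel)"
    unfolding circle_deficit_def
  proof (rule nn_integral_mono)
    fix t
    show "e2ennreal (ereal B - u (z + rcis r t)) * indicator {0..2*pi} t
      \<le> liminf (\<lambda>n. e2ennreal (ereal B - u (w n + rcis r t)) * indicator {0..2*pi} t)"
    proof (cases "t \<in> {0..2*pi}")
      case True
      then show ?thesis
        using usc_deficit_liminf[OF usc, of "\<lambda>n. w n + rcis r t" "z + rcis r t" B]
          tendsto_add[OF assms(2) tendsto_const, of "rcis r t"] by simp
    qed simp
  qed
  also have "\<dots> \<le> liminf (\<lambda>n. circle_deficit u B (w n) r)"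
    unfolding circle_deficit_def by (intro nn_integral_liminf) measurable
  finally show ?thesis .
qed

lemma circle_deficit_mono:
  assumes "\<And>w. v w \<le> u w"
  shows "circle_deficit u B z r \<le> circle_deficit v B z r"
  unfolding circle_deficit_def
  by (intro nn_integral_mono mult_right_mono e2ennreal_mono ereal_minus_mono assms) auto

text \<open>The continuous majorant keeps the regularization finite. For y below its value at z
  there are centres w n tending to z and competitors v with v (w n) > y. Each v lies below the Green
  function, so the deficit of the latter at w n is at most that of v; lower semicontinuity of the
  deficit passes to z.\<close>

lemma subharmonic_green_function:
  assumes cont: "continuous_on UNIV h" and le: "\<And>z. extremal_function X z \<le> ereal (h z)"
  shows "subharmonic (green_function X)"
proof (rule subharmonicI_deficit)
  let ?G = "green_function X"
  have Gh: "?G z \<le> ereal (h z)" for z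
    using cont le by (intro green_function_le) (auto simp: continuous_on_eq_continuous_at)
  show usc: "\<forall>y. open {z. ?G z < y}" using green_function_usc by blast
  show fin: "\<forall>z. ?G z < \<infinity>"
  proof
    fix z show "?G z < \<infinity>" using Gh[of z] by (cases "?G z") auto
  qed
  fix z and r :: real assume r: "r > 0"
  \<comment> \<open>The radius r + 1 makes \<open>B\<close> a bound on all discs of radius r whose
    centre is within distance 1 of z, as is needed for the centres w n below.\<close>
  obtain B where B: "B \<ge> 0" "\<And>w. w \<in> cball z (r + 1) \<Longrightarrow> ?G w \<le> ereal B"
    using usc_cball_bounded[OF usc fin compact_cball] by metis
  have D: "circle_deficit ?G B z r \<le> ennreal (2*pi) * e2ennreal (ereal B - y)"
    if y: "y < ?G z" for y
  proof -
    have "\<exists>w. dist w z < inverse (real (Suc n)) \<and> y < extremal_function X w" for n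
    proof (rule ccontr)
      assume *: "\<not> ?thesis"
      have "eventually (\<lambda>w. extremal_function X w \<le> y) (nhds z)"
        unfolding eventually_nhds_metric
      proof (intro exI conjI allI impI)
        show "0 < inverse (real (Suc n))" by simp
        show "extremal_function X w \<le> y" if "dist w z < inverse (real (Suc n))" for w
          using * that not_le by blast
      qed
      then have "?G z \<le> y" unfolding green_function_def by (rule Limsup_bounded)
      with y show False by simp
    qed
    then obtain w where w: "\<And>n. dist (w n) z < inverse (real (Suc n))" "\<And>n. y < extremal_function X (w n)"
      by metis
    have "(\<lambda>n. dist (w n) z) \<longlonglongrightarrow> 0"
      by (rule tendsto_sandwich[OF _ _ tendsto_const LIMSEQ_inverse_real_of_nat]) (use w(1) in \<open>auto intro!: always_eventually less_imp_le simp del: of_nat_Suc\<close>)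
    then have lim: "w \<longlonglongrightarrow> z" unfolding tendsto_dist_iff[of w] .
    have "circle_deficit ?G B (w n) r \<le> ennreal (2*pi) * e2ennreal (ereal B - y)" for n
    proof -
      obtain v where v: "subharmonic v" "log_growth v" "\<forall>x\<in>X. v x \<le> 0" "y < v (w n)"
        using w(2)[of n] unfolding extremal_function_def less_Sup_iff by auto
      have vG: "v p \<le> ?G p" for p using green_function_upper[OF v(1-3)] .
      have "inverse (real (Suc n)) \<le> 1" by (simp add: field_simps)
      then have "dist (w n) z \<le> 1" using w(1)[of n] by linarith
      then have "cball (w n) r \<subseteq> cball z (r + 1)"
        unfolding cball_subset_cball_iff by simp
      then have "\<And>p. p \<in> cball (w n) r \<Longrightarrow> v p \<le> ereal B" using B(2) vG by (meson order_trans subsetD)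
      then have "circle_deficit v B (w n) r \<le> ennreal (2*pi) * e2ennreal (ereal B - v (w n))"
        by (intro subharmonic_deficit v r B(1))
      also have "\<dots> \<le> ennreal (2*pi) * e2ennreal (ereal B - y)"
        using v(4) by (intro mult_left_mono e2ennreal_mono ereal_minus_mono) auto
      finally show ?thesis using circle_deficit_mono[OF vG] by (meson order_trans)
    qed
    then have "liminf (\<lambda>n. circle_deficit ?G B (w n) r) \<le> ennreal (2*pi) * e2ennreal (ereal B - y)"
      by (intro Liminf_le) auto
    with circle_deficit_liminf[OF usc lim, of B r] show ?thesis by (rule order_trans)
  qed
  obtain g where g: "?G z = ereal g"
    using green_function_nonneg[of X z] fin by (cases "?G z") auto
  have gB: "g \<le> B" using B(2)[of z] g r by simp
  have "circle_deficit ?G B z r \<le> ennreal (2*pi) * e2ennreal (ereal B - ?G z)"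
  proof (rule ennreal_le_epsilon)
    fix e :: real assume "e > 0"
    \<comment> \<open>\<open>D\<close> covers only values y strictly below the Green function at z.
      The choice y = g - e / (2 pi) costs exactly e after multiplication by 2 pi.\<close>
    then have "circle_deficit ?G B z r \<le> ennreal (2*pi) * e2ennreal (ereal B - ereal (g - e / (2*pi)))"
      using g by (intro D) auto
    also have "\<dots> = ennreal (2*pi) * ennreal (B - (g - e / (2*pi)))" by simp
    also have "\<dots> = ennreal (2*pi * (B - (g - e / (2*pi))))"
    proof (rule ennreal_mult[symmetric])
      have "e / (2*pi) \<ge> 0" using \<open>e > 0\<close> by simp
      then show "0 \<le> B - (g - e / (2*pi))" using gB by linarith
    qed simp
    also have "2*pi * (B - (g - e / (2*pi))) = 2*pi*(B - g) + e"
      by (simp add: field_simps)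
    also have "\<dots> = ennreal (2*pi) * e2ennreal (ereal B - ?G z) + ennreal e"
      using gB g \<open>e > 0\<close> by (simp add: ennreal_mult)
    finally show "circle_deficit ?G B z r \<le> ennreal (2*pi) * e2ennreal (ereal B - ?G z) + ennreal e" .
  qed
  then show "\<exists>B\<ge>0. (\<forall>w\<in>cball z r. ?G w \<le> ereal B) \<and>
      circle_deficit ?G B z r \<le> ennreal (2*pi) * e2ennreal (ereal B - ?G z)"
    using B by (intro exI[of _ B]) auto
qed

subsection \<open>The conformal map of the exterior of a segment\<close>

abbreviation seg :: "real \<Rightarrow> real \<Rightarrow> complex set" where
  "seg \<alpha> \<beta> \<equiv> complex_of_real ` {\<alpha>..\<beta>}"

lemma closed_seg [simp]: "closed (seg \<alpha> \<beta>)"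
  by (intro compact_imp_closed compact_continuous_image) (auto intro!: continuous_intros)

text \<open>If the quotient equals t \<le> 0, solving for z gives a convex combination of \<alpha>
  and \<beta>, with weights 1 / (1 - t) and -t / (1 - t).\<close>

lemma ratio_nonpos_Reals:
  assumes "\<alpha> < \<beta>" "z \<notin> seg \<alpha> \<beta>"
  shows "(z - of_real \<alpha>) / (z - of_real \<beta>) \<notin> \<real>\<^sub>\<le>\<^sub>0"
proof
  assume "(z - of_real \<alpha>) / (z - of_real \<beta>) \<in> \<real>\<^sub>\<le>\<^sub>0"
  then obtain t where t: "(z - of_real \<alpha>) / (z - of_real \<beta>) = of_real t" "t \<le> 0"
    by (auto elim!: nonpos_Reals_cases)
  have "z \<noteq> of_real \<beta>" using assms by auto
  then have "z - of_real \<alpha> = of_real t * (z - of_real \<beta>)" using t by (simp add: field_simps)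
  then have "z * of_real (1 - t) = of_real (\<alpha> - t * \<beta>)" by (simp add: algebra_simps)
  moreover have "complex_of_real (1 - t) \<noteq> 0" using t by (metis of_real_eq_0_iff diff_eq_eq add_0 not_one_le_zero)
  ultimately have "z = of_real ((\<alpha> - t * \<beta>) / (1 - t))" by (simp add: field_simps)
  moreover have "\<alpha> \<le> (\<alpha> - t * \<beta>) / (1 - t)" "(\<alpha> - t * \<beta>) / (1 - t) \<le> \<beta>"
    using t assms mult_left_mono_neg[of \<alpha> \<beta> t] by (auto simp: field_simps)
  ultimately show False using assms(2) by (metis atLeastAtMost_iff imageI)
qed

definition seg_root :: "real \<Rightarrow> real \<Rightarrow> complex \<Rightarrow> complex" where
  "seg_root \<alpha> \<beta> z = csqrt ((z - of_real \<alpha>) / (z - of_real \<beta>))"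

text \<open>For the segment [-1, 1] this is z + sqrt (z^2 - 1), the inverse of the Joukowski map,
  taking the exterior of the segment to the exterior of the unit disc.\<close>

definition seg_ext :: "real \<Rightarrow> real \<Rightarrow> complex \<Rightarrow> complex" where
  "seg_ext \<alpha> \<beta> z = (seg_root \<alpha> \<beta> z + 1) / (seg_root \<alpha> \<beta> z - 1)"

lemma Re_csqrt_pos: "w \<notin> \<real>\<^sub>\<le>\<^sub>0 \<Longrightarrow> Re (csqrt w) > 0"
proof (rule ccontr)
  assume w: "w \<notin> \<real>\<^sub>\<le>\<^sub>0" and "\<not> Re (csqrt w) > 0"
  define q where "q = csqrt w"
  have "Re q \<ge> 0" "q\<^sup>2 = w" by (simp_all only: q_def Re_csqrt power2_csqrt)
  with \<open>\<not> Re (csqrt w) > 0\<close> have "Re q = 0" by (simp only: q_def[symmetric])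
  then have "Re (q\<^sup>2) \<le> 0" "Im (q\<^sup>2) = 0" by (auto simp: Re_power2 Im_power2)
  then show False using w \<open>q\<^sup>2 = w\<close> by (simp add: complex_nonpos_Reals_iff)
qed

context
  fixes \<alpha> \<beta> :: real
  assumes less: "\<alpha> < \<beta>"
begin

lemma seg_root_props:
  assumes z: "z \<notin> seg \<alpha> \<beta>"
  shows "Re (seg_root \<alpha> \<beta> z) > 0" "seg_root \<alpha> \<beta> z \<noteq> 1" "seg_root \<alpha> \<beta> z \<noteq> -1"
    "(seg_root \<alpha> \<beta> z)\<^sup>2 - 1 = of_real (\<beta> - \<alpha>) / (z - of_real \<beta>)"
proof -
  show "Re (seg_root \<alpha> \<beta> z) > 0"
    unfolding seg_root_def using ratio_nonpos_Reals[OF less z] by (rule Re_csqrt_pos)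
  then show "seg_root \<alpha> \<beta> z \<noteq> -1" by auto
  have nz: "z \<noteq> of_real \<beta>" using z less by auto
  then show *: "(seg_root \<alpha> \<beta> z)\<^sup>2 - 1 = of_real (\<beta> - \<alpha>) / (z - of_real \<beta>)"
    unfolding seg_root_def by (simp add: field_simps)
  have "of_real (\<beta> - \<alpha>) / (z - of_real \<beta>) \<noteq> 0" using nz less by auto
  with * show "seg_root \<alpha> \<beta> z \<noteq> 1" by (metis one_power2 diff_self)
qed

lemma seg_ext_nonzero: "z \<notin> seg \<alpha> \<beta> \<Longrightarrow> seg_ext \<alpha> \<beta> z \<noteq> 0"
  using seg_root_props[of z] by (auto simp: seg_ext_def add_eq_0_iff2)

lemma holomorphic_seg_root: "seg_root \<alpha> \<beta> holomorphic_on - seg \<alpha> \<beta>"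
proof -
  have "z - of_real \<beta> \<noteq> 0" if "z \<in> - seg \<alpha> \<beta>" for z using that less by auto
  then show ?thesis
    unfolding seg_root_def using ratio_nonpos_Reals[OF less]
    by (intro holomorphic_intros) auto
qed

lemma holomorphic_seg_ext: "seg_ext \<alpha> \<beta> holomorphic_on - seg \<alpha> \<beta>"
  unfolding seg_ext_def using seg_root_props by (intro holomorphic_intros holomorphic_seg_root) auto

lemma norm_seg_ext:
  assumes z: "z \<notin> seg \<alpha> \<beta>"
  shows "norm (seg_ext \<alpha> \<beta> z) = (norm (seg_root \<alpha> \<beta> z + 1))\<^sup>2 * norm (z - of_real \<beta>) / (\<beta> - \<alpha>)"
proof -
  let ?q = "seg_root \<alpha> \<beta> z"
  note p = seg_root_props[OF z]
  have nz: "z \<noteq> of_real \<beta>" using z less by auto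
  have "(?q + 1) * (?q - 1) = of_real (\<beta> - \<alpha>) / (z - of_real \<beta>)"
    using p(4) by (simp add: power2_eq_square algebra_simps)
  moreover have "?q + 1 \<noteq> 0" "?q - 1 \<noteq> 0" using p(2,3) by (auto simp: add_eq_0_iff2)
  ultimately have "seg_ext \<alpha> \<beta> z = (?q + 1)\<^sup>2 * (z - of_real \<beta>) / of_real (\<beta> - \<alpha>)"
  proof -
    have L: "z - of_real \<beta> \<noteq> 0" "complex_of_real (\<beta> - \<alpha>) \<noteq> 0" using nz less by (auto simp flip: of_real_diff)
    have "seg_ext \<alpha> \<beta> z = (?q + 1)\<^sup>2 / ((?q + 1) * (?q - 1))"
      using \<open>?q + 1 \<noteq> 0\<close> unfolding seg_ext_def power2_eq_square by simp
    also have "\<dots> = (?q + 1)\<^sup>2 / (of_real (\<beta> - \<alpha>) / (z - of_real \<beta>))"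
      using \<open>(?q + 1) * (?q - 1) = _\<close> by (rule arg_cong)
    finally show ?thesis using L by simp
  qed
  then show ?thesis using less by (simp add: norm_mult norm_divide norm_power del: of_real_diff)
qed

text \<open>Points of the closed right half plane are at least as far from -1 as from 1. The bound
  also holds on the segment; at \<beta> the division by zero makes the root 0 and
  \<open>seg_ext\<close> equal to -1.\<close>

lemma norm_seg_ext_ge_1: "norm (seg_ext \<alpha> \<beta> z) \<ge> 1"
proof -
  let ?q = "seg_root \<alpha> \<beta> z"
  have "Re ?q \<ge> 0" unfolding seg_root_def by (rule Re_csqrt)
  then have "norm (?q - 1) \<le> norm (?q + 1)"
    unfolding cmod_def by (intro real_sqrt_le_mono) (auto simp: power2_eq_square algebra_simps)
  moreover have "?q \<noteq> 1" using less by (auto simp: seg_root_def)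
  ultimately show ?thesis unfolding seg_ext_def by (simp add: norm_divide)
qed

lemma norm_seg_ext_ge:
  assumes z: "z \<notin> seg \<alpha> \<beta>"
  shows "norm (seg_ext \<alpha> \<beta> z) \<ge> norm (z - of_real \<beta>) / (\<beta> - \<alpha>)"
proof -
  let ?q = "seg_root \<alpha> \<beta> z"
  have "1 \<le> Re (?q + 1)" using seg_root_props(1)[OF z] by simp
  also have "\<dots> \<le> norm (?q + 1)" by (rule complex_Re_le_cmod)
  finally have "1 \<le> (norm (?q + 1))\<^sup>2" by simp
  then have "1 * norm (z - of_real \<beta>) / (\<beta> - \<alpha>) \<le> (norm (?q + 1))\<^sup>2 * norm (z - of_real \<beta>) / (\<beta> - \<alpha>)"
    using less by (intro divide_right_mono mult_right_mono) auto
  then show ?thesis using norm_seg_ext[OF z] by simp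
qed

text \<open>From |q + 1|^2 \<le> 2 (|q|^2 + 1). As q tends to 1 at infinity, the bound is
  asymptotically sharp there, so that it still encodes the capacity (\<beta> - \<alpha>) /
  4.\<close>

lemma norm_seg_ext_le:
  assumes z: "z \<notin> seg \<alpha> \<beta>"
  shows "norm (seg_ext \<alpha> \<beta> z) \<le> 2 * (norm (z - of_real \<alpha>) + norm (z - of_real \<beta>)) / (\<beta> - \<alpha>)"
proof -
  let ?q = "seg_root \<alpha> \<beta> z"
  have nz: "z \<noteq> of_real \<beta>" using z less by auto
  have "norm (?q + 1) \<le> norm ?q + 1" using norm_triangle_ineq[of ?q 1] by simp
  then have "(norm (?q + 1))\<^sup>2 \<le> (norm ?q + 1)\<^sup>2" by (intro power_mono) auto
  also have "\<dots> \<le> 2 * ((norm ?q)\<^sup>2 + 1)"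
    using sum_squares_bound[of "norm ?q" 1] by (simp add: power2_eq_square algebra_simps)
  also have "(norm ?q)\<^sup>2 = norm (z - of_real \<alpha>) / norm (z - of_real \<beta>)"
    by (simp add: seg_root_def norm_divide)
  finally have "(norm (?q + 1))\<^sup>2 * norm (z - of_real \<beta>) \<le>
      2 * (norm (z - of_real \<alpha>) / norm (z - of_real \<beta>) + 1) * norm (z - of_real \<beta>)"
    by (intro mult_right_mono) auto
  also have "\<dots> = 2 * (norm (z - of_real \<alpha>) + norm (z - of_real \<beta>))"
    using nz by (simp add: field_simps)
  finally show ?thesis unfolding norm_seg_ext[OF z] using less by (intro divide_right_mono) auto
qed

end

subsection \<open>Comparison with the Green function of a segment\<close>

lemma usc_attains_max:
  fixes u :: "'a::topological_space \<Rightarrow> ereal"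
  assumes usc: "\<forall>y. open {z. u z < y}" and K: "compact K" "K \<noteq> {}"
  shows "\<exists>p\<in>K. \<forall>w\<in>K. u w \<le> u p"
proof (rule ccontr)
  assume "\<not> ?thesis"
  then have "K \<subseteq> (\<Union>p\<in>K. {z. u z < u p})" by (force simp: not_le)
  then obtain F where F: "F \<subseteq> K" "finite F" "K \<subseteq> (\<Union>p\<in>F. {z. u z < u p})"
    using compactE_image[OF K(1), of K "\<lambda>p. {z. u z < u p}"] usc by metis
  have "F \<noteq> {}" using F(3) K(2) by auto
  then have "Max (u ` F) \<in> u ` F" using F(2) by simp
  then obtain p where p: "p \<in> F" "u p = Max (u ` F)" by force
  then obtain q where "q \<in> F" "u p < u q" using F by blast
  then show False using p F(2) by (metis Max_ge finite_imageI image_eqI not_le)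
qed

lemma ennreal_absorb:
  fixes Z :: ennreal
  assumes "ennreal c + Z \<le> ennreal c" "c \<ge> 0"
  shows "Z = 0"
  using assms by (cases Z) (auto simp: top_unique simp flip: ennreal_plus)

text \<open>Since \<open>h\<close> has an exact mean at \<open>p\<close> and \<open>v\<close>
  touches it there, the integral of h - v over the circle vanishes, so v = h almost everywhere on
  it. The arc of angles in (0, pi/2) has positive measure; a contact point on it has a larger real
  part than \<open>p\<close>, which replaces propagation along a connected set in the maximum
  principle.\<close>

lemma subharmonic_touching_majorant:
  assumes v: "subharmonic v" and \<rho>: "0 < r"
    and cont: "continuous_on (cball p r) h"
    and mean: "((\<lambda>t. h (p + rcis r t)) has_integral (2*pi*h p)) {0..2*pi}"
    and le: "\<And>w. w \<in> cball p r \<Longrightarrow> v w \<le> ereal (h w)" and eq: "v p = ereal (h p)"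
  shows "\<exists>t. 0 < t \<and> t < pi/2 \<and> v (p + rcis r t) = ereal (h (p + rcis r t))"
proof -
  have usc: "\<forall>y. open {z. v z < y}" using v by (simp add: subharmonic_def)
  note [measurable] = usc_circle_measurable[OF usc]
  have "bounded (h ` cball p r)"
    using cont by (intro compact_imp_bounded compact_continuous_image) auto
  then obtain B where B: "B > 0" "\<And>w. w \<in> cball p r \<Longrightarrow> h w \<le> B"
    unfolding bounded_pos by (force simp: abs_le_iff)
  have on: "p + rcis r t \<in> cball p r" for t using \<rho> by simp
  have [measurable]: "(\<lambda>t. h (p + rcis r t)) \<in> borel_measurable borel"
    using on by (intro borel_measurable_continuous_onI continuous_on_compose2[OF cont] continuous_intros) auto
  let ?Z = "\<integral>\<^sup>+t. e2ennreal (ereal (h (p + rcis r t)) - v (p + rcis r t)) * indicator {0..2*pi} t \<partial>lborel"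
  have split: "e2ennreal (ereal B - v w) = ennreal (B - h w) + e2ennreal (ereal (h w) - v w)"
    if "w \<in> cball p r" for w
    using le[OF that] B(2)[OF that] by (cases "v w") (auto simp flip: ennreal_plus)
  have I: "((\<lambda>t. B - h (p + rcis r t)) has_integral (2*pi*(B - h p))) {0..2*pi}"
    using has_integral_diff[OF has_integral_const_real[of B 0 "2*pi"] mean] by (simp add: algebra_simps)
  have "circle_deficit v B p r =
     (\<integral>\<^sup>+t. ennreal (B - h (p + rcis r t)) * indicator {0..2*pi} t +
        e2ennreal (ereal (h (p + rcis r t)) - v (p + rcis r t)) * indicator {0..2*pi} t \<partial>lborel)"
    unfolding circle_deficit_def using split[OF on] by (simp add: distrib_right)
  also have "\<dots> = (\<integral>\<^sup>+t\<in>{0..2*pi}. ennreal (B - h (p + rcis r t)) \<partial>lborel) + ?Z"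
    by (rule nn_integral_add) measurable
  also have "(\<integral>\<^sup>+t\<in>{0..2*pi}. ennreal (B - h (p + rcis r t)) \<partial>lborel) = ennreal (2*pi*(B - h p))"
    using \<rho> B I by (intro nn_integral_circle[where h = "\<lambda>w. B - h w"] continuous_intros
        continuous_on_subset[OF cont]) auto
  finally have "ennreal (2*pi*(B - h p)) + ?Z = circle_deficit v B p r" ..
  also have "\<dots> \<le> ennreal (2*pi) * e2ennreal (ereal B - v p)"
  proof (intro subharmonic_deficit v \<rho>)
    show "v w \<le> ereal B" if "w \<in> cball p r" for w
      using le[OF that] B(2)[OF that] by (meson ereal_less_eq(3) order_trans)
  qed (use B in auto)
  also have "\<dots> = ennreal (2*pi*(B - h p))"
    using eq B(2)[of p] \<rho> by (simp add: ennreal_mult)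
  finally have "?Z = 0"
    using B(2)[of p] \<rho> by (intro ennreal_absorb[of "2*pi*(B - h p)"]) auto
  then have AE: "AE t in lborel. e2ennreal (ereal (h (p + rcis r t)) - v (p + rcis r t)) * indicator {0..2*pi} t = 0"
    by (subst (asm) nn_integral_0_iff_AE) measurable
  show ?thesis
  proof (rule ccontr)
    assume neg: "\<not> ?thesis"
    have pos: "0 < e2ennreal (ereal (h (p + rcis r t)) - v (p + rcis r t))" if "0 < t" "t < pi/2" for t
    proof -
      have "v (p + rcis r t) < ereal (h (p + rcis r t))"
        using neg that le[OF on] by (metis order_le_less)
      then show ?thesis by (cases "v (p + rcis r t)") auto
    qed
    have "AE t in lborel. t \<notin> {0<..<pi/2}"
      using AE
    proof (rule eventually_mono, intro notI)
      fix t assume t: "t \<in> {0<..<pi/2}"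
        and 0: "e2ennreal (ereal (h (p + rcis r t)) - v (p + rcis r t)) * indicator {0..2*pi} t = 0"
      then have "t \<in> {0..2*pi}" by auto
      with 0 pos[of t] t show False by simp
    qed
    then have "{0<..<pi/2} \<in> null_sets lborel" by (subst AE_iff_null_sets) auto
    then show False by (simp add: null_sets_def)
  qed
qed

definition seg_green :: "real \<Rightarrow> real \<Rightarrow> complex \<Rightarrow> real" where
  "seg_green \<alpha> \<beta> z = ln (norm (seg_ext \<alpha> \<beta> z))"

text \<open>Continuity of \<open>seg_green\<close> is established only off the segment, whereas
  \<open>subharmonic_green_function\<close> asks for a majorant continuous on the whole plane. This
  one is constant on the ellipses with foci \<alpha> and \<beta>, and its difference from
  \<open>seg_green\<close> tends to 0 at infinity.\<close>

definition seg_majorant :: "real \<Rightarrow> real \<Rightarrow> complex \<Rightarrow> real" where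
  "seg_majorant \<alpha> \<beta> z = ln (2 * (norm (z - of_real \<alpha>) + norm (z - of_real \<beta>)) / (\<beta> - \<alpha>))"

context
  fixes \<alpha> \<beta> :: real
  assumes less: "\<alpha> < \<beta>"
begin

lemma seg_green_nonneg: "seg_green \<alpha> \<beta> z \<ge> 0"
  using norm_seg_ext_ge_1[OF less] by (simp add: seg_green_def)

lemma continuous_seg_green: "continuous_on (- seg \<alpha> \<beta>) (seg_green \<alpha> \<beta>)"
  unfolding seg_green_def using seg_ext_nonzero[OF less]
  by (intro continuous_intros holomorphic_on_imp_continuous_on holomorphic_seg_ext less) auto

lemma seg_green_ge:
  assumes "norm z \<ge> 2 * \<bar>\<beta>\<bar> + 1" "z \<notin> seg \<alpha> \<beta>"
  shows "seg_green \<alpha> \<beta> z \<ge> ln (norm z) - ln (2 * (\<beta> - \<alpha>))"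
proof -
  have "norm z - \<bar>\<beta>\<bar> \<le> norm (z - of_real \<beta>)" using norm_triangle_ineq2[of z "of_real \<beta>"] by simp
  then have 1: "norm z / 2 \<le> norm (z - of_real \<beta>)" using assms by linarith
  have "ln (norm z) - ln (2 * (\<beta> - \<alpha>)) = ln (norm z / (2 * (\<beta> - \<alpha>)))"
    using assms less by (subst ln_div) auto
  also have "\<dots> \<le> ln (norm (z - of_real \<beta>) / (\<beta> - \<alpha>))"
  proof -
    have "norm z / (2 * (\<beta> - \<alpha>)) \<le> norm (z - of_real \<beta>) / (\<beta> - \<alpha>)"
      using divide_right_mono[OF 1, of "\<beta> - \<alpha>"] less by simp
    moreover have "0 < norm z / (2 * (\<beta> - \<alpha>))" using assms less by (intro divide_pos_pos) auto
    ultimately show ?thesis by simp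
  qed
  also have "\<dots> \<le> seg_green \<alpha> \<beta> z"
    unfolding seg_green_def using norm_seg_ext_ge[OF less assms(2)] 1 assms less
    by (subst ln_le_cancel_iff) (auto simp: field_simps)
  finally show ?thesis .
qed

text \<open>The factor 1 + \<epsilon> beats the additive constant in the logarithmic growth, so the
  difference is \<le> 0 near infinity and a positive maximum is attained on a compact set. At the
  point of this set with the largest real part, \<open>subharmonic_touching_majorant\<close>
  supplies another maximum point further to the right.\<close>

lemma bernstein_walsh_eps:
  assumes v: "subharmonic v" "log_growth v" "\<forall>x\<in>seg \<alpha> \<beta>. v x \<le> 0" and \<epsilon>: "\<epsilon> > 0"
    and z: "z \<notin> seg \<alpha> \<beta>"
  shows "v z \<le> ereal ((1 + \<epsilon>) * seg_green \<alpha> \<beta> z)"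
proof (rule ccontr)
  assume neg: "\<not> ?thesis"
  let ?k = "\<lambda>w. (1 + \<epsilon>) * seg_green \<alpha> \<beta> w"
  have usc: "\<forall>y. open {z. v z < y}" and fin: "\<forall>z. v z < \<infinity>" using v by (auto simp: subharmonic_def)
  \<comment> \<open>Keeping \<open>v\<close> itself on the segment avoids any statement about
    \<open>seg_green\<close> near it: there \<phi> \<le> v suffices for upper
    semicontinuity.\<close>
  define \<phi> where "\<phi> w = (if w \<in> seg \<alpha> \<beta> then v w else v w - ereal (?k w))" for w
  have k0: "?k w \<ge> 0" for w using seg_green_nonneg \<epsilon> by simp
  have \<phi>v: "\<phi> w \<le> v w" for w
    using k0[of w] unfolding \<phi>_def by (cases "v w") auto
  have \<phi>fin: "\<phi> w < \<infinity>" for w using \<phi>v fin by (metis le_less_trans)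
  have usc\<phi>: "open {w. \<phi> w < y}" for y
  proof (subst open_subopen, safe)
    fix w assume w: "\<phi> w < y"
    show "\<exists>T. open T \<and> w \<in> T \<and> T \<subseteq> {w. \<phi> w < y}"
    proof (cases "w \<in> seg \<alpha> \<beta>")
      case True
      then have "v w < y" using w by (simp add: \<phi>_def)
      moreover have "{w. v w < y} \<subseteq> {w. \<phi> w < y}" using \<phi>v by (auto intro: le_less_trans)
      ultimately show ?thesis using usc by (intro exI[of _ "{w. v w < y}"]) auto
    next
      case out: False
      show ?thesis
      proof (cases y)
        case PInf
        then show ?thesis using \<phi>fin by (intro exI[of _ UNIV]) auto
      next
        case (real s)
        have "v w < ereal (s + ?k w)" using w out real by (cases "v w") (auto simp: \<phi>_def)
        then obtain y1 where y1: "v w < ereal y1" "ereal y1 < ereal (s + ?k w)"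
          using ereal_dense2 by blast
        let ?T = "{x. v x < ereal y1} \<inter> {x \<in> - seg \<alpha> \<beta>. y1 < s + ?k x}"
        have "open {x \<in> - seg \<alpha> \<beta>. y1 < s + ?k x}"
        proof -
          have "open (- seg \<alpha> \<beta> \<inter> (\<lambda>x. s + ?k x) -` {y1<..})"
            by (intro continuous_open_preimage continuous_intros continuous_seg_green) (auto simp: open_Compl)
          then show ?thesis by (simp add: vimage_def Int_def conj_commute)
        qed
        then have "open ?T" using usc by (intro open_Int) auto
        moreover have "w \<in> ?T" using y1 out by auto
        moreover have "\<phi> x < y" if "x \<in> ?T" for x
          using that real by (cases "v x") (auto simp: \<phi>_def)
        ultimately show ?thesis by blast
      qed (use w in auto)
    qed
  qed
  obtain M where M: "\<And>z. v z \<le> ereal (ln (max 1 (norm z)) + M)"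
    using v(2) by (auto simp: log_growth_def)
  define C where "C = ln (2 * (\<beta> - \<alpha>))"
  \<comment> \<open>The exponential makes \<epsilon> ln |w| absorb \<open>M\<close> and the constant
    of \<open>seg_green_ge\<close>; the other entries meet the hypothesis of that lemma and keep w
    off the segment.\<close>
  define R where "R = max (max (2 * \<bar>\<beta>\<bar> + 1) (max \<bar>\<alpha>\<bar> \<bar>\<beta>\<bar> + 1)) (exp ((M + (1 + \<epsilon>) * C) / \<epsilon>))"
  have out: "\<phi> w \<le> 0" if w: "norm w \<ge> R" for w
  proof -
    have ns: "w \<notin> seg \<alpha> \<beta>" using w by (auto simp: R_def)
    have ge: "norm w \<ge> 2 * \<bar>\<beta>\<bar> + 1" "norm w \<ge> exp ((M + (1 + \<epsilon>) * C) / \<epsilon>)" using w by (auto simp: R_def)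
    have n1: "norm w \<ge> 1" using ge by linarith
    have "(M + (1 + \<epsilon>) * C) / \<epsilon> \<le> ln (norm w)"
      using ge(2) n1 by (subst ln_ge_iff) auto
    then have "M + (1 + \<epsilon>) * C \<le> \<epsilon> * ln (norm w)" using \<epsilon> by (simp add: field_simps)
    moreover have "(1 + \<epsilon>) * (ln (norm w) - C) \<le> ?k w"
      using seg_green_ge[OF ge(1) ns] \<epsilon> unfolding C_def by (intro mult_left_mono) auto
    ultimately have "ln (max 1 (norm w)) + M \<le> ?k w" using n1 by (simp add: algebra_simps max_def)
    then have "v w \<le> ereal (?k w)" using M[of w] by (meson ereal_less_eq(3) order_trans)
    then show ?thesis using ns by (cases "v w") (auto simp: \<phi>_def)
  qed
  have \<phi>z: "\<phi> z > 0" using neg z by (cases "v z") (auto simp: \<phi>_def)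
  let ?K = "cball 0 (max R (norm z)) :: complex set"
  have "z \<in> ?K" by simp
  then have "?K \<noteq> {}" by blast
  then obtain p0 where p0: "p0 \<in> ?K" "\<And>w. w \<in> ?K \<Longrightarrow> \<phi> w \<le> \<phi> p0"
    using usc_attains_max[of \<phi> ?K] usc\<phi> by auto
  have p0pos: "\<phi> p0 > 0" using p0(2)[OF \<open>z \<in> ?K\<close>] \<phi>z by simp
  then obtain m where m: "\<phi> p0 = ereal m" "m > 0"
    using \<phi>fin[of p0] by (cases "\<phi> p0") auto
  have le_m: "\<phi> w \<le> ereal m" for w
  proof (cases "norm w \<ge> R")
    case True
    then show ?thesis using out[of w] m(2) by (meson ereal_less_eq(5) less_imp_le order_trans)
  next
    case False
    then show ?thesis using p0(2)[of w] m by simp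
  qed
  let ?A = "{w. \<phi> w \<ge> ereal m}"
  have "closed ?A" using usc\<phi>[of "ereal m"] by (simp add: closed_def Collect_neg_eq[symmetric] not_le)
  moreover have "?A \<subseteq> ?K"
  proof
    fix w assume "w \<in> ?A"
    then have "\<phi> w > 0" using m(2) by (metis ereal_less(2) less_le_trans mem_Collect_eq)
    then have "norm w < R" using out[of w] by (meson not_le)
    then show "w \<in> ?K" by simp
  qed
  ultimately have "compact ?A" by (meson compact_cball compact_eq_bounded_closed bounded_subset)
  moreover have "?A \<noteq> {}" using m(1) by (auto intro!: exI[of _ p0])
  ultimately obtain p where p: "p \<in> ?A" "\<And>w. w \<in> ?A \<Longrightarrow> Re w \<le> Re p"
    using continuous_attains_sup[of ?A Re] continuous_on_Re[OF continuous_on_id] by blast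
  have p_out: "p \<notin> seg \<alpha> \<beta>"
  proof
    assume s: "p \<in> seg \<alpha> \<beta>"
    then have "ereal m \<le> v p" using p(1) by (simp add: \<phi>_def)
    then have "ereal m \<le> 0" using v(3) s by (meson order_trans)
    then show False using m(2) by simp
  qed
  have "open (- seg \<alpha> \<beta>)" by (simp add: open_Compl)
  then obtain \<delta> where \<delta>: "\<delta> > 0" "ball p \<delta> \<subseteq> - seg \<alpha> \<beta>"
    using p_out open_contains_ball by blast
  define r where "r = \<delta> / 2"
  have r: "0 < r" "r < \<delta>" "cball p r \<subseteq> - seg \<alpha> \<beta>"
    using \<delta> cball_subset_ball_iff[of p r p \<delta>] by (auto simp: r_def intro: order_trans)
  have mean: "((\<lambda>t. seg_green \<alpha> \<beta> (p + rcis r t)) has_integral (2*pi * seg_green \<alpha> \<beta> p)) {0..2*pi}"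
    unfolding seg_green_def using \<delta> r seg_ext_nonzero[OF less]
    by (intro ln_norm_circle_mean[where R=\<delta>] holomorphic_on_subset[OF holomorphic_seg_ext[OF less]]) auto
  have "\<exists>t. 0 < t \<and> t < pi/2 \<and> v (p + rcis r t) = ereal (m + ?k (p + rcis r t))"
  proof (rule subharmonic_touching_majorant[OF v(1) r(1)])
    show "continuous_on (cball p r) (\<lambda>w. m + ?k w)"
      using r(3) by (intro continuous_intros continuous_on_subset[OF continuous_seg_green])
    show "((\<lambda>t. m + ?k (p + rcis r t)) has_integral 2 * pi * (m + ?k p)) {0..2 * pi}"
      using has_integral_add[OF has_integral_const_real[of m 0 "2*pi"] has_integral_mult_right[OF mean, of "1+\<epsilon>"]]
      by (simp add: algebra_simps)
    show "v w \<le> ereal (m + ?k w)" if "w \<in> cball p r" for w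
    proof -
      have "w \<notin> seg \<alpha> \<beta>" using that r by auto
      then show ?thesis using le_m[of w] by (cases "v w") (auto simp: \<phi>_def)
    qed
    show "v p = ereal (m + ?k p)"
      using le_m[of p] p(1) p_out by (cases "v p") (auto simp: \<phi>_def)
  qed
  then obtain t where t: "0 < t" "t < pi/2" "v (p + rcis r t) = ereal (m + ?k (p + rcis r t))" by blast
  have "p + rcis r t \<in> cball p r" using r by simp
  then have "p + rcis r t \<notin> seg \<alpha> \<beta>" using r by blast
  then have "p + rcis r t \<in> ?A" using t(3) by (simp add: \<phi>_def)
  then have "Re (p + rcis r t) \<le> Re p" by (rule p(2))
  moreover have "cos t > 0" using t by (intro cos_gt_zero_pi) auto
  ultimately show False using r by (simp add: mult_le_0_iff)
qed

lemma bernstein_walsh: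
  assumes v: "subharmonic v" "log_growth v" "\<forall>x\<in>seg \<alpha> \<beta>. v x \<le> 0"
  shows "v z \<le> ereal (seg_green \<alpha> \<beta> z)"
proof (cases "z \<in> seg \<alpha> \<beta>")
  case True
  then have "v z \<le> 0" using v by blast
  also have "0 \<le> ereal (seg_green \<alpha> \<beta> z)" using seg_green_nonneg by simp
  finally show ?thesis .
next
  case out: False
  let ?G = "seg_green \<alpha> \<beta> z"
  note eps = bernstein_walsh_eps[OF v _ out]
  show ?thesis
  proof (cases "v z")
    case (real s)
    have "s \<le> ?G"
    proof (rule field_le_epsilon)
      fix e :: real assume "e > 0"
      then have "s \<le> (1 + e / (?G + 1)) * ?G"
        using eps[of "e / (?G + 1)"] seg_green_nonneg[of z] real by simp
      also have "\<dots> \<le> ?G + e"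
        using seg_green_nonneg[of z] \<open>e > 0\<close> by (simp add: field_simps)
      finally show "s \<le> ?G + e" .
    qed
    then show ?thesis using real by simp
  next
    case PInf
    then show ?thesis using v(1) by (metis subharmonic_def less_irrefl)
  qed auto
qed

lemma extremal_le_seg_green:
  assumes "seg \<alpha> \<beta> \<subseteq> X"
  shows "extremal_function X z \<le> ereal (seg_green \<alpha> \<beta> z)"
  unfolding extremal_function_def using assms bernstein_walsh by (intro Sup_least) blast

lemma norm_sum_ge: "norm (z - complex_of_real \<alpha>) + norm (z - of_real \<beta>) \<ge> \<beta> - \<alpha>"
  using norm_triangle_ineq4[of "z - of_real \<alpha>" "z - of_real \<beta>"] less
  by (simp add: norm_of_real flip: of_real_diff)

lemma continuous_seg_majorant: "continuous_on UNIV (seg_majorant \<alpha> \<beta>)"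
proof -
  have "norm (z - complex_of_real \<alpha>) + norm (z - of_real \<beta>) > 0" for z
    using norm_sum_ge[of z] less by linarith
  then show ?thesis unfolding seg_majorant_def using less
    by (intro continuous_intros) (metis divide_pos_pos diff_gt_0_iff_gt less_irrefl mult_pos_pos zero_less_numeral)+
qed

lemma le_seg_majorant:
  assumes v: "subharmonic v" "log_growth v" "\<forall>x\<in>seg \<alpha> \<beta>. v x \<le> 0"
  shows "v z \<le> ereal (seg_majorant \<alpha> \<beta> z)"
proof (cases "z \<in> seg \<alpha> \<beta>")
  case True
  then have "v z \<le> 0" using v by blast
  also have "0 \<le> ereal (seg_majorant \<alpha> \<beta> z)"
    unfolding seg_majorant_def using norm_sum_ge[of z] less
    by (auto intro!: ln_ge_zero simp: field_simps)
  finally show ?thesis .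
next
  case False
  have "seg_green \<alpha> \<beta> z \<le> seg_majorant \<alpha> \<beta> z"
    unfolding seg_green_def seg_majorant_def
    using norm_seg_ext_le[OF less False] norm_seg_ext_ge_1[OF less, of z]
    by (subst ln_le_cancel_iff) auto
  then show ?thesis using bernstein_walsh[OF v, of z] by (meson ereal_less_eq(3) order_trans)
qed

lemma subharmonic_green_function_seg:
  assumes "seg \<alpha> \<beta> \<subseteq> X"
  shows "subharmonic (green_function X)"
proof (rule subharmonic_green_function[OF continuous_seg_majorant])
  show "extremal_function X z \<le> ereal (seg_majorant \<alpha> \<beta> z)" for z
    unfolding extremal_function_def using assms le_seg_majorant by (intro Sup_least) blast
qed

lemma isCont_csqrt_0: "isCont csqrt 0"
proof -
  have "((\<lambda>z::complex. sqrt (norm z)) \<longlongrightarrow> sqrt (norm (0::complex))) (at 0)"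
    by (rule tendsto_real_sqrt[OF tendsto_norm[OF tendsto_ident_at]])
  then have "((\<lambda>z. norm (csqrt z)) \<longlongrightarrow> 0) (at 0)"
    by (simp only: norm_csqrt norm_zero real_sqrt_zero)
  then have "(csqrt \<longlongrightarrow> 0) (at 0)" by (rule tendsto_norm_zero_cancel)
  then show ?thesis unfolding isCont_def by (simp only: csqrt_0)
qed

text \<open>Although 0 lies on the branch cut of \<open>csqrt\<close>, |csqrt z| = sqrt |z| makes it
  continuous there; hence the segment's Green function is continuous at the left end, with value 0.
  At the right end the quotient has a pole, so only left ends are treated. Every x in [\<alpha>,
  \<beta>) is the left end of [x, \<beta>].\<close>

lemma green_function_seg_end:
  assumes "seg \<alpha> \<beta> \<subseteq> X"
  shows "green_function X (of_real \<alpha>) = 0"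
proof -
  have ne: "complex_of_real \<alpha> - of_real \<beta> \<noteq> 0" using less by auto
  have "isCont (\<lambda>z. csqrt ((z - of_real \<alpha>) / (z - of_real \<beta>))) (of_real \<alpha>)"
    by (rule isCont_o2[where g = csqrt]) (use ne isCont_csqrt_0 in \<open>auto intro!: continuous_intros\<close>)
  moreover have "seg_root \<alpha> \<beta> (of_real \<alpha>) = 0" by (simp add: seg_root_def)
  ultimately have "isCont (seg_green \<alpha> \<beta>) (of_real \<alpha>)"
    unfolding seg_green_def seg_ext_def seg_root_def by (intro continuous_intros) auto
  then have "green_function X (of_real \<alpha>) \<le> ereal (seg_green \<alpha> \<beta> (of_real \<alpha>))"
    using extremal_le_seg_green[OF assms] by (intro green_function_le) auto
  also have "seg_green \<alpha> \<beta> (of_real \<alpha>) = 0"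
    by (simp add: seg_green_def seg_ext_def seg_root_def)
  finally show ?thesis using green_function_nonneg[of X "of_real \<alpha>"] by (simp add: zero_ereal_def)
qed

end

lemma green_function_interior:
  assumes "z \<in> interior X"
  shows "green_function X z = 0"
proof -
  have "extremal_function X w \<le> ereal 0" if "w \<in> X" for w
    unfolding extremal_function_def using that by (intro Sup_least) (auto simp: zero_ereal_def)
  then have "eventually (\<lambda>w. extremal_function X w \<le> ereal 0) (nhds z)"
    using assms by (auto simp: eventually_nhds interior_def)
  then have "green_function X z \<le> ereal 0" by (intro green_function_le) auto
  then show ?thesis using green_function_nonneg[of X z] by (simp add: zero_ereal_def)
qed

subsection \<open>The fine topology refines the Euclidean topology\<close>

lemma openin_fine_vimage: "subharmonic u \<Longrightarrow> open U \<Longrightarrow> openin fine_topology (u -` U)"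
  unfolding fine_topology_def by (intro topology_generated_by_Basis) auto

text \<open>The sublevel sets of this function are the Euclidean discs about \<open>p\<close>, which
  are therefore finely open.\<close>

lemma subharmonic_norm_diff: "subharmonic (\<lambda>w. ereal (norm (w - p)))"
proof (rule subharmonicI_continuous)
  fix z and r :: real assume r: "r > 0"
  have I: "((\<lambda>t. (z + rcis r t) - p) has_integral (2*pi*(z - p))) {0..2*pi}"
    using r by (intro holomorphic_circle_mean) (auto intro!: holomorphic_intros)
  have "norm (integral {0..2*pi} (\<lambda>t. (z + rcis r t) - p)) \<le> integral {0..2*pi} (\<lambda>t. norm ((z + rcis r t) - p))"
    using I by (intro integral_norm_bound_integral integrable_continuous_real continuous_intros)
      (auto simp: has_integral_integrable)
  then show "2 * pi * norm (z - p) \<le> integral {0..2*pi} (\<lambda>t. norm ((z + rcis r t) - p))"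
    using integral_unique[OF I] by (simp add: norm_mult)
qed (intro continuous_intros)

lemma openin_fine_open:
  assumes "open U"
  shows "openin fine_topology U"
proof (subst openin_subopen, intro ballI)
  fix x assume "x \<in> U"
  then obtain e where e: "e > 0" "ball x e \<subseteq> U" using assms open_contains_ball by blast
  have "openin fine_topology ((\<lambda>w. ereal (norm (w - x))) -` {..<ereal e})"
    by (intro openin_fine_vimage subharmonic_norm_diff) auto
  also have "(\<lambda>w. ereal (norm (w - x))) -` {..<ereal e} = ball x e"
    by (auto simp: dist_norm norm_minus_commute)
  finally show "\<exists>T. openin fine_topology T \<and> x \<in> T \<and> T \<subseteq> U" using e by (intro exI[of _ "ball x e"]) auto
qed

subsection \<open>Uniform approximation by rational functions\<close>

text \<open>The approximation in \<open>finely_holomorphic_on\<close> with an error bound instead of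
  sequences, so that limits and products need no diagonal choice.\<close>

definition rational_approx :: "complex set \<Rightarrow> (complex \<Rightarrow> complex) \<Rightarrow> bool" where
  "rational_approx K f \<longleftrightarrow> (\<forall>e>0. \<exists>p q. (\<forall>w\<in>K. poly q w \<noteq> 0) \<and>
     (\<forall>w\<in>K. norm (poly p w / poly q w - f w) < e))"

lemma rational_approx_ratio:
  assumes "\<And>w. w \<in> K \<Longrightarrow> poly q w \<noteq> 0" "\<And>w. w \<in> K \<Longrightarrow> f w = poly p w / poly q w"
  shows "rational_approx K f"
  unfolding rational_approx_def
proof (intro allI impI exI conjI ballI)
  fix e :: real and w assume "e > 0" "w \<in> K"
  then show "poly q w \<noteq> 0" "norm (poly p w / poly q w - f w) < e" using assms by auto
qed

lemma rational_approx_const: "rational_approx K (\<lambda>_. c)"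
  by (rule rational_approx_ratio[of K 1 _ "[:c:]"]) auto

lemma rational_approx_uniform_limitD:
  assumes "rational_approx K f"
  shows "\<exists>p q :: nat \<Rightarrow> complex poly. (\<forall>n. \<forall>w\<in>K. poly (q n) w \<noteq> 0) \<and>
     uniform_limit K (\<lambda>n w. poly (p n) w / poly (q n) w) f sequentially"
proof -
  have "\<forall>n. \<exists>p q. (\<forall>w\<in>K. poly q w \<noteq> 0) \<and> (\<forall>w\<in>K. norm (poly p w / poly q w - f w) < inverse (real (Suc n)))"
    using assms unfolding rational_approx_def by (metis inverse_positive_iff_positive of_nat_0_less_iff zero_less_Suc)
  then obtain p q :: "nat \<Rightarrow> complex poly" where pq: "\<And>n w. w \<in> K \<Longrightarrow> poly (q n) w \<noteq> 0"
      "\<And>n w. w \<in> K \<Longrightarrow> norm (poly (p n) w / poly (q n) w - f w) < inverse (real (Suc n))"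
    by metis
  have "uniform_limit K (\<lambda>n w. poly (p n) w / poly (q n) w) f sequentially"
  proof (rule uniform_limitI)
    fix e :: real assume "e > 0"
    then have "\<forall>\<^sub>F n in sequentially. inverse (real (Suc n)) < e"
      by (intro order_tendstoD(2)[OF LIMSEQ_inverse_real_of_nat])
    then show "\<forall>\<^sub>F n in sequentially. \<forall>w\<in>K. dist (poly (p n) w / poly (q n) w) (f w) < e"
    proof eventually_elim
      case (elim n)
      then show ?case using pq(2)[of _ n] by (auto simp only: dist_norm intro: less_trans)
    qed
  qed
  then show ?thesis using pq(1) by blast
qed

lemma rational_approx_uniform_limit:
  assumes lim: "uniform_limit K F f sequentially" and F: "\<And>n. rational_approx K (F n)"
  shows "rational_approx K f"
  unfolding rational_approx_def
proof (intro allI impI)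
  fix e :: real assume "e > 0"
  then have "\<forall>\<^sub>F n in sequentially. \<forall>w\<in>K. dist (F n w) (f w) < e / 2"
    by (intro uniform_limitD[OF lim]) auto
  then obtain n where n: "\<And>w. w \<in> K \<Longrightarrow> norm (F n w - f w) < e / 2"
    unfolding eventually_sequentially dist_norm by blast
  obtain p q where pq: "\<forall>w\<in>K. poly q w \<noteq> 0" "\<forall>w\<in>K. norm (poly p w / poly q w - F n w) < e / 2"
    using F[of n] \<open>e > 0\<close> unfolding rational_approx_def by (meson half_gt_zero)
  have "norm (poly p w / poly q w - f w) < e" if "w \<in> K" for w
    using norm_triangle_ineq[of "poly p w / poly q w - F n w" "F n w - f w"] n[OF that] pq(2) that
    by fastforce
  then show "\<exists>p q. (\<forall>w\<in>K. poly q w \<noteq> 0) \<and> (\<forall>w\<in>K. norm (poly p w / poly q w - f w) < e)"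
    using pq(1) by blast
qed

lemma rational_approx_mult:
  assumes f: "rational_approx K f" and g: "rational_approx K g"
    and bf: "bounded (f ` K)" and bg: "bounded (g ` K)"
  shows "rational_approx K (\<lambda>w. f w * g w)"
  unfolding rational_approx_def
proof (intro allI impI)
  fix e :: real assume "e > 0"
  obtain B where B: "B > 0" "\<And>w. w \<in> K \<Longrightarrow> norm (f w) \<le> B" using bf unfolding bounded_pos by auto
  obtain C where C: "C > 0" "\<And>w. w \<in> K \<Longrightarrow> norm (g w) \<le> C" using bg unfolding bounded_pos by auto
  \<comment> \<open>The product of the approximants errs by at most (1 + B) d + C d, which is below
    d (B + C + 2).\<close>
  define d where "d = min 1 (e / (B + C + 2))"
  have d: "d > 0" "d \<le> 1" "d * (B + C + 2) \<le> e"
  proof -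
    have pos: "B + C + 2 > 0" using B(1) C(1) by simp
    then show "d > 0" "d \<le> 1" using \<open>e > 0\<close> by (auto simp: d_def)
    have "d \<le> e / (B + C + 2)" by (simp add: d_def)
    then show "d * (B + C + 2) \<le> e" using pos by (simp add: pos_le_divide_eq)
  qed
  obtain p q where pq: "\<forall>w\<in>K. poly q w \<noteq> 0" "\<forall>w\<in>K. norm (poly p w / poly q w - f w) < d"
    using f d(1) unfolding rational_approx_def by meson
  obtain p' q' where pq': "\<forall>w\<in>K. poly q' w \<noteq> 0" "\<forall>w\<in>K. norm (poly p' w / poly q' w - g w) < d"
    using g d(1) unfolding rational_approx_def by meson
  have "norm (poly (p * p') w / poly (q * q') w - f w * g w) < e" if w: "w \<in> K" for w
  proof -
    let ?f = "poly p w / poly q w" and ?g = "poly p' w / poly q' w"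
    have 1: "norm (?f - f w) \<le> d" "norm (?g - g w) \<le> d" using pq pq' w by (auto intro: less_imp_le)
    have "norm ?f \<le> norm (?f - f w) + norm (f w)" by (metis diff_add_cancel norm_triangle_ineq)
    also have "\<dots> \<le> 1 + B" using 1 d(2) B(2)[OF w] by linarith
    finally have 2: "norm ?f \<le> 1 + B" .
    have "poly (p * p') w / poly (q * q') w - f w * g w = ?f * (?g - g w) + g w * (?f - f w)"
      by (simp add: algebra_simps)
    also have "norm \<dots> \<le> norm ?f * norm (?g - g w) + norm (g w) * norm (?f - f w)"
      by (metis norm_mult norm_triangle_ineq)
    also have "\<dots> \<le> (1 + B) * d + C * d"
      using 1 2 C(2)[OF w] B(1) C(1) by (intro add_mono mult_mono) auto
    also have "\<dots> < d * (B + C + 2)" using d(1) by (simp add: algebra_simps)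
    finally show ?thesis using d(3) by linarith
  qed
  then show "\<exists>p q. (\<forall>w\<in>K. poly q w \<noteq> 0) \<and> (\<forall>w\<in>K. norm (poly p w / poly q w - f w * g w) < e)"
    using pq(1) pq'(1) by (intro exI[of _ "p * p'"] exI[of _ "q * q'"]) auto
qed

lemma rational_approx_mult_compact:
  assumes "compact K" "rational_approx K f" "rational_approx K g" "continuous_on K f" "continuous_on K g"
  shows "rational_approx K (\<lambda>w. f w * g w)"
  using assms by (intro rational_approx_mult compact_imp_bounded compact_continuous_image)

lemma rational_approx_prod:
  assumes "compact K" "finite I" "\<And>i. i \<in> I \<Longrightarrow> rational_approx K (f i)"
    "\<And>i. i \<in> I \<Longrightarrow> continuous_on K (f i)"
  shows "rational_approx K (\<lambda>w. \<Prod>i\<in>I. f i w)"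
  using assms(2-)
proof (induction I rule: finite_induct)
  case (insert i I)
  then have "rational_approx K (\<lambda>w. f i w * (\<Prod>i\<in>I. f i w))"
    by (intro rational_approx_mult_compact assms(1) continuous_intros) auto
  then show ?case using insert by simp
qed (simp add: rational_approx_const)

text \<open>Newton's iteration converges to \<open>csqrt X\<close> off the negative axis, and its iterates are rational in \<open>X\<close>.\<close>

fun newton_root :: "complex \<Rightarrow> nat \<Rightarrow> complex" where
  "newton_root X 0 = 1"
| "newton_root X (Suc n) = (newton_root X n + X / newton_root X n) / 2"

text \<open>In the coordinate (N - s) / (N + s) a Newton step N \<mapsto> (N + s^2 / N) / 2 is
  squaring. The starting value 1 has the coordinate \<rho>, and \<rho> lies in the unit disc because
  s lies in the right half plane.\<close>

lemma newton_root_eq: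
  assumes s: "Re s > 0" and \<rho>: "\<rho> = (1 - s) / (1 + s)"
  shows "norm \<rho> < 1"
    and "newton_root (s\<^sup>2) n = s * (1 + \<rho> ^ (2 ^ n)) / (1 - \<rho> ^ (2 ^ n))"
proof -
  have s1: "1 + s \<noteq> 0" using s by (metis Re_complex_of_real add.commute add_eq_0_iff2 less_irrefl neg_0_less_iff_less not_one_less_zero of_real_1 of_real_minus order.strict_trans)
  have "norm (1 - s) < norm (1 + s)"
    unfolding cmod_def using s by (intro real_sqrt_less_mono) (auto simp: power2_eq_square algebra_simps)
  then show 1: "norm \<rho> < 1" using s1 by (simp add: \<rho> norm_divide)
  have s0: "s \<noteq> 0" using s by auto
  show "newton_root (s\<^sup>2) n = s * (1 + \<rho> ^ (2 ^ n)) / (1 - \<rho> ^ (2 ^ n))"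
  proof (induction n)
    case 0
    have "1 + \<rho> = 2 / (1 + s)" "1 - \<rho> = 2 * s / (1 + s)" using s1 by (auto simp: \<rho> field_simps)
    then show ?case using s0 s1 by simp
  next
    case (Suc n)
    define r where "r = \<rho> ^ (2 ^ n)"
    have "norm r < 1" using 1 by (simp add: r_def norm_power power_less_one_iff)
    then have r: "1 + r \<noteq> 0" "1 - r \<noteq> 0"
      by (metis add_eq_0_iff2 norm_minus_cancel norm_one less_irrefl, force)
    then have r': "(1 + r) * (1 - r) \<noteq> 0" by simp
    have r2: "\<rho> ^ (2 ^ Suc n) = r * r" by (simp add: r_def power_add mult_2)
    have "newton_root (s\<^sup>2) (Suc n) = (s * (1 + r) / (1 - r) + s\<^sup>2 / (s * (1 + r) / (1 - r))) / 2"
      using Suc by (simp add: r_def)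
    also have "s\<^sup>2 / (s * (1 + r) / (1 - r)) = s * (1 - r) / (1 + r)"
      using s0 by (simp add: power2_eq_square)
    also have "s * (1 + r) / (1 - r) + s * (1 - r) / (1 + r) = s * ((1 + r) * (1 + r) + (1 - r) * (1 - r)) / ((1 + r) * (1 - r))"
      using r by (simp add: divide_simps) (simp add: algebra_simps)
    also have "(1 + r) * (1 + r) + (1 - r) * (1 - r) = 2 * (1 + r * r)" by (simp add: algebra_simps)
    also have "(1 + r) * (1 - r) = 1 - r * r" by (simp add: algebra_simps)
    also have "s * (2 * (1 + r * r)) / (1 - r * r) / 2 = s * (1 + r * r) / (1 - r * r)"
    proof -
      have "s * (2 * x) / y / 2 = s * x / y" for x y :: complex by simp
      then show ?thesis .
    qed
    finally show ?case unfolding r2 .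
  qed
qed

lemma newton_root_nonzero:
  assumes "X \<notin> \<real>\<^sub>\<le>\<^sub>0"
  shows "newton_root X n \<noteq> 0"
proof -
  define s where "s = csqrt X"
  define \<rho> where "\<rho> = (1 - s) / (1 + s)"
  have s: "Re s > 0" "s\<^sup>2 = X" unfolding s_def using Re_csqrt_pos[OF assms] by (simp_all only: power2_csqrt)
  note N = newton_root_eq[OF s(1) \<rho>_def]
  have "norm (\<rho> ^ (2 ^ n)) < 1" using N(1) by (simp add: norm_power power_less_one_iff)
  then have "1 + \<rho> ^ (2 ^ n) \<noteq> 0" "1 - \<rho> ^ (2 ^ n) \<noteq> 0"
    by (metis add_eq_0_iff2 norm_minus_cancel norm_one less_irrefl, force)
  moreover have "s \<noteq> 0" using s by auto
  ultimately show ?thesis using N(2)[of n] s(2) by simp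
qed

text \<open>The numerator is kept nonzero along the induction because it is a factor of the next
  denominator.\<close>

lemma newton_root_rational:
  assumes B: "\<And>w. w \<in> K \<Longrightarrow> poly B w \<noteq> 0" and X: "\<And>w. w \<in> K \<Longrightarrow> poly A w / poly B w \<notin> \<real>\<^sub>\<le>\<^sub>0"
  shows "\<exists>p q. \<forall>w\<in>K. poly p w \<noteq> 0 \<and> poly q w \<noteq> 0 \<and>
    newton_root (poly A w / poly B w) n = poly p w / poly q w"
proof (induction n)
  case 0
  show ?case by (intro exI[of _ 1]) auto
next
  case (Suc n)
  then obtain p q where pq: "\<And>w. w \<in> K \<Longrightarrow> poly p w \<noteq> 0" "\<And>w. w \<in> K \<Longrightarrow> poly q w \<noteq> 0"
    "\<And>w. w \<in> K \<Longrightarrow> newton_root (poly A w / poly B w) n = poly p w / poly q w" by metis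
  define P where "P = p * p * B + A * q * q"
  define Q where "Q = smult 2 (p * q * B)"
  have "poly P w \<noteq> 0 \<and> poly Q w \<noteq> 0 \<and> newton_root (poly A w / poly B w) (Suc n) = poly P w / poly Q w"
    if w: "w \<in> K" for w
  proof -
    have Q: "poly Q w \<noteq> 0" using pq(1,2)[OF w] B[OF w] by (simp add: Q_def)
    have eq: "newton_root (poly A w / poly B w) (Suc n) = poly P w / poly Q w"
    proof -
      have nz: "poly p w \<noteq> 0" "poly q w \<noteq> 0" "poly B w \<noteq> 0" using pq[OF w] B[OF w] by auto
      have "poly p w / poly q w + poly A w / poly B w / (poly p w / poly q w)
        = poly P w / (poly p w * poly q w * poly B w)"
        using nz by (simp add: P_def divide_simps)
      then show ?thesis using pq(3)[OF w] nz by (simp add: Q_def)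
    qed
    moreover have "newton_root (poly A w / poly B w) (Suc n) \<noteq> 0"
      using X[OF w] by (rule newton_root_nonzero)
    ultimately show ?thesis using Q by auto
  qed
  then show ?case by blast
qed

text \<open>By compactness |\<rho>| has a bound R < 1 on \<open>K\<close>, which makes the
  convergence of Newton's iteration uniform. The true rate R^(2^n) is weakened to R^n.\<close>

lemma rational_approx_csqrt:
  assumes K: "compact K" and B: "\<And>w. w \<in> K \<Longrightarrow> poly B w \<noteq> 0"
    and X: "\<And>w. w \<in> K \<Longrightarrow> poly A w / poly B w \<notin> \<real>\<^sub>\<le>\<^sub>0"
  shows "continuous_on K (\<lambda>w. csqrt (poly A w / poly B w))"
    and "rational_approx K (\<lambda>w. csqrt (poly A w / poly B w))"
proof -
  define s where "s w = csqrt (poly A w / poly B w)" for w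
  have s: "Re (s w) > 0" "(s w)\<^sup>2 = poly A w / poly B w" if "w \<in> K" for w
    unfolding s_def using Re_csqrt_pos[OF X[OF that]] by (simp_all only: power2_csqrt)
  have "continuous_on K s" unfolding s_def
    using B X by (intro continuous_on_compose2[OF continuous_on_csqrt] continuous_intros) auto
  then show "continuous_on K (\<lambda>w. csqrt (poly A w / poly B w))" unfolding s_def .
  have ne: "1 + s w \<noteq> 0" if "w \<in> K" for w
    using s(1)[OF that] by (metis add_eq_0_iff2 less_asym minus_complex.simps(1) neg_0_less_iff_less one_complex.simps(1) uminus_complex.simps(1) zero_less_one)
  define \<rho> where "\<rho> w = (1 - s w) / (1 + s w)" for w
  have c\<rho>: "continuous_on K (\<lambda>w. norm (\<rho> w))"
    unfolding \<rho>_def using ne by (intro continuous_intros \<open>continuous_on K s\<close>) auto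
  have \<rho>1: "norm (\<rho> w) < 1" if "w \<in> K" for w
    using newton_root_eq(1)[OF s(1)[OF that] \<rho>_def] .
  obtain R where R: "0 \<le> R" "R < 1" "\<And>w. w \<in> K \<Longrightarrow> norm (\<rho> w) \<le> R"
  proof (cases "K = {}")
    case True
    then show thesis using that[of 0] by auto
  next
    case False
    then obtain p where "p \<in> K" "\<And>w. w \<in> K \<Longrightarrow> norm (\<rho> w) \<le> norm (\<rho> p)"
      using continuous_attains_sup[OF K False c\<rho>] by blast
    then show thesis using that[of "norm (\<rho> p)"] \<rho>1 by auto
  qed
  have "bounded (s ` K)" using \<open>continuous_on K s\<close> K by (intro compact_imp_bounded compact_continuous_image)
  then obtain S where S: "S > 0" "\<And>w. w \<in> K \<Longrightarrow> norm (s w) \<le> S" unfolding bounded_pos by auto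
  have bound: "norm (newton_root (poly A w / poly B w) n - s w) \<le> 2 * S / (1 - R) * R ^ n" if w: "w \<in> K" for w n
  proof -
    define r where "r = \<rho> w ^ (2 ^ n)"
    have "norm r \<le> R ^ (2 ^ n)" using R(3)[OF w] by (simp add: r_def norm_power power_mono)
    also have "\<dots> \<le> R ^ n" using R by (intro power_decreasing) (auto simp: less_imp_le[OF less_exp])
    finally have r1: "norm r \<le> R ^ n" .
    have "norm r \<le> R"
      using power_decreasing[of 1 "2 ^ n" "norm (\<rho> w)"] \<rho>1[OF w] R(3)[OF w]
      by (simp add: r_def norm_power)
    then have "1 - R \<le> norm (1 - r)" using norm_triangle_ineq2[of 1 r] by simp
    have nr: "1 - r \<noteq> 0" using \<open>norm r \<le> R\<close> R(2) by auto
    have "newton_root (poly A w / poly B w) n - s w = s w * (1 + r) / (1 - r) - s w"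
      using newton_root_eq(2)[OF s(1)[OF w] \<rho>_def, of n] s(2)[OF w] by (simp add: r_def)
    also have "\<dots> = 2 * s w * r / (1 - r)" using nr by (simp add: field_simps)
    also have "norm \<dots> = 2 * norm (s w) * norm r / norm (1 - r)" by (simp add: norm_mult norm_divide)
    also have "\<dots> \<le> 2 * S * R ^ n / (1 - R)"
      using S r1 R \<open>1 - R \<le> norm (1 - r)\<close> w by (intro frac_le mult_mono) auto
    finally show ?thesis by simp
  qed
  have lim: "uniform_limit K (\<lambda>n w. newton_root (poly A w / poly B w) n) s sequentially"
  proof (rule uniform_limitI)
    fix e :: real assume "e > 0"
    have "(\<lambda>n. 2 * S / (1 - R) * R ^ n) \<longlonglongrightarrow> 2 * S / (1 - R) * 0"
      using R by (intro tendsto_intros LIMSEQ_power_zero) auto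
    then have "\<forall>\<^sub>F n in sequentially. 2 * S / (1 - R) * R ^ n < e"
      using \<open>e > 0\<close> by (intro order_tendstoD(2)) auto
    then show "\<forall>\<^sub>F n in sequentially. \<forall>w\<in>K. dist (newton_root (poly A w / poly B w) n) (s w) < e"
    proof eventually_elim
      case (elim n)
      then show ?case using bound[of _ n] unfolding dist_norm by (meson le_less_trans)
    qed
  qed
  have "rational_approx K (\<lambda>w. newton_root (poly A w / poly B w) n)" for n
  proof -
    obtain p q where "\<And>w. w \<in> K \<Longrightarrow> poly q w \<noteq> 0 \<and> newton_root (poly A w / poly B w) n = poly p w / poly q w"
      using newton_root_rational[of K B A n, OF B X] by blast
    then show ?thesis by (intro rational_approx_ratio[of K q _ p]) auto
  qed
  then have "rational_approx K s" using rational_approx_uniform_limit[OF lim] by blast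
  then show "rational_approx K (\<lambda>w. csqrt (poly A w / poly B w))" unfolding s_def .
qed

subsection \<open>Infinite products\<close>

text \<open>The bound is asked only from \<open>n0\<close> on, since finitely many factors may be
  far from 1 on \<open>K\<close>.\<close>

lemma uniform_limit_prodinf_complex:
  fixes f :: "nat \<Rightarrow> complex \<Rightarrow> complex"
  assumes K: "compact K" and cont: "\<And>n. continuous_on K (f n)"
    and M: "summable M" "\<And>n w. n \<ge> n0 \<Longrightarrow> w \<in> K \<Longrightarrow> norm (f n w - 1) \<le> M n"
  shows "uniform_limit K (\<lambda>N w. \<Prod>n<N. f n w) (\<lambda>w. \<Prod>n. f n w) sequentially"
    and "\<And>w. w \<in> K \<Longrightarrow> convergent_prod (\<lambda>n. f n w)"
proof -
  have "\<forall>\<^sub>F n in sequentially. \<forall>w\<in>K. norm (norm (f n w - 1)) \<le> M n"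
    using M(2) by (intro eventually_sequentiallyI[of n0]) auto
  then have "uniform_limit K (\<lambda>n w. \<Sum>i<n. norm (f i w - 1)) (\<lambda>w. \<Sum>i. norm (f i w - 1)) sequentially"
    using M(1) by (rule Weierstrass_m_test_ev)
  then have "uniformly_convergent_on K (\<lambda>n w. \<Sum>i<n. norm (f i w - 1))"
    by (rule uniformly_convergentI)
  then have "uniformly_convergent_on K (\<lambda>N w. \<Prod>n<N. f n w)"
    using K cont by (intro uniformly_convergent_on_prod')
  then have lim: "uniform_limit K (\<lambda>N w. \<Prod>n<N. f n w) (\<lambda>w. lim (\<lambda>N. \<Prod>n<N. f n w)) sequentially"
    by (rule uniformly_convergent_uniform_limit_iff[THEN iffD1])
  show conv: "convergent_prod (\<lambda>n. f n w)" if "w \<in> K" for w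
  proof -
    have "summable (\<lambda>n. norm (f n w - 1))"
      using M(2)[OF _ that] by (intro summable_comparison_test'[OF M(1), of n0]) auto
    then show ?thesis
      by (intro abs_convergent_prod_imp_convergent_prod summable_imp_abs_convergent_prod)
  qed
  have "(\<Prod>n. f n w) = lim (\<lambda>N. \<Prod>n<N. f n w)" if "w \<in> K" for w
  proof -
    have "(\<lambda>N. \<Prod>n<Suc N. f n w) \<longlonglongrightarrow> (\<Prod>n. f n w)"
      using convergent_prod_LIMSEQ[OF conv[OF that]] by (simp only: lessThan_Suc_atMost)
    then have "(\<lambda>N. \<Prod>n<N. f n w) \<longlonglongrightarrow> (\<Prod>n. f n w)"
      by (rule LIMSEQ_imp_Suc[where f = "\<lambda>N. \<Prod>n<N. f n w"])
    then show ?thesis by (simp add: limI)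
  qed
  then show "uniform_limit K (\<lambda>N w. \<Prod>n<N. f n w) (\<lambda>w. \<Prod>n. f n w) sequentially"
    by (intro uniform_limit_cong'[THEN iffD2, OF _ _ lim]) auto
qed

text \<open>With q the root, |q - 1| |q + 1| = |x - 1| and Re q \<ge> 0 gives |q + 1| \<ge> 1. A
  summable bound for the factors thus also serves for their roots.\<close>

lemma norm_csqrt_minus_1: "norm (csqrt x - 1) \<le> norm (x - 1)"
proof -
  define q where "q = csqrt x"
  have q: "Re q \<ge> 0" "q\<^sup>2 = x" by (simp_all only: q_def Re_csqrt power2_csqrt)
  have "1 \<le> Re (q + 1)" using q by simp
  also have "\<dots> \<le> norm (q + 1)" by (rule complex_Re_le_cmod)
  finally have "norm (q - 1) * 1 \<le> norm (q - 1) * norm (q + 1)" by (intro mult_left_mono) auto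
  also have "\<dots> = norm ((q - 1) * (q + 1))" by (simp add: norm_mult)
  also have "(q - 1) * (q + 1) = x - 1" using q(2) by (simp add: power2_eq_square algebra_simps)
  finally show ?thesis by (simp add: q_def)
qed

lemma rational_approx_prodinf:
  assumes K: "compact K" and cont: "\<And>n. continuous_on K (f n)" and ra: "\<And>n. rational_approx K (f n)"
    and M: "summable M" "\<And>n w. n \<ge> n0 \<Longrightarrow> w \<in> K \<Longrightarrow> norm (f n w - 1) \<le> M n"
  shows "continuous_on K (\<lambda>w. \<Prod>n. f n w)" "rational_approx K (\<lambda>w. \<Prod>n. f n w)"
proof -
  note lim = uniform_limit_prodinf_complex(1)[OF K cont M]
  show "continuous_on K (\<lambda>w. \<Prod>n. f n w)"
    using cont by (intro uniform_limit_theorem[OF _ lim] always_eventually) (auto intro!: continuous_intros)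
  show "rational_approx K (\<lambda>w. \<Prod>n. f n w)"
    using K cont ra by (intro rational_approx_uniform_limit[OF lim] rational_approx_prod) auto
qed

subsection \<open>The products\<close>

lemma finely_holomorphic_onI:
  assumes "\<And>z. z \<in> \<Omega> \<Longrightarrow> \<exists>K W. compact K \<and> K \<subseteq> \<Omega> \<and> openin fine_topology W \<and> z \<in> W \<and> W \<subseteq> K \<and>
      rational_approx K f"
  shows "finely_holomorphic_on f \<Omega>"
  unfolding finely_holomorphic_on_def
proof (intro conjI ballI)
  show "openin fine_topology \<Omega>"
  proof (subst openin_subopen, intro ballI)
    fix z assume "z \<in> \<Omega>"
    from assms[OF this] show "\<exists>T. openin fine_topology T \<and> z \<in> T \<and> T \<subseteq> \<Omega>"
    proof (elim exE conjE)
      fix K W assume "K \<subseteq> \<Omega>" "openin fine_topology W" "z \<in> W" "W \<subseteq> K"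
      then show ?thesis by (intro exI[of _ W] conjI) auto
    qed
  qed
  fix z assume "z \<in> \<Omega>"
  from assms[OF this] show "\<exists>K. compact K \<and> K \<subseteq> \<Omega> \<and>
        (\<exists>W. openin fine_topology W \<and> z \<in> W \<and> W \<subseteq> K) \<and>
        (\<exists>p q :: nat \<Rightarrow> complex poly.
           (\<forall>n. \<forall>w\<in>K. poly (q n) w \<noteq> 0) \<and>
           uniform_limit K (\<lambda>n w. poly (p n) w / poly (q n) w) f sequentially)"
  proof (elim exE conjE)
    fix K W assume *: "compact K" "K \<subseteq> \<Omega>" "openin fine_topology W" "z \<in> W" "W \<subseteq> K" "rational_approx K f"
    show ?thesis
      by (rule exI[of _ K], intro conjI * exI[of _ W] rational_approx_uniform_limitD)
  qed
qed

text \<open>Halving a radius lets one \<delta> serve both as the radius and as a lower bound for the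
  distance to the complement of \<open>U\<close>.\<close>

lemma open_cball_inside:
  fixes z :: complex
  assumes "open U" "z \<in> U"
  obtains \<delta> where "\<delta> > 0" "cball z \<delta> \<subseteq> U" "\<And>w p. w \<in> cball z \<delta> \<Longrightarrow> p \<notin> U \<Longrightarrow> norm (w - p) \<ge> \<delta>"
proof -
  obtain e where e: "e > 0" "ball z e \<subseteq> U" using assms open_contains_ball by blast
  show thesis
  proof (rule that[of "e / 2"])
    show "e / 2 > 0" using e by simp
    have "cball z (e / 2) \<subseteq> ball z e" using e by (simp add: cball_subset_ball_iff)
    then show "cball z (e / 2) \<subseteq> U" using e by blast
    fix w p assume w: "w \<in> cball z (e / 2)" and p: "p \<notin> U"
    have "dist z p \<ge> e" using p e by (meson mem_ball not_le subsetD)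
    moreover have "dist z p \<le> dist z w + dist w p" by (rule dist_triangle)
    ultimately show "norm (w - p) \<ge> e / 2" using w by (simp add: dist_norm)
  qed
qed

section \<open>Cantor data with exponentially small gaps\<close>

locale exponential_cantor_data =
  fixes a b c :: "nat \<Rightarrow> real"
  assumes data: "cantor_data a b"
    and c_pos: "\<forall>j\<ge>1. 0 < c j"
    and c_mono: "mono_on {1..} c"
    and len: "\<forall>j\<ge>1. b j - a j = exp (- (real j * c j))"
begin

lemma a_less_b: "a j < b j"
  using data by (simp add: cantor_data_def)

lemma inside: "i \<ge> 1 \<Longrightarrow> a 0 < a i" "i \<ge> 1 \<Longrightarrow> b i < b 0"
proof -
  assume "i \<ge> 1"
  then have "{a i..b i} \<subseteq> {a 0<..<b 0}" using data by (simp add: cantor_data_def)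
  then show "a 0 < a i" "b i < b 0" using a_less_b[of i] by (auto simp: subset_iff)
qed

lemma gaps_disjoint:
  assumes "i \<ge> 1" "j \<ge> 1" "i \<noteq> j"
  shows "{a i..b i} \<inter> {a j..b j} = {}"
proof -
  have D: "\<And>i j. i > j \<Longrightarrow> j \<ge> 1 \<Longrightarrow> {a i..b i} \<inter> {a j..b j} = {}"
    using data unfolding cantor_data_def by blast
  show ?thesis using D[of i j] D[of j i] assms by (metis Int_commute linorder_neqE_nat)
qed

lemma cantor_set_iff:
  "complex_of_real x \<in> cantor_set a b \<longleftrightarrow> a 0 \<le> x \<and> x \<le> b 0 \<and> (\<forall>i\<ge>1. \<not> (a i < x \<and> x < b i))"
  by (auto simp: cantor_set_def)

lemma cantor_set_subset: "cantor_set a b \<subseteq> seg (a 0) (b 0)"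
  by (auto simp: cantor_set_def)

lemma closed_cantor_set: "closed (cantor_set a b)"
proof -
  have "open (\<Union>i\<in>{1..}. {a i<..<b i})" by auto
  then have "compact ({a 0..b 0} - (\<Union>i\<in>{1..}. {a i<..<b i}))"
    by (intro compact_diff) auto
  then show ?thesis unfolding cantor_set_def
    by (intro compact_imp_closed compact_continuous_image continuous_intros)
qed

lemma endpoints_in_cantor_set:
  "complex_of_real (a 0) \<in> cantor_set a b" "j \<ge> 1 \<Longrightarrow> complex_of_real (b j) \<in> cantor_set a b"
proof -
  show "complex_of_real (a 0) \<in> cantor_set a b"
    using inside a_less_b[of 0] by (auto simp: cantor_set_iff) (meson less_asym)
  assume j: "j \<ge> 1"
  have "\<not> (a i < b j \<and> b j < b i)" if i: "i \<ge> 1" for i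
  proof
    assume *: "a i < b j \<and> b j < b i"
    then have "i \<noteq> j" by auto
    then show False using gaps_disjoint[OF i j] * a_less_b[of j] by (auto simp: disjoint_iff)
  qed
  then show "complex_of_real (b j) \<in> cantor_set a b"
    using inside[OF j] a_less_b[of j] by (auto simp: cantor_set_iff)
qed

lemma c_ge: "j \<ge> 1 \<Longrightarrow> c 1 \<le> c j"
  using c_mono by (auto simp: mono_on_def)

text \<open>As \<open>c\<close> increases, c (Suc i) \<ge> c 1 > 0, and the series is dominated by a
  geometric one.\<close>

lemma summable_exp_half: "summable (\<lambda>i. exp (- (real (Suc i) * c (Suc i)) / 2))"
proof (rule summable_comparison_test')
  show "summable (\<lambda>i. exp (- c 1 / 2) ^ i)"
    using c_pos by (intro summable_geometric) auto
  fix i :: nat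
  have "real i * c 1 \<le> real (Suc i) * c (Suc i)"
    using c_ge[of "Suc i"] c_pos by (intro mult_mono) (auto intro: less_imp_le)
  then show "norm (exp (- (real (Suc i) * c (Suc i)) / 2)) \<le> exp (- c 1 / 2) ^ i"
    by (simp add: exp_of_nat_mult[symmetric] del: of_nat_Suc)
qed

lemma summable_len: "summable (\<lambda>i. b (Suc i) - a (Suc i))"
proof (rule summable_comparison_test'[OF summable_exp_half])
  fix i :: nat
  have "0 \<le> real (Suc i) * c (Suc i)" using c_pos by (intro mult_nonneg_nonneg) (auto intro: less_imp_le)
  then show "norm (b (Suc i) - a (Suc i)) \<le> exp (- (real (Suc i) * c (Suc i)) / 2)"
    using len c_pos by (simp add: less_imp_le del: of_nat_Suc)
qed

section \<open>The factors (z - a i) / (z - b i) and their principal square roots\<close>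

definition ratio :: "nat \<Rightarrow> complex \<Rightarrow> complex" where
  "ratio i z = (z - of_real (a (Suc i))) / (z - of_real (b (Suc i)))"

lemma norm_ratio_minus_1:
  assumes "z \<noteq> of_real (b (Suc i))"
  shows "norm (ratio i z - 1) = (b (Suc i) - a (Suc i)) / norm (z - of_real (b (Suc i)))"
proof -
  have "ratio i z - 1 = of_real (b (Suc i) - a (Suc i)) / (z - of_real (b (Suc i)))"
    using assms by (simp add: ratio_def field_simps)
  then show ?thesis using a_less_b[of "Suc i"] by (simp add: norm_divide del: of_real_diff)
qed

text \<open>The conditions for the M-test on \<open>K\<close>. They hold at a positive distance from
  all b i, and also on compact sets that come arbitrarily close to the b i while staying outside the
  discs of F.\<close>

definition tame :: "complex set \<Rightarrow> bool" where
  "tame K \<longleftrightarrow> compact K \<and> (\<forall>w\<in>K. \<forall>i. w \<noteq> of_real (b (Suc i))) \<and>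
     (\<exists>n0 M. summable M \<and> (\<forall>n\<ge>n0. \<forall>w\<in>K. norm (ratio n w - 1) \<le> M n))"

lemma tame_far:
  assumes "compact K" "d > 0" "\<And>w i. w \<in> K \<Longrightarrow> norm (w - of_real (b (Suc i))) \<ge> d"
  shows "tame K"
proof -
  have ne: "w \<noteq> of_real (b (Suc i))" if "w \<in> K" for w i using assms(2) assms(3)[OF that, of i] by auto
  have "norm (ratio n w - 1) \<le> (b (Suc n) - a (Suc n)) / d" if "w \<in> K" for n w
    unfolding norm_ratio_minus_1[OF ne[OF that]] using assms(2) assms(3)[OF that] a_less_b[of "Suc n"]
    by (intro divide_left_mono) (auto intro!: mult_pos_pos intro: less_le_trans)
  moreover have "summable (\<lambda>n. (b (Suc n) - a (Suc n)) / d)" by (intro summable_divide summable_len)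
  ultimately show ?thesis unfolding tame_def using assms(1) ne by blast
qed

context
  fixes K assumes tame: "tame K"
begin

lemma ratio_poly:
  "w \<in> K \<Longrightarrow> poly [:- of_real (b (Suc i)), 1:] w \<noteq> 0"
  "ratio i w = poly [:- of_real (a (Suc i)), 1:] w / poly [:- of_real (b (Suc i)), 1:] w"
  using tame by (auto simp: tame_def ratio_def)

lemma continuous_on_ratio: "continuous_on K (ratio i)"
  unfolding ratio_def using tame by (intro continuous_intros) (auto simp: tame_def)

lemma tame_prodinf:
  shows "w \<in> K \<Longrightarrow> convergent_prod (\<lambda>i. ratio i w)" "continuous_on K (\<lambda>w. \<Prod>i. ratio i w)"
    "rational_approx K (\<lambda>w. \<Prod>i. ratio i w)"
proof -
  have K: "compact K" using tame by (simp add: tame_def)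
  obtain n0 M where M: "summable M" "\<And>n w. n \<ge> n0 \<Longrightarrow> w \<in> K \<Longrightarrow> norm (ratio n w - 1) \<le> M n"
    using tame unfolding tame_def by blast
  have ra: "rational_approx K (ratio i)" for i
    by (rule rational_approx_ratio[OF ratio_poly])
  show "w \<in> K \<Longrightarrow> convergent_prod (\<lambda>i. ratio i w)"
    by (rule uniform_limit_prodinf_complex(2)[OF K continuous_on_ratio M])
  show "continuous_on K (\<lambda>w. \<Prod>i. ratio i w)" "rational_approx K (\<lambda>w. \<Prod>i. ratio i w)"
    by (rule rational_approx_prodinf[OF K continuous_on_ratio ra M]; assumption)+
qed

lemma rational_approx_f_ab:
  assumes "of_real (a 0) \<notin> K"
  shows "rational_approx K (f_ab a b)"
proof -
  have K: "compact K" using tame by (simp add: tame_def)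
  have ne: "w - of_real (a 0) \<noteq> 0" if "w \<in> K" for w using assms that by auto
  have "rational_approx K (\<lambda>z. (z - of_real (b 0)) / (z - of_real (a 0)))"
    using ne by (intro rational_approx_ratio[of K "[:- of_real (a 0), 1:]" _ "[:- of_real (b 0), 1:]"]) auto
  then show ?thesis
    unfolding f_ab_def ratio_def[symmetric] using ne
    by (intro rational_approx_mult_compact K tame_prodinf continuous_intros) auto
qed

end

text \<open>The cut of each factor is its own closed gap [a i, b i], so no cut is imposed along the
  remaining part of [a 0, b 0].\<close>

definition root_prod :: "complex \<Rightarrow> complex" where
  "root_prod z = (\<Prod>i. csqrt (ratio i z))"

lemma tame_root_prod:
  assumes tame: "tame K" and seg: "\<And>w i. w \<in> K \<Longrightarrow> w \<notin> seg (a (Suc i)) (b (Suc i))"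
  shows "continuous_on K root_prod" "rational_approx K root_prod"
    "w \<in> K \<Longrightarrow> (root_prod w)\<^sup>2 = (\<Prod>i. ratio i w)" "w \<in> K \<Longrightarrow> (\<Prod>i. ratio i w) \<noteq> 0"
proof -
  have K: "compact K" using tame by (simp add: tame_def)
  obtain n0 M where M: "summable M" "\<And>n w. n \<ge> n0 \<Longrightarrow> w \<in> K \<Longrightarrow> norm (ratio n w - 1) \<le> M n"
    using tame unfolding tame_def by blast
  have M': "norm (csqrt (ratio n w) - 1) \<le> M n" if "n \<ge> n0" "w \<in> K" for n w
    using norm_csqrt_minus_1 M(2)[OF that] by (rule order_trans)
  have np: "ratio i w \<notin> \<real>\<^sub>\<le>\<^sub>0" if "w \<in> K" for i w
    unfolding ratio_def using a_less_b seg[OF that] by (rule ratio_nonpos_Reals)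
  note R = rational_approx_csqrt[OF K ratio_poly(1)[OF tame] np[unfolded ratio_poly(2)[OF tame]]]
  have root: "continuous_on K (\<lambda>w. csqrt (ratio i w))" "rational_approx K (\<lambda>w. csqrt (ratio i w))" for i
    unfolding ratio_poly(2)[OF tame] using R[of i] by blast+
  show "continuous_on K root_prod" "rational_approx K root_prod"
    unfolding root_prod_def[abs_def] by (rule rational_approx_prodinf[OF K root M(1) M']; assumption)+
  assume w: "w \<in> K"
  have conv: "convergent_prod (\<lambda>i. csqrt (ratio i w))"
    by (rule uniform_limit_prodinf_complex(2)[OF K root(1) M(1) M' w])
  have "(root_prod w)\<^sup>2 = (\<Prod>i. (csqrt (ratio i w))\<^sup>2)"
    unfolding root_prod_def by (rule prodinf_power[OF conv, symmetric])
  then show "(root_prod w)\<^sup>2 = (\<Prod>i. ratio i w)" by (simp only: power2_csqrt)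
  show "(\<Prod>i. ratio i w) \<noteq> 0"
  proof (rule prodinf_nonzero[OF tame_prodinf(1)[OF tame w]])
    show "ratio i w \<noteq> 0" for i using np[OF w, of i] by force
  qed
qed

text \<open>Unlike the branches \<open>g\<close>, this root of \<open>f_ab a b\<close> has its cut along the complement of the interval
  \<open>(a 0, b 0)\<close> in the real line.\<close>

definition flipped_root :: "complex \<Rightarrow> complex" where
  "flipped_root z = \<i> * csqrt ((of_real (b 0) - z) / (z - of_real (a 0))) * root_prod z"

text \<open>On (a 0, b 0) the quotient is positive. Elsewhere z is not real, and adding 1 to the
  quotient gives (b 0 - a 0) / (z - a 0), which is not real either.\<close>

lemma flipped_ratio_nonpos:
  assumes "z \<in> \<real> \<Longrightarrow> a 0 < Re z \<and> Re z < b 0"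
  shows "(of_real (b 0) - z) / (z - of_real (a 0)) \<notin> \<real>\<^sub>\<le>\<^sub>0" "z - of_real (a 0) \<noteq> 0"
proof -
  show ne: "z - of_real (a 0) \<noteq> 0" using assms by auto
  show "(of_real (b 0) - z) / (z - of_real (a 0)) \<notin> \<real>\<^sub>\<le>\<^sub>0"
  proof (cases "z \<in> \<real>")
    case True
    then obtain x where x: "z = of_real x" by (auto elim: Reals_cases)
    then have "(b 0 - x) / (x - a 0) > 0" using assms True by simp
    moreover have "(of_real (b 0) - z) / (z - of_real (a 0)) = of_real ((b 0 - x) / (x - a 0))"
      by (simp add: x)
    ultimately show ?thesis by (simp only: nonpos_Reals_of_real_iff not_le)
  next
    case False
    show ?thesis
    proof
      assume "(of_real (b 0) - z) / (z - of_real (a 0)) \<in> \<real>\<^sub>\<le>\<^sub>0"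
      then have "(of_real (b 0) - z) / (z - of_real (a 0)) + 1 \<in> \<real>"
        using nonpos_Reals_subset_Reals by (intro Reals_add) auto
      moreover have "(of_real (b 0) - z) / (z - of_real (a 0)) + 1 = of_real (b 0 - a 0) / (z - of_real (a 0))"
        using ne by (simp add: field_simps)
      ultimately have "of_real (b 0 - a 0) / (of_real (b 0 - a 0) / (z - of_real (a 0))) \<in> \<real>"
        by (metis Reals_divide Reals_of_real)
      moreover have "complex_of_real (b 0 - a 0) \<noteq> 0" using a_less_b[of 0] by (metis diff_gt_0_iff_gt less_irrefl of_real_eq_0_iff)
      ultimately have "z - of_real (a 0) \<in> \<real>" by simp
      then have "z - of_real (a 0) + of_real (a 0) \<in> \<real>" by (intro Reals_add Reals_of_real)
      then show False using False by simp
    qed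
  qed
qed

lemma rational_approx_flipped_root:
  assumes tame: "tame K" and seg: "\<And>w i. w \<in> K \<Longrightarrow> w \<notin> seg (a (Suc i)) (b (Suc i))"
    and re: "\<And>w. w \<in> K \<Longrightarrow> w \<in> \<real> \<Longrightarrow> a 0 < Re w \<and> Re w < b 0"
  shows "continuous_on K flipped_root" "rational_approx K flipped_root"
proof -
  have K: "compact K" using tame by (simp add: tame_def)
  note R = rational_approx_csqrt[of K "[:- of_real (a 0), 1:]" "[:of_real (b 0), -1:]"]
  have P: "poly [:- of_real (a 0), 1:] w \<noteq> 0" "poly [:of_real (b 0), -1:] w / poly [:- of_real (a 0), 1:] w \<notin> \<real>\<^sub>\<le>\<^sub>0"
    if "w \<in> K" for w
    using flipped_ratio_nonpos[of w] re[OF that] by auto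
  have eq: "flipped_root w = \<i> * (csqrt (poly [:of_real (b 0), -1:] w / poly [:- of_real (a 0), 1:] w) * root_prod w)" for w
    by (simp add: flipped_root_def)
  note C = R(1)[OF K P] and A = R(2)[OF K P]
  show "continuous_on K flipped_root"
    unfolding eq[abs_def] by (intro continuous_on_mult continuous_on_const C tame_root_prod tame seg)
  show "rational_approx K flipped_root"
    unfolding eq[abs_def]
    by (intro rational_approx_mult_compact rational_approx_const continuous_on_mult continuous_on_const
        K C A tame_root_prod tame seg)
qed

subsection \<open>The square roots\<close>

lemma tame_outside:
  assumes "z \<notin> seg (a 0) (b 0)"
  obtains \<delta> where "\<delta> > 0" "cball z \<delta> \<subseteq> - seg (a 0) (b 0)" "tame (cball z \<delta>)"
    "\<And>w i. w \<in> cball z \<delta> \<Longrightarrow> w \<notin> seg (a (Suc i)) (b (Suc i))"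
proof -
  have "open (- seg (a 0) (b 0))" by (simp add: open_Compl)
  then obtain \<delta> where \<delta>: "\<delta> > 0" "cball z \<delta> \<subseteq> - seg (a 0) (b 0)"
      "\<And>w p. w \<in> cball z \<delta> \<Longrightarrow> p \<notin> - seg (a 0) (b 0) \<Longrightarrow> norm (w - p) \<ge> \<delta>"
    using open_cball_inside[of "- seg (a 0) (b 0)" z] assms by auto
  have sub: "seg (a (Suc i)) (b (Suc i)) \<subseteq> seg (a 0) (b 0)" for i
    using inside[of "Suc i"] by auto
  have "of_real (b (Suc i)) \<in> seg (a (Suc i)) (b (Suc i))" for i using a_less_b[of "Suc i"] by auto
  then have "of_real (b (Suc i)) \<in> seg (a 0) (b 0)" for i using sub by blast
  then have "tame (cball z \<delta>)" using \<delta> by (intro tame_far[of _ \<delta>]) auto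
  then show thesis using that[of \<delta>] \<delta> sub by blast
qed

text \<open>The quotient under the root is -1 / q^2 with q = \<open>seg_root (a 0) (b 0) z\<close>,
  so its principal root is whichever of -\<i> / q and \<i> / q has positive real part. This depends
  on the sign of Im q, which is opposite to that of Im z; hence the change of sign between the half
  planes.\<close>

lemma flipped_root_eq:
  assumes "Im z \<noteq> 0"
  shows "flipped_root z = (if Im z > 0 then 1 else -1) * (root_prod z / seg_root (a 0) (b 0) z)"
proof -
  define q where "q = seg_root (a 0) (b 0) z"
  have ns: "z \<notin> seg (a 0) (b 0)" using assms by auto
  have q: "Re q > 0" "q\<^sup>2 - 1 = of_real (b 0 - a 0) / (z - of_real (b 0))"
    using seg_root_props[OF a_less_b ns] by (auto simp: q_def)
  have q2: "q\<^sup>2 = (z - of_real (a 0)) / (z - of_real (b 0))"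
    unfolding q_def seg_root_def by (rule power2_csqrt)
  have "2 * Re q * Im q = Im (q\<^sup>2 - 1)" by (simp add: Im_power2)
  also have "\<dots> = - ((b 0 - a 0) / (norm (z - of_real (b 0)))\<^sup>2) * Im z"
    unfolding q(2) by (simp add: Im_divide cmod_power2)
  finally have im: "2 * Re q * Im q = - ((b 0 - a 0) / (norm (z - of_real (b 0)))\<^sup>2) * Im z" .
  have nz: "z - of_real (b 0) \<noteq> 0" "z - of_real (a 0) \<noteq> 0" using assms by auto
  obtain k where k: "k > 0" and imk: "2 * Re q * Im q = - k * Im z"
    using im nz a_less_b[of 0] by (intro that[of "(b 0 - a 0) / (norm (z - of_real (b 0)))\<^sup>2"]) auto
  have q0: "q \<noteq> 0" using q(1) by auto
  have N: "(norm q)\<^sup>2 > 0" using q0 by simp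
  have sq: "(of_real (b 0) - z) / (z - of_real (a 0)) = - 1 / q\<^sup>2"
    unfolding q2 using nz by (simp add: field_simps)
  show ?thesis
  proof (cases "Im z > 0")
    case True
    then have "2 * Re q * Im q < 0" unfolding imk using mult_pos_pos[OF k True] by simp
    then have "Im q < 0" using q(1) by (simp add: mult_less_0_iff)
    then have "Re (- \<i> / q) > 0" using N by (simp add: Re_divide cmod_power2 divide_neg_pos)
    then have "csqrt ((of_real (b 0) - z) / (z - of_real (a 0))) = - \<i> / q"
      unfolding sq by (intro csqrt_unique) (auto simp: power_divide)
    then show ?thesis using True by (simp add: flipped_root_def q_def del: csqrt.simps)
  next
    case False
    then have "2 * Re q * Im q > 0" unfolding imk using mult_pos_neg[OF k, of "Im z"] assms by simp
    then have "Im q > 0" using q(1) by (simp add: zero_less_mult_iff)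
    then have "Re (\<i> / q) > 0" using N by (simp add: Re_divide cmod_power2)
    then have "csqrt ((of_real (b 0) - z) / (z - of_real (a 0))) = \<i> / q"
      unfolding sq by (intro csqrt_unique) (auto simp: power_divide)
    then show ?thesis using False by (simp add: flipped_root_def q_def del: csqrt.simps)
  qed
qed

text \<open>Off [a 0, b 0] both g and the explicit root \<open>G\<close> are continuous roots of the
  same nonvanishing function. Their quotient takes values in {1, -1} on a connected set and is
  constant.\<close>

lemma flip_lower_sqrt_branch:
  assumes g: "sqrt_branch a b s g"
  shows "\<exists>\<sigma>. \<forall>z. Im z \<noteq> 0 \<longrightarrow> flip_lower g z = \<sigma> * flipped_root z"
proof -
  let ?S = "- seg (a 0) (b 0)"
  define G where "G z = root_prod z / seg_root (a 0) (b 0) z" for z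
  have root0: "seg_root (a 0) (b 0) z \<noteq> 0" if "z \<in> ?S" for z
    using seg_root_props(1)[OF a_less_b, of z 0] that by force
  have sub: "?S \<subseteq> - cantor_set a b" using cantor_set_subset by blast
  have sq: "(g z)\<^sup>2 = (G z)\<^sup>2 \<and> G z \<noteq> 0 \<and> isCont root_prod z" if z: "z \<in> ?S" for z
  proof -
    obtain \<delta> where \<delta>: "\<delta> > 0" "cball z \<delta> \<subseteq> ?S" "tame (cball z \<delta>)"
      "\<And>w i. w \<in> cball z \<delta> \<Longrightarrow> w \<notin> seg (a (Suc i)) (b (Suc i))"
      using tame_outside[of z] z by blast
    have zin: "z \<in> cball z \<delta>" using \<delta> by simp
    have T: "continuous_on (cball z \<delta>) root_prod" "(root_prod z)\<^sup>2 = (\<Prod>i. ratio i z)" "(\<Prod>i. ratio i z) \<noteq> 0"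
      by (rule tame_root_prod[OF \<delta>(3)]; rule \<delta>(4) zin; assumption?)+
    have "isCont root_prod z"
      using T(1) \<delta>(1) by (intro continuous_on_interior[where S = "cball z \<delta>"]) (auto simp: interior_cball)
    moreover have "(seg_root (a 0) (b 0) z)\<^sup>2 = (z - of_real (a 0)) / (z - of_real (b 0))"
      unfolding seg_root_def by (rule power2_csqrt)
    then have "(G z)\<^sup>2 = f_ab a b z"
      unfolding G_def power_divide T(2) f_ab_def ratio_def by simp
    moreover have "(g z)\<^sup>2 = f_ab a b z" using g z sub by (auto simp: sqrt_branch_def)
    moreover have "root_prod z \<noteq> 0" using T(2,3) by auto
    then have "G z \<noteq> 0" using root0[OF z] by (simp add: G_def)
    ultimately show ?thesis by simp
  qed
  have "continuous_on ?S root_prod" using sq by (intro continuous_at_imp_continuous_on) auto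
  then have "continuous_on ?S G"
    unfolding G_def using root0 holomorphic_on_imp_continuous_on[OF holomorphic_seg_root[OF a_less_b[of 0]]]
    by (intro continuous_on_divide) auto
  moreover have "continuous_on ?S g"
    using g sub by (auto simp: sqrt_branch_def intro: holomorphic_on_imp_continuous_on holomorphic_on_subset)
  ultimately have cont: "continuous_on ?S (\<lambda>z. g z / G z)" using sq by (intro continuous_intros) auto
  have pm: "g z / G z = 1 \<or> g z / G z = -1" if "z \<in> ?S" for z
  proof -
    have "(g z / G z)\<^sup>2 = 1" using sq[OF that] by (simp add: power_divide)
    then show ?thesis by (simp add: power2_eq_1_iff)
  qed
  have "connected ?S"
  proof (rule connected_complement_bounded_convex)
    show "bounded (seg (a 0) (b 0))"
      by (intro compact_imp_bounded compact_continuous_image continuous_intros) auto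
    show "convex (seg (a 0) (b 0))"
      by (intro convex_linear_image bounded_linear.linear bounded_linear_of_real) auto
  qed simp
  moreover have "(\<lambda>z. g z / G z) ` ?S \<subseteq> {1, -1}" using pm by blast
  then have "finite ((\<lambda>z. g z / G z) ` ?S)" by (rule finite_subset) simp
  ultimately have "(\<lambda>z. g z / G z) constant_on ?S"
    by (intro continuous_finite_range_constant cont)
  then obtain \<sigma> where \<sigma>: "\<And>z. z \<in> ?S \<Longrightarrow> g z / G z = \<sigma>" unfolding constant_on_def by blast
  have "flip_lower g z = \<sigma> * flipped_root z" if "Im z \<noteq> 0" for z
  proof -
    have z: "z \<in> ?S" using that by auto
    then have "g z = \<sigma> * G z" using \<sigma>[OF z] sq[OF z] by (simp add: field_simps)
    then show ?thesis using that by (simp add: flip_lower_def flipped_root_eq G_def)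
  qed
  then show ?thesis by blast
qed

end

context exponential_cantor_data
begin

subsection \<open>The fine neighbourhoods\<close>

lemma seg_subset_F: "i \<ge> 1 \<Longrightarrow> seg (a i) (b i) \<subseteq> F_set a b c N"
  unfolding F_set_def by auto

lemma F_subset_J: "F_set a b c N \<subseteq> J_set a b c N"
  unfolding J_set_def by blast

lemma ball_subset_interior_F:
  assumes "n \<ge> N"
  shows "ball (of_real (b n)) (exp (- (real n * c n) / 2)) \<subseteq> interior (F_set a b c N)"
proof (rule interior_maximal)
  have "ball (of_real (b n)) (exp (- (real n * c n) / 2)) \<subseteq> cball (of_real (b n)) (exp (- (real n * c n) / 2))"
    by (rule ball_subset_cball)
  also have "\<dots> \<subseteq> F_set a b c N" unfolding F_set_def using assms by auto
  finally show "ball (of_real (b n)) (exp (- (real n * c n) / 2)) \<subseteq> F_set a b c N" .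
qed simp

lemma subharmonic_green_F: "subharmonic (green_function (F_set a b c N))"
  using subharmonic_green_function_seg[OF a_less_b seg_subset_F[of 1]] by simp

lemma subharmonic_green_J: "subharmonic (green_function (J_set a b c N))"
  using subharmonic_green_function_seg[OF a_less_b] seg_subset_F[of 1] F_subset_J by (meson order_refl order_trans)

text \<open>Both Green functions are finite, so the difference in \<open>u_fun\<close> never
  involves \<infinity> - \<infinity>.\<close>

lemma u_fun_pos_iff:
  "u_fun a b c N z > 0 \<longleftrightarrow> green_function (J_set a b c N) z < green_function (F_set a b c N) z"
proof -
  have "green_function (F_set a b c N) z < \<infinity>" "green_function (J_set a b c N) z < \<infinity>"
    using subharmonic_green_F subharmonic_green_J by (auto simp: subharmonic_def)
  moreover have "0 \<le> green_function (F_set a b c N) z" "0 \<le> green_function (J_set a b c N) z"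
    by (rule green_function_nonneg)+
  ultimately show ?thesis unfolding u_fun_def
    by (cases "green_function (F_set a b c N) z"; cases "green_function (J_set a b c N) z") auto
qed

lemma u_fun_pos_green_F: "u_fun a b c N z > 0 \<Longrightarrow> green_function (F_set a b c N) z \<noteq> 0"
  using green_function_nonneg[of "J_set a b c N" z] by (auto simp: u_fun_pos_iff)

text \<open>The segment [x, b i] lies in F and has x as its left end, where the Green function of F
  then vanishes. The point b i escapes this argument; it is removed by the disc about it or as one
  of the exceptional points.\<close>

lemma u_fun_pos_off_gap:
  assumes u: "u_fun a b c N (of_real x) > 0" and i: "i \<ge> 1"
  shows "\<not> (a i \<le> x \<and> x < b i)"
proof
  assume x: "a i \<le> x \<and> x < b i"
  then have "seg x (b i) \<subseteq> seg (a i) (b i)" by auto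
  then have "seg x (b i) \<subseteq> F_set a b c N" using seg_subset_F[OF i] by blast
  then have "green_function (F_set a b c N) (of_real x) = 0" using x by (intro green_function_seg_end) auto
  then show False using u_fun_pos_green_F[OF u] by simp
qed

lemma u_fun_pos_off_disc:
  assumes u: "u_fun a b c N z > 0" and "n \<ge> N"
  shows "norm (z - of_real (b n)) \<ge> exp (- (real n * c n) / 2)"
proof (rule ccontr)
  assume "\<not> ?thesis"
  then have "z \<in> ball (of_real (b n)) (exp (- (real n * c n) / 2))"
    by (simp add: dist_norm norm_minus_commute)
  then have "green_function (F_set a b c N) z = 0"
    using ball_subset_interior_F[OF assms(2)] by (intro green_function_interior) blast
  then show False using u_fun_pos_green_F[OF u] by simp
qed

text \<open>A difference of subharmonic functions need not be semicontinuous, so a level q is put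
  between the two values at z. By upper semicontinuity, {J < q} is open and {F \<ge> q} is closed in
  the Euclidean sense, while {F > q} is finely open.\<close>

lemma fine_compact_neighbourhood:
  assumes u: "u_fun a b c N z > 0" and U: "open U" "z \<in> U"
  obtains K W where "compact K" "K \<subseteq> U" "\<And>w. w \<in> K \<Longrightarrow> u_fun a b c N w > 0"
    "openin fine_topology W" "z \<in> W" "W \<subseteq> K"
proof -
  let ?F = "green_function (F_set a b c N)" and ?J = "green_function (J_set a b c N)"
  have "?J z < ?F z" using u u_fun_pos_iff by blast
  then obtain q where q: "?J z < q" "q < ?F z" using dense by blast
  have "open (U \<inter> {w. ?J w < q})" "z \<in> U \<inter> {w. ?J w < q}"
    using U q subharmonic_green_J by (auto simp: subharmonic_def)
  then obtain \<delta> where \<delta>: "\<delta> > 0" "cball z \<delta> \<subseteq> U \<inter> {w. ?J w < q}"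
    by (rule open_cball_inside)
  show thesis
  proof (rule that)
    have "closed {w. q \<le> ?F w}"
      using subharmonic_green_F unfolding subharmonic_def
      by (simp add: closed_def Collect_neg_eq[symmetric] not_le)
    then show "compact ({w. q \<le> ?F w} \<inter> cball z \<delta>)" by (intro closed_Int_compact) auto
    show "{w. q \<le> ?F w} \<inter> cball z \<delta> \<subseteq> U" using \<delta> by blast
    show "u_fun a b c N w > 0" if "w \<in> {w. q \<le> ?F w} \<inter> cball z \<delta>" for w
    proof -
      have "?J w < q" "q \<le> ?F w" using that \<delta> by auto
      then show ?thesis unfolding u_fun_pos_iff by (rule less_le_trans)
    qed
    show "openin fine_topology (?F -` {q<..} \<inter> ball z \<delta>)"
      by (intro openin_Int openin_fine_vimage openin_fine_open subharmonic_green_F) auto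
    show "z \<in> ?F -` {q<..} \<inter> ball z \<delta>" using q \<delta> by auto
    show "?F -` {q<..} \<inter> ball z \<delta> \<subseteq> {w. q \<le> ?F w} \<inter> cball z \<delta>" by auto
  qed
qed

text \<open>The choice of radii in F pays off here: outside the disc about b n, a gap of length
  e^(-t) moves the factor by at most e^(-t) / e^(-t/2) = e^(-t/2). For the indices below
  \<open>N\<close> it is enough to avoid the points b n.\<close>

lemma tame_u_fun_pos:
  assumes K: "compact K" and u: "\<And>w. w \<in> K \<Longrightarrow> u_fun a b c N w > 0"
    and b: "\<And>w n. w \<in> K \<Longrightarrow> n \<in> {1..<N} \<Longrightarrow> w \<noteq> of_real (b n)"
  shows "tame K"
  unfolding tame_def
proof (intro conjI ballI allI exI impI)
  show ne: "w \<noteq> of_real (b (Suc i))" if "w \<in> K" for w i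
  proof (cases "Suc i < N")
    case True
    then show ?thesis using b[OF that, of "Suc i"] by simp
  next
    case False
    then have "norm (w - of_real (b (Suc i))) > 0"
      using u_fun_pos_off_disc[OF u[OF that], of "Suc i"] by (metis exp_gt_zero less_le_trans not_less)
    then show ?thesis by auto
  qed
  show "summable (\<lambda>i. exp (- (real (Suc i) * c (Suc i)) / 2))" by (rule summable_exp_half)
  show "norm (ratio n w - 1) \<le> exp (- (real (Suc n) * c (Suc n)) / 2)" if n: "N \<le> n" and w: "w \<in> K" for n w
  proof -
    let ?t = "real (Suc n) * c (Suc n)"
    have d: "norm (w - of_real (b (Suc n))) \<ge> exp (- ?t / 2)"
      using n by (intro u_fun_pos_off_disc[OF u[OF w]]) auto
    have "norm (ratio n w - 1) = exp (- ?t) / norm (w - of_real (b (Suc n)))"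
      unfolding norm_ratio_minus_1[OF ne[OF w]] using len by (simp del: of_nat_Suc)
    also have "\<dots> \<le> exp (- ?t) / exp (- ?t / 2)"
      using d by (intro divide_left_mono mult_pos_pos) (auto intro: less_le_trans[OF exp_gt_zero])
    also have "\<dots> = exp (- ?t / 2)" by (simp add: exp_diff[symmetric])
    finally show ?thesis .
  qed
qed (rule K)

section \<open>The finely holomorphic extensions\<close>

lemma closed_exceptional: "closed ((\<lambda>n. complex_of_real (b n)) ` {1..<N})"
  by (intro finite_imp_closed) auto

lemma E_set_iff:
  "z \<in> E_set a b c N \<longleftrightarrow> z \<in> cantor_set a b \<and> u_fun a b c N z > 0 \<and> z \<notin> (\<lambda>n. of_real (b n)) ` {1..<N}"
  by (auto simp: E_set_def)

text \<open>The compact neighbourhood may cross the real line outside the Cantor set, since those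
  points belong to the domain; its points in the Cantor set have u > 0 and so lie in E.\<close>

lemma f_ab_extends:
  "finely_extends_over (f_ab a b) (- cantor_set a b) (E_set a b c N - {of_real (a 0)})"
  unfolding finely_extends_over_def
proof (intro exI conjI ballI)
  let ?\<Omega> = "- cantor_set a b \<union> (E_set a b c N - {of_real (a 0)})"
  show "finely_holomorphic_on (f_ab a b) ?\<Omega>"
  proof (rule finely_holomorphic_onI)
    fix z assume z: "z \<in> ?\<Omega>"
    show "\<exists>K W. compact K \<and> K \<subseteq> ?\<Omega> \<and> openin fine_topology W \<and> z \<in> W \<and> W \<subseteq> K \<and>
        rational_approx K (f_ab a b)"
    proof (cases "z \<in> cantor_set a b")
      case False
      then have "open (- cantor_set a b)" "z \<in> - cantor_set a b" using closed_cantor_set by auto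
      then obtain \<delta> where \<delta>: "\<delta> > 0" "cball z \<delta> \<subseteq> - cantor_set a b"
          "\<And>w p. w \<in> cball z \<delta> \<Longrightarrow> p \<notin> - cantor_set a b \<Longrightarrow> norm (w - p) \<ge> \<delta>"
        by (rule open_cball_inside) blast
      have "tame (cball z \<delta>)"
        using \<delta> endpoints_in_cantor_set(2) by (intro tame_far[of _ \<delta>]) auto
      then have "rational_approx (cball z \<delta>) (f_ab a b)"
        using \<delta>(2) endpoints_in_cantor_set(1) by (intro rational_approx_f_ab) auto
      then show ?thesis using \<delta>
        by (intro exI[of _ "cball z \<delta>"] exI[of _ "ball z \<delta>"] conjI openin_fine_open) auto
    next
      case True
      let ?U = "- (insert (complex_of_real (a 0)) ((\<lambda>n. complex_of_real (b n)) ` {1..<N}))"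
      have u: "u_fun a b c N z > 0" and zU: "z \<in> ?U" using z True by (auto simp: E_set_iff)
      have op: "open ?U" using closed_exceptional by (intro open_Compl closed_insert)
      obtain K W where K: "compact K" "K \<subseteq> ?U" "\<And>w. w \<in> K \<Longrightarrow> u_fun a b c N w > 0"
        "openin fine_topology W" "z \<in> W" "W \<subseteq> K"
        using fine_compact_neighbourhood[OF u op zU] by blast
      have "K \<subseteq> ?\<Omega>"
      proof
        fix w assume w: "w \<in> K"
        then have "w \<in> ?U" using K by blast
        then show "w \<in> ?\<Omega>" using K(3)[OF w] by (auto simp: E_set_iff)
      qed
      moreover have "tame K" using K by (intro tame_u_fun_pos[of K N]) auto
      then have "rational_approx K (f_ab a b)" using K(2) by (intro rational_approx_f_ab) auto
      ultimately show ?thesis using K by (intro exI[of _ K] exI[of _ W] conjI)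
    qed
  qed
qed simp

text \<open>The domain has no real points outside E, so a compact neighbourhood of a point of E must
  miss every gap and the real line beyond a 0 and b 0. The first holds because u > 0 excludes the
  gaps, the second by restricting to the strip a 0 < Re w < b 0.\<close>

lemma fine_extension_flipped_root:
  "finely_holomorphic_on (\<lambda>z. \<sigma> * flipped_root z) (- \<real> \<union> (E_set a b c N - {of_real (a 0), of_real (b 0)}))"
    (is "finely_holomorphic_on _ ?\<Omega>")
proof (rule finely_holomorphic_onI)
  have approx: "rational_approx K (\<lambda>z. \<sigma> * flipped_root z)"
    if "tame K" "\<And>w i. w \<in> K \<Longrightarrow> w \<notin> seg (a (Suc i)) (b (Suc i))"
      "\<And>w. w \<in> K \<Longrightarrow> w \<in> \<real> \<Longrightarrow> a 0 < Re w \<and> Re w < b 0" for K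
    using rational_approx_flipped_root[OF that] that(1)
    by (intro rational_approx_mult_compact rational_approx_const continuous_on_const) (auto simp: tame_def)
  fix z assume z: "z \<in> ?\<Omega>"
  show "\<exists>K W. compact K \<and> K \<subseteq> ?\<Omega> \<and> openin fine_topology W \<and> z \<in> W \<and> W \<subseteq> K \<and>
      rational_approx K (\<lambda>z. \<sigma> * flipped_root z)"
  proof (cases "z \<in> \<real>")
    case False
    then have "open (- \<real> :: complex set)" "z \<in> - \<real>" using closed_complex_Reals by auto
    then obtain \<delta> where \<delta>: "\<delta> > 0" "cball z \<delta> \<subseteq> - \<real>"
        "\<And>w p. w \<in> cball z \<delta> \<Longrightarrow> p \<notin> - \<real> \<Longrightarrow> norm (w - p) \<ge> \<delta>"
      by (rule open_cball_inside) blast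
    have "tame (cball z \<delta>)" using \<delta> by (intro tame_far[of _ \<delta>]) auto
    then have "rational_approx (cball z \<delta>) (\<lambda>z. \<sigma> * flipped_root z)"
    proof (rule approx)
      fix w i assume "w \<in> cball z \<delta>"
      then have "w \<notin> \<real>" using \<delta>(2) by blast
      then show "w \<notin> seg (a (Suc i)) (b (Suc i))" "w \<in> \<real> \<Longrightarrow> a 0 < Re w \<and> Re w < b 0" by auto
    qed
    then show ?thesis using \<delta>
      by (intro exI[of _ "cball z \<delta>"] exI[of _ "ball z \<delta>"] conjI openin_fine_open) auto
  next
    case True
    then have zE: "z \<in> E_set a b c N" "z \<noteq> of_real (a 0)" "z \<noteq> of_real (b 0)" using z by auto
    let ?S = "{w. a 0 < Re w} \<inter> {w. Re w < b 0}"
    let ?U = "?S - (\<lambda>n. complex_of_real (b n)) ` {1..<N}"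
    have "z \<in> ?S"
    proof -
      obtain x where x: "z = of_real x" using True by (auto elim: Reals_cases)
      then show ?thesis using zE by (auto simp: E_set_iff cantor_set_iff)
    qed
    then have u: "u_fun a b c N z > 0" and zU: "z \<in> ?U" using zE by (auto simp: E_set_iff)
    have "open ?S" by (intro open_Int open_halfspace_Re_gt open_halfspace_Re_lt)
    then have op: "open ?U" using closed_exceptional by (intro open_Diff)
    obtain K W where K: "compact K" "K \<subseteq> ?U" "\<And>w. w \<in> K \<Longrightarrow> u_fun a b c N w > 0"
      "openin fine_topology W" "z \<in> W" "W \<subseteq> K"
      using fine_compact_neighbourhood[OF u op zU] by blast
    have tame: "tame K" using K by (intro tame_u_fun_pos[of K N]) auto
    have sub: "K \<subseteq> ?\<Omega>"
    proof
      fix w assume w: "w \<in> K"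
      show "w \<in> ?\<Omega>"
      proof (cases "w \<in> \<real>")
        case True
        then obtain x where x: "w = of_real x" by (auto elim: Reals_cases)
        have "a 0 < x" "x < b 0" using w K(2) x by auto
        moreover have "\<not> (a i < x \<and> x < b i)" if "i \<ge> 1" for i
          using u_fun_pos_off_gap[OF K(3)[OF w, unfolded x] that] by auto
        ultimately show ?thesis using K(2,3) w x by (auto simp: E_set_iff cantor_set_iff)
      qed simp
    qed
    have "rational_approx K (\<lambda>z. \<sigma> * flipped_root z)"
    proof (rule approx[OF tame])
      fix w i assume w: "w \<in> K"
      show "w \<notin> seg (a (Suc i)) (b (Suc i))"
      proof
        assume "w \<in> seg (a (Suc i)) (b (Suc i))"
        then obtain x where x: "w = of_real x" "a (Suc i) \<le> x" "x \<le> b (Suc i)" by auto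
        have "x \<noteq> b (Suc i)" using tame w x(1) unfolding tame_def by metis
        then show False
          using u_fun_pos_off_gap[OF K(3)[OF w, unfolded x(1)], of "Suc i"] x by auto
      qed
    next
      fix w assume "w \<in> K" then show "a 0 < Re w \<and> Re w < b 0" using K(2) by auto
    qed
    then show ?thesis using K sub by (intro exI[of _ K] exI[of _ W] conjI)
  qed
qed

lemma flip_lower_extends:
  assumes "sqrt_branch a b s g"
  shows "finely_extends_over (flip_lower g) (- \<real>) (E_set a b c N - {of_real (a 0), of_real (b 0)})"
proof -
  obtain \<sigma> where "\<forall>z. Im z \<noteq> 0 \<longrightarrow> flip_lower g z = \<sigma> * flipped_root z"
    using flip_lower_sqrt_branch[OF assms] by blast
  then show ?thesis
    unfolding finely_extends_over_def
    by (intro exI[of _ "\<lambda>z. \<sigma> * flipped_root z"] conjI fine_extension_flipped_root)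
      (auto simp: complex_is_Real_iff)
qed

end

subsection \<open>Logarithmic potentials of discs\<close>

text \<open>Continuous subharmonic functions with real values, for which sums and nonnegative
  multiples follow from linearity of the integral.\<close>

definition submean :: "(complex \<Rightarrow> real) \<Rightarrow> bool" where
  "submean h \<longleftrightarrow> continuous_on UNIV h \<and>
     (\<forall>z r. r > 0 \<longrightarrow> 2 * pi * h z \<le> integral {0..2*pi} (\<lambda>t. h (z + rcis r t)))"

lemma submean_integrable:
  assumes "submean h"
  shows "(\<lambda>t. h (z + rcis r t)) integrable_on {0..2*pi}"
  using assms unfolding submean_def
  by (intro integrable_continuous_real continuous_on_compose2[where f = "\<lambda>t. z + rcis r t" and g = h]
      continuous_intros) auto

lemma submean_const: "submean (\<lambda>_. k)"
  by (auto simp: submean_def)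

lemma submean_add:
  assumes "submean h" "submean g"
  shows "submean (\<lambda>z. h z + g z)"
  unfolding submean_def
proof (intro conjI allI impI)
  show "continuous_on UNIV (\<lambda>z. h z + g z)" using assms by (auto simp: submean_def intro!: continuous_intros)
  fix z and r :: real assume r: "r > 0"
  have "2 * pi * h z + 2 * pi * g z \<le> integral {0..2*pi} (\<lambda>t. h (z + rcis r t)) + integral {0..2*pi} (\<lambda>t. g (z + rcis r t))"
    using assms r by (intro add_mono) (auto simp: submean_def)
  then show "2 * pi * (h z + g z) \<le> integral {0..2*pi} (\<lambda>t. h (z + rcis r t) + g (z + rcis r t))"
    by (simp add: integral_add submean_integrable assms distrib_left)
qed

lemma submean_scale:
  assumes "submean h" "k \<ge> 0"
  shows "submean (\<lambda>z. k * h z)"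
  unfolding submean_def
proof (intro conjI allI impI)
  show "continuous_on UNIV (\<lambda>z. k * h z)" using assms by (auto simp: submean_def intro!: continuous_intros)
  fix z and r :: real assume r: "r > 0"
  have "k * (2 * pi * h z) \<le> k * integral {0..2*pi} (\<lambda>t. h (z + rcis r t))"
    using assms r by (intro mult_left_mono) (auto simp: submean_def)
  then show "2 * pi * (k * h z) \<le> integral {0..2*pi} (\<lambda>t. k * h (z + rcis r t))"
    by (simp add: mult_ac)
qed

lemma submean_sum:
  assumes "finite I" "\<And>i. i \<in> I \<Longrightarrow> submean (h i)"
  shows "submean (\<lambda>z. \<Sum>i\<in>I. h i z)"
  using assms by (induction I rule: finite_induct) (auto simp: submean_const intro!: submean_add)

lemma subharmonic_submean: "submean h \<Longrightarrow> subharmonic (\<lambda>z. ereal (h z))"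
  by (intro subharmonicI_continuous) (auto simp: submean_def)

text \<open>With \<zeta> = z - p, reflection in the unit circle gives |\<zeta> + r e^(it)| = |r +
  cnj \<zeta> e^(it)|, and r + cnj \<zeta> u has no zero on a disc slightly larger than the unit
  disc. Its value at 0 is r.\<close>

lemma ln_norm_circle_integral_big:
  fixes z p :: complex
  assumes "norm (z - p) < r"
  shows "((\<lambda>t. ln (norm (z + rcis r t - p))) has_integral (2 * pi * ln r)) {0..2*pi}"
proof -
  define \<zeta> where "\<zeta> = z - p"
  have r: "r > 0" "norm \<zeta> < r" using assms by (auto simp: \<zeta>_def intro: le_less_trans[OF norm_ge_zero])
  \<comment> \<open>The harmonic mean of 1 and r / |\<zeta>|, in a form that makes sense for \<zeta>
    = 0.\<close>
  define R where "R = 2 * r / (r + norm \<zeta>)"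
  have pos: "r + norm \<zeta> > 0" using r by (simp add: add_pos_nonneg)
  have R1: "R > 1" using r pos by (simp add: R_def field_simps)
  have "((\<lambda>t. ln (norm (of_real r + cnj \<zeta> * (0 + rcis 1 t)))) has_integral
      (2 * pi * ln (norm (of_real r + cnj \<zeta> * 0)))) {0..2*pi}"
  proof (rule ln_norm_circle_mean[where R = R and f = "\<lambda>u. of_real r + cnj \<zeta> * u"])
    fix w assume "w \<in> ball (0::complex) R"
    then have "norm (cnj \<zeta> * w) \<le> norm \<zeta> * R" by (auto simp: norm_mult intro: mult_left_mono)
    also have "\<dots> < r"
    proof -
      have "norm \<zeta> * (2 * r) < r * (r + norm \<zeta>)" using r by (simp add: algebra_simps)
      then show ?thesis using pos by (simp add: R_def divide_less_eq)
    qed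
    finally have "norm (cnj \<zeta> * w) < norm (complex_of_real r)" using r by simp
    then show "of_real r + cnj \<zeta> * w \<noteq> 0"
      by (metis add_eq_0_iff2 less_irrefl norm_minus_cancel)
  qed (use R1 in \<open>auto intro!: holomorphic_intros\<close>)
  moreover have "norm (of_real r + cnj \<zeta> * (0 + rcis 1 t)) = norm (z + rcis r t - p)" for t
  proof -
    have "norm (of_real r + cnj \<zeta> * (0 + rcis 1 t)) = norm (cnj (of_real r + cnj \<zeta> * (0 + rcis 1 t)))"
      by (rule complex_mod_cnj[symmetric])
    also have "cnj (of_real r + cnj \<zeta> * (0 + rcis 1 t)) = of_real r + \<zeta> * cis (- t)"
      by (simp add: rcis_def cis_cnj)
    also have "norm \<dots> = norm (cis t * (of_real r + \<zeta> * cis (- t)))" by (simp add: norm_mult)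
    also have "cis t * (of_real r + \<zeta> * cis (- t)) = z + rcis r t - p"
      by (simp add: \<zeta>_def rcis_def algebra_simps cis_mult)
    finally show ?thesis .
  qed
  ultimately show ?thesis using r by simp
qed

text \<open>For z in the disc of radius \<rho>, the constant ln \<rho> is a minorant with the right
  mean. Otherwise ln |w - p| is the minorant: its mean is ln |z - p| if p lies outside the circle,
  and ln r \<ge> ln |z - p| if p lies inside.\<close>

lemma submean_ln_max:
  fixes p :: complex
  assumes \<rho>: "\<rho> > 0"
  shows "submean (\<lambda>z. ln (max (norm (z - p)) \<rho>))"
proof -
  let ?h = "\<lambda>z. ln (max (norm (z - p)) \<rho>)"
  have cont: "continuous_on UNIV ?h"
    using \<rho> by (intro continuous_intros) (auto simp: max_def)
  have int: "(\<lambda>t. ?h (z + rcis r t)) integrable_on {0..2*pi}" for z r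
    by (intro integrable_continuous_real continuous_on_compose2[OF cont, where f = "\<lambda>t. z + rcis r t"]
      continuous_intros) auto
  have lower: "c \<le> integral {0..2*pi} (\<lambda>t. ?h (z + rcis r t))"
    if "(g has_integral c) {0..2*pi}" "\<And>t. g t \<le> ?h (z + rcis r t)" for g c z r
    using that by (intro has_integral_le[OF that(1) integrable_integral[OF int]])
  \<comment> \<open>A circle through \<open>p\<close> is excluded since \<open>ln 0 = 0\<close> may
    exceed ln \<rho>.\<close>
  have ln_le: "ln (norm (z + rcis r t - p)) \<le> ?h (z + rcis r t)" if "norm (z - p) \<noteq> r" "r > 0" for z r t
  proof -
    have "z + rcis r t - p \<noteq> 0"
    proof
      assume "z + rcis r t - p = 0"
      then have "z - p = - rcis r t" by (simp add: algebra_simps add_eq_0_iff)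
      then have "norm (z - p) = r" using that(2) by simp
      then show False using that(1) by simp
    qed
    then show ?thesis using \<rho> by (subst ln_le_cancel_iff) (auto simp: max_def)
  qed
  have "2 * pi * ?h z \<le> integral {0..2*pi} (\<lambda>t. ?h (z + rcis r t))" if r: "r > 0" for z r
  proof (cases "norm (z - p) \<le> \<rho>")
    case True
    have "2 * pi * ln \<rho> \<le> integral {0..2*pi} (\<lambda>t. ?h (z + rcis r t))"
      using has_integral_const_real[of "ln \<rho>" 0 "2*pi"] \<rho>
      by (intro lower[where g = "\<lambda>_. ln \<rho>"]) (auto simp: mult.commute)
    then show ?thesis using True by (simp add: max_def)
  next
    case False
    then have big: "norm (z - p) > \<rho>" by simp
    show ?thesis
    proof (cases "r < norm (z - p)")
      case True
      have "((\<lambda>t. ln (norm (z + rcis r t - p))) has_integral (2 * pi * ln (norm (z - p)))) {0..2*pi}"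
        using True r by (intro ln_norm_circle_mean[where R = "norm (z - p)" and f = "\<lambda>w. w - p"])
          (auto intro!: holomorphic_intros simp: dist_norm)
      then have "2 * pi * ln (norm (z - p)) \<le> integral {0..2*pi} (\<lambda>t. ?h (z + rcis r t))"
        by (rule lower) (use ln_le True r in auto)
      then show ?thesis using big by (simp add: max_def)
    next
      case False
      text \<open>The centre is moved slightly towards \<open>p\<close>, so that \<open>p\<close> is off the circle.\<close>
      have lip: "?h w' - \<delta> / \<rho> \<le> ?h w" if "norm (w' - w) \<le> \<delta>" for w w' \<delta>
      proof -
        have "norm (w' - p) - norm (w - p) \<le> \<delta>"
          using norm_triangle_ineq2[of "w' - p" "w - p"] that by simp
        then have 1: "max (norm (w' - p)) \<rho> - max (norm (w - p)) \<rho> \<le> \<delta>"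
          using order_trans[OF norm_ge_zero that] by (auto simp: max_def)
        have "?h w' - ?h w \<le> (max (norm (w' - p)) \<rho> - max (norm (w - p)) \<rho>) / max (norm (w - p)) \<rho>"
          using \<rho> by (intro ln_diff_le) auto
        also have "\<dots> \<le> \<delta> / max (norm (w - p)) \<rho>"
          using 1 \<rho> by (intro divide_right_mono) auto
        also have "\<dots> \<le> \<delta> / \<rho>"
          using \<rho> order_trans[OF norm_ge_zero that] by (intro divide_left_mono mult_pos_pos) auto
        finally show ?thesis by simp
      qed
      have "2 * pi * ln r \<le> integral {0..2*pi} (\<lambda>t. ?h (z + rcis r t)) + e" if "e > 0" for e
      proof -
        \<comment> \<open>The centre moves by s |z - p|. By the Lipschitz constant 1 / \<rho> the
          integral changes by at most 2 pi s |z - p| / \<rho>, which this choice bounds by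
          e.\<close>
        define s where "s = min (1/2) (e * \<rho> / (2 * pi * norm (z - p)))"
        have np: "norm (z - p) > 0" using big \<rho> by linarith
        have s: "0 < s" "s < 1" using that \<rho> np by (auto simp: s_def)
        have "s \<le> e * \<rho> / (2 * pi * norm (z - p))" by (simp add: s_def)
        then have s2: "2 * pi * (s * norm (z - p) / \<rho>) \<le> e" using np \<rho> by (simp add: field_simps)
        define z' where "z' = z - of_real s * (z - p)"
        have "norm (z' - p) = norm (of_real (1 - s) * (z - p))" by (simp add: z'_def algebra_simps)
        also have "\<dots> = (1 - s) * norm (z - p)" using s by (simp add: norm_mult del: of_real_diff)
        also have "\<dots> < r" using s np False by (smt (verit) mult_less_cancel_right2)
        finally have z'r: "norm (z' - p) < r" .
        then have I: "((\<lambda>t. ln (norm (z' + rcis r t - p))) has_integral (2 * pi * ln r)) {0..2*pi}"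
          by (rule ln_norm_circle_integral_big)
        let ?\<delta> = "s * norm (z - p)"
        have "((\<lambda>t. ln (norm (z' + rcis r t - p)) - ?\<delta> / \<rho>) has_integral (2 * pi * ln r - 2 * pi * (?\<delta> / \<rho>))) {0..2*pi}"
          using has_integral_diff[OF I has_integral_const_real[of "?\<delta> / \<rho>" 0 "2*pi"]] by simp
        then have "2 * pi * ln r - 2 * pi * (?\<delta> / \<rho>) \<le> integral {0..2*pi} (\<lambda>t. ?h (z + rcis r t))"
        proof (rule lower)
          fix t
          have "ln (norm (z' + rcis r t - p)) - ?\<delta> / \<rho> \<le> ?h (z' + rcis r t) - ?\<delta> / \<rho>"
            using ln_le[of z' r t] r z'r by simp
          also have "\<dots> \<le> ?h (z + rcis r t)"
            using s by (intro lip) (simp add: z'_def norm_mult)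
          finally show "ln (norm (z' + rcis r t - p)) - ?\<delta> / \<rho> \<le> ?h (z + rcis r t)" .
        qed
        then show ?thesis using s2 by linarith
      qed
      then have "2 * pi * ln r \<le> integral {0..2*pi} (\<lambda>t. ?h (z + rcis r t))" by (rule field_le_epsilon)
      moreover have "ln (norm (z - p)) \<le> ln r" using False big \<rho> by (subst ln_le_cancel_iff) auto
      then have "2 * pi * ln (norm (z - p)) \<le> 2 * pi * ln r" by (intro mult_left_mono) auto
      moreover have "2 * pi * ?h z = 2 * pi * ln (norm (z - p))" using big by simp
      ultimately show ?thesis by linarith
    qed
  qed
  with cont show ?thesis by (simp add: submean_def)
qed

text \<open>Along a decreasing sequence one bound \<open>B\<close> serves all terms, and the
  deficits pass to the limit by Fatou's lemma.\<close>

lemma subharmonic_INF: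
  assumes v: "\<And>n. subharmonic (v n)" and dec: "\<And>n z. v (Suc n) z \<le> v n z"
  shows "subharmonic (\<lambda>z. INF n. v n z)"
proof (rule subharmonicI_deficit)
  let ?u = "\<lambda>z. INF n. v n z"
  have usc_v: "\<forall>y. open {z. v n z < y}" and fin_v: "\<forall>z. v n z < \<infinity>" for n
    using v[of n] by (auto simp: subharmonic_def)
  have "{z. ?u z < y} = (\<Union>n. {z. v n z < y})" for y by (auto simp: INF_less_iff)
  then show usc: "\<forall>y. open {z. ?u z < y}" using usc_v by auto
  show "\<forall>z. ?u z < \<infinity>" using fin_v[of 0] by (metis INF_lower UNIV_I le_less_trans)
  have anti: "v n z \<le> v m z" if "m \<le> n" for m n z
    using that dec by (induction rule: dec_induct) (auto intro: order_trans)
  fix z and r :: real assume r: "r > 0"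
  obtain B where B: "B \<ge> 0" "\<And>w. w \<in> cball z r \<Longrightarrow> v 0 w \<le> ereal B"
    using usc_cball_bounded[OF usc_v fin_v compact_cball] by metis
  have Bn: "v n w \<le> ereal B" if "w \<in> cball z r" for n w
    using anti[of 0 n w] B(2)[OF that] by (simp add: order_trans)
  have pt: "e2ennreal (ereal B - ?u w) \<le> liminf (\<lambda>n. e2ennreal (ereal B - v n w))" for w
    unfolding le_Liminf_iff
  proof (intro allI impI)
    fix y assume "y < e2ennreal (ereal B - ?u w)"
    then obtain m where "v m w < ereal B - enn2ereal y" by (auto simp: less_e2ennreal_diff_iff INF_less_iff)
    then have "\<forall>n\<ge>m. v n w < ereal B - enn2ereal y" using anti by (meson le_less_trans)
    then show "\<forall>\<^sub>F n in sequentially. y < e2ennreal (ereal B - v n w)"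
      unfolding less_e2ennreal_diff_iff eventually_sequentially by blast
  qed
  have [measurable]: "(\<lambda>t. v n (z + rcis r t)) \<in> borel_measurable borel" for n
    by (rule usc_circle_measurable[OF usc_v])
  have "circle_deficit ?u B z r
    \<le> (\<integral>\<^sup>+t. liminf (\<lambda>n. e2ennreal (ereal B - v n (z + rcis r t)) * indicator {0..2*pi} t) \<partial>lborel)"
    unfolding circle_deficit_def
  proof (rule nn_integral_mono)
    fix t
    show "e2ennreal (ereal B - ?u (z + rcis r t)) * indicator {0..2*pi} t
      \<le> liminf (\<lambda>n. e2ennreal (ereal B - v n (z + rcis r t)) * indicator {0..2*pi} t)"
      by (cases "t \<in> {0..2*pi}") (use pt in auto)
  qed
  also have "\<dots> \<le> liminf (\<lambda>n. circle_deficit (v n) B z r)"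
    unfolding circle_deficit_def by (intro nn_integral_liminf) measurable
  also have "\<dots> \<le> ennreal (2*pi) * e2ennreal (ereal B - ?u z)"
  proof (intro Liminf_le always_eventually allI)
    fix n
    have "circle_deficit (v n) B z r \<le> ennreal (2*pi) * e2ennreal (ereal B - v n z)"
      by (intro subharmonic_deficit v r B Bn)
    also have "\<dots> \<le> ennreal (2*pi) * e2ennreal (ereal B - ?u z)"
      by (intro mult_left_mono e2ennreal_mono ereal_minus_mono INF_lower) auto
    finally show "circle_deficit (v n) B z r \<le> ennreal (2*pi) * e2ennreal (ereal B - ?u z)" .
  qed simp
  finally show "\<exists>B\<ge>0. (\<forall>w\<in>cball z r. ?u w \<le> ereal B) \<and>
      circle_deficit ?u B z r \<le> ennreal (2*pi) * e2ennreal (ereal B - ?u z)"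
    using B(1) Bn by (intro exI[of _ B]) (meson INF_lower UNIV_I order_trans)
qed

text \<open>A weighted sum of the potentials of the discs \<open>cball (p i) (r i)\<close>. The weights
  \<open>\<alpha> i\<close>, proportional to \<open>1 / - ln (r i)\<close>, make the bound on each disc the same. The remaining
  weight goes to \<open>M\<close>, which dominates all the potentials: this makes the partial sums decrease.\<close>

lemma disc_potential:
  fixes p :: "nat \<Rightarrow> complex" and r :: "nat \<Rightarrow> real"
  assumes r: "\<And>i. 0 < r i" "\<And>i. r i < 1" and sm: "summable (\<lambda>i. 1 / - ln (r i))"
    and L: "L \<ge> 1" "\<And>i. norm (p i - x0) \<le> L"
    and X: "\<And>z. z \<in> X \<Longrightarrow> \<exists>j. norm (z - p j) \<le> r j" "\<And>z i. z \<in> X \<Longrightarrow> norm (z - p i) \<le> D" and D: "D \<ge> 1"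
  obtains v where "subharmonic v" "log_growth v" "\<forall>z\<in>X. v z \<le> 0"
    "\<And>z T. T > 0 \<Longrightarrow> T \<le> norm (z - x0) \<Longrightarrow> (\<And>i. T \<le> norm (z - p i)) \<Longrightarrow>
       ereal (ln T + 1 / (\<Sum>i. 1 / - ln (r i)) - ln D) \<le> v z"
proof -
  define \<l> where "\<l> i = - ln (r i)" for i
  have \<l>: "\<l> i > 0" for i using r[of i] by (simp add: \<l>_def)
  define S where "S = (\<Sum>i. 1 / \<l> i)"
  have sm': "summable (\<lambda>i. 1 / \<l> i)" using sm by (simp add: \<l>_def)
  have S: "S > 0" unfolding S_def using sm' \<l> by (intro suminf_pos) auto
  define \<alpha> where "\<alpha> i = 1 / \<l> i / S" for i
  have \<alpha>0: "\<alpha> i \<ge> 0" for i using \<l>[of i] S by (simp add: \<alpha>_def)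
  have \<alpha>sum: "\<alpha> sums 1"
    unfolding \<alpha>_def[abs_def] using sums_divide[OF summable_sums[OF sm'], of S] S by (simp add: S_def)
  have \<alpha>le: "(\<Sum>i<n. \<alpha> i) \<le> 1" for n
    using sum_le_suminf[OF sums_summable[OF \<alpha>sum], of "{..<n}"] \<alpha>0 sums_unique[OF \<alpha>sum] by simp
  define h where "h i z = ln (max (norm (z - p i)) (r i))" for i z
  \<comment> \<open>From |z - p i| \<le> |z - x0| + L \<le> 2 max (|z - x0|, L). The additive ln 2
    does no harm, as the weight of \<open>M\<close> tends to 0.\<close>
  define M where "M z = ln 2 + ln (max (norm (z - x0)) L)" for z
  define \<kappa> where "\<kappa> = 1 / S - ln D"
  have hM: "h i z \<le> M z" for i z
  proof -
    have "norm (z - p i) \<le> norm (z - x0) + norm (p i - x0)"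
      using norm_triangle_ineq4[of "z - x0" "p i - x0"] by simp
    then have "max (norm (z - p i)) (r i) \<le> 2 * max (norm (z - x0)) L"
      using L(2)[of i] L(1) r(2)[of i] by (auto simp: max_def)
    then have "h i z \<le> ln (2 * max (norm (z - x0)) L)"
      unfolding h_def using r(1)[of i] L(1) by (subst ln_le_cancel_iff) auto
    also have "\<dots> = M z" unfolding M_def using L(1) by (subst ln_mult) auto
    finally show ?thesis .
  qed
  define v where "v n z = (\<Sum>i<n. \<alpha> i * h i z) + (1 - (\<Sum>i<n. \<alpha> i)) * M z + \<kappa>" for n z
  have subv: "subharmonic (\<lambda>z. ereal (v n z))" for n
    unfolding v_def h_def M_def using \<alpha>0 \<alpha>le r(1) L(1)
    by (intro subharmonic_submean submean_add submean_sum submean_scale submean_const submean_ln_max) auto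
  have dec: "v (Suc n) z \<le> v n z" for n z
  proof -
    have "v n z - v (Suc n) z = \<alpha> n * (M z - h n z)" by (simp add: v_def algebra_simps)
    also have "\<dots> \<ge> 0" using \<alpha>0 hM by simp
    finally show ?thesis by simp
  qed
  define u where "u z = (INF n. ereal (v n z))" for z
  show thesis
  proof (rule that)
    show "subharmonic u" unfolding u_def[abs_def] using subv dec by (intro subharmonic_INF) auto
    show "log_growth u"
      unfolding log_growth_def
    proof (intro exI allI)
      fix z
      let ?A = "1 + norm x0 + L"
      have "norm (z - x0) \<le> norm z + norm x0" by (rule norm_triangle_ineq4)
      also have "\<dots> \<le> ?A * max 1 (norm z)"
      proof -
        have "norm z \<le> max 1 (norm z)" "norm x0 * 1 \<le> norm x0 * max 1 (norm z)" "0 \<le> L * max 1 (norm z)"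
          using L(1) by (auto intro!: mult_nonneg_nonneg simp del: mult_1_right intro: mult_left_mono)
        then show ?thesis by (simp only: distrib_right mult_1 mult_1_right)
      qed
      finally have 1: "norm (z - x0) \<le> ?A * max 1 (norm z)" .
      have "L \<le> ?A * 1" using norm_ge_zero[of x0] by simp
      also have "\<dots> \<le> ?A * max 1 (norm z)" using L(1) norm_ge_zero[of x0] by (intro mult_left_mono) auto
      finally have "max (norm (z - x0)) L \<le> ?A * max 1 (norm z)" using 1 by simp
      moreover have "max (norm (z - x0)) L > 0" using L(1) by simp
      moreover have A: "?A > 0" using L(1) norm_ge_zero[of x0] by linarith
      ultimately have "ln (max (norm (z - x0)) L) \<le> ln (?A * max 1 (norm z))"
        by (subst ln_le_cancel_iff) auto
      also have "\<dots> = ln ?A + ln (max 1 (norm z))" using A by (subst ln_mult) auto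
      finally have "v 0 z \<le> ln (max 1 (norm z)) + (ln ?A + ln 2 + \<kappa>)" by (simp add: v_def M_def)
      moreover have "u z \<le> ereal (v 0 z)" unfolding u_def by (rule INF_lower) simp
      ultimately show "u z \<le> ereal (ln (max 1 (norm z)) + (ln ?A + ln 2 + \<kappa>))"
        by (meson ereal_less_eq(3) order_trans)
    qed
    show "\<forall>z\<in>X. u z \<le> 0"
    proof
      fix z assume z: "z \<in> X"
      obtain j where j: "norm (z - p j) \<le> r j" using X(1)[OF z] by blast
      have hj: "h j z = - \<l> j" using j by (simp add: h_def \<l>_def max_def)
      have hi: "h i z \<le> ln D" for i
        unfolding h_def using X(2)[OF z, of i] r[of i] D by (subst ln_le_cancel_iff) auto
      have D0: "ln D \<ge> 0" using D by simp
      \<comment> \<open>The disc containing z contributes \<alpha> j (ln r_j) = -1 / S, and the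
        other potentials at most ln D \<ge> 0 with total weight at most 1. Both are cancelled by
        \<kappa>; what remains is the term of \<open>M\<close>, whose weight tends to 0.\<close>
      have bound: "u z \<le> ereal ((1 - (\<Sum>i<n. \<alpha> i)) * M z)" if n: "n > j" for n
      proof -
        have "(\<Sum>i<n. \<alpha> i * h i z) = \<alpha> j * h j z + (\<Sum>i\<in>{..<n}-{j}. \<alpha> i * h i z)"
          using n by (intro sum.remove) auto
        also have "\<dots> \<le> \<alpha> j * h j z + (\<Sum>i\<in>{..<n}-{j}. \<alpha> i * ln D)"
          using \<alpha>0 hi by (intro add_left_mono sum_mono mult_left_mono) auto
        also have "(\<Sum>i\<in>{..<n}-{j}. \<alpha> i * ln D) = (\<Sum>i\<in>{..<n}-{j}. \<alpha> i) * ln D"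
          by (simp add: sum_distrib_right)
        also have "\<dots> \<le> 1 * ln D"
        proof (intro mult_right_mono D0)
          have "(\<Sum>i\<in>{..<n}-{j}. \<alpha> i) \<le> (\<Sum>i<n. \<alpha> i)" using \<alpha>0 by (intro sum_mono2) auto
          then show "(\<Sum>i\<in>{..<n}-{j}. \<alpha> i) \<le> 1" using \<alpha>le[of n] by linarith
        qed
        also have "\<alpha> j * h j z = - (1 / S)" using hj \<l>[of j] S by (simp add: \<alpha>_def)
        finally have "v n z \<le> (1 - (\<Sum>i<n. \<alpha> i)) * M z" by (simp add: v_def \<kappa>_def)
        moreover have "u z \<le> ereal (v n z)" unfolding u_def by (rule INF_lower) simp
        ultimately show ?thesis by (meson ereal_less_eq(3) order_trans)
      qed
      have "(\<lambda>n. (1 - (\<Sum>i<n. \<alpha> i)) * M z) \<longlonglongrightarrow> (1 - 1) * M z"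
        using \<alpha>sum unfolding sums_def by (intro tendsto_intros)
      then have "(\<lambda>n. ereal ((1 - (\<Sum>i<n. \<alpha> i)) * M z)) \<longlonglongrightarrow> ereal 0" by simp
      then show "u z \<le> 0"
        using bound by (intro LIMSEQ_le_const[where X = "\<lambda>n. ereal ((1 - (\<Sum>i<n. \<alpha> i)) * M z)"])
          (auto simp: zero_ereal_def intro!: exI[of _ "Suc j"])
    qed
    fix z T assume T: "T > 0" "T \<le> norm (z - x0)" "\<And>i. T \<le> norm (z - p i)"
    have hT: "ln T \<le> h i z" for i
      unfolding h_def using T(1) T(3)[of i] r(1)[of i] by (subst ln_le_cancel_iff) auto
    have "ln T \<le> ln (max (norm (z - x0)) L)" using T(1,2) by (subst ln_le_cancel_iff) auto
    then have MT: "ln T \<le> M z" unfolding M_def by (simp add: add_increasing)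
    have "ln T + \<kappa> \<le> v n z" for n
    proof -
      have "ln T = (\<Sum>i<n. \<alpha> i) * ln T + (1 - (\<Sum>i<n. \<alpha> i)) * ln T" by (simp add: algebra_simps)
      also have "\<dots> = (\<Sum>i<n. \<alpha> i * ln T) + (1 - (\<Sum>i<n. \<alpha> i)) * ln T" by (simp add: sum_distrib_right)
      also have "\<dots> \<le> (\<Sum>i<n. \<alpha> i * h i z) + (1 - (\<Sum>i<n. \<alpha> i)) * M z"
        using \<alpha>0 \<alpha>le[of n] hT MT by (intro add_mono sum_mono mult_left_mono) auto
      finally show ?thesis by (simp add: v_def)
    qed
    then have "ereal (ln T + \<kappa>) \<le> u z" unfolding u_def by (intro INF_greatest) auto
    then show "ereal (ln T + 1 / (\<Sum>i. 1 / - ln (r i)) - ln D) \<le> u z"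
      by (simp add: \<kappa>_def S_def \<l>_def add_diff_eq)
  qed
qed

subsection \<open>Nonemptiness of the set\<close>

text \<open>The number 67/10 is 536/80, the quotient of the two bounds compared in
  \<open>E_set_nonempty\<close>; (1 + 1/16)^32 is about 6.96.\<close>

lemma exp_2_gt: "exp (2::real) > 67 / 10"
proof -
  have "(67::real) / 10 < (1 + 1/16) ^ 32" by (simp add: power_divide)
  also have "\<dots> \<le> exp (1/16) ^ 32" by (intro power_mono exp_ge_add_one_self) auto
  also have "\<dots> = exp (2::real)" by (simp add: exp_of_nat_mult[symmetric])
  finally show ?thesis .
qed

context exponential_cantor_data
begin

definition decay :: "nat \<Rightarrow> real" where
  "decay i = real (Suc i) * c (Suc i)"

text \<open>For the early indices F contains only the segment [a i, b i], which the disc about b i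
  with the gap length as radius covers. For the later ones it is the disc of F itself, which covers
  the segment as well.\<close>

definition radius :: "nat \<Rightarrow> nat \<Rightarrow> real" where
  "radius N i = (if Suc i < N then exp (- decay i) else exp (- decay i / 2))"

lemma decay_pos: "decay i > 0"
  unfolding decay_def using c_pos by (intro mult_pos_pos) auto

lemma dist_centres: "\<bar>b (Suc i) - b (Suc j)\<bar> \<le> b 0 - a 0" "\<bar>b (Suc i) - a 0\<bar> \<le> b 0 - a 0"
  using inside[of "Suc i"] inside[of "Suc j"] a_less_b[of "Suc i"] a_less_b[of "Suc j"] by auto

text \<open>The factor 5/4 comes from centres at most l = b 0 - a 0 apart and disc radii at most 1/4
  \<le> l / 4.\<close>

lemma F_set_covered:
  assumes N: "N \<ge> 1" and z: "z \<in> F_set a b c N" and L: "b 0 - a 0 \<ge> 1"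
    and small: "\<And>i. Suc i \<ge> N \<Longrightarrow> exp (- decay i / 2) \<le> 1/4"
  shows "\<exists>j. norm (z - of_real (b (Suc j))) \<le> radius N j"
    "norm (z - of_real (b (Suc k))) \<le> 5/4 * (b 0 - a 0)"
proof -
  consider i x where "i \<ge> 1" "z = of_real x" "a i \<le> x" "x \<le> b i"
    | n where "n \<ge> N" "norm (z - of_real (b n)) \<le> exp (- (real n * c n) / 2)"
    using z unfolding F_set_def by (auto simp: dist_norm norm_minus_commute)
  then have "(\<exists>j. norm (z - of_real (b (Suc j))) \<le> radius N j) \<and>
    norm (z - of_real (b (Suc k))) \<le> 5/4 * (b 0 - a 0)"
  proof cases
    case (1 i x)
    then obtain j where j: "i = Suc j" by (cases i) auto
    have "norm (z - of_real (b (Suc j))) = b i - x"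
      using 1 j by (simp flip: of_real_diff)
    also have "\<dots> \<le> exp (- decay j)"
    proof -
      have "b (Suc j) - a (Suc j) = exp (- decay j)" using len by (simp add: decay_def del: of_nat_Suc)
      then show ?thesis using 1 j by simp
    qed
    also have "\<dots> \<le> radius N j" using decay_pos[of j] by (simp add: radius_def)
    finally have "norm (z - of_real (b (Suc j))) \<le> radius N j" .
    moreover have "norm (z - of_real (b (Suc k))) = \<bar>x - b (Suc k)\<bar>"
      using 1 by (simp flip: of_real_diff)
    moreover have "\<bar>x - b (Suc k)\<bar> \<le> b 0 - a 0"
      using 1 inside[of i] inside[of "Suc k"] a_less_b[of "Suc k"] by (auto simp: abs_le_iff)
    then have "\<bar>x - b (Suc k)\<bar> \<le> 5/4 * (b 0 - a 0)" using L by simp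
    ultimately have "norm (z - of_real (b (Suc j))) \<le> radius N j"
      "norm (z - of_real (b (Suc k))) \<le> 5/4 * (b 0 - a 0)" by simp_all
    then show ?thesis by blast
  next
    case (2 n)
    then obtain j where j: "n = Suc j" using N by (cases n) auto
    have nj: "norm (z - of_real (b (Suc j))) \<le> exp (- decay j / 2)"
      using 2 j by (simp add: decay_def)
    then have "norm (z - of_real (b (Suc j))) \<le> radius N j" using 2 j by (simp add: radius_def)
    moreover have "norm (z - of_real (b (Suc k))) \<le> norm (z - of_real (b (Suc j))) + norm (of_real (b (Suc j)) - complex_of_real (b (Suc k)))"
      using norm_triangle_ineq[of "z - of_real (b (Suc j))" "of_real (b (Suc j)) - of_real (b (Suc k))"] by simp
    then have "norm (z - of_real (b (Suc k))) \<le> 1/4 + (b 0 - a 0)"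
      using nj small[of j] 2(1) j dist_centres(1)[of j k] by (simp flip: of_real_diff)
    then have "norm (z - of_real (b (Suc k))) \<le> 5/4 * (b 0 - a 0)" using L by simp
    ultimately show ?thesis by blast
  qed
  then show "\<exists>j. norm (z - of_real (b (Suc j))) \<le> radius N j"
    "norm (z - of_real (b (Suc k))) \<le> 5/4 * (b 0 - a 0)" by auto
qed

text \<open>A point of the open interval (a 0, b 0) outside F lies in the Cantor set, and the Green
  function of J vanishes there. If the potential v of the covering discs were positive at it, u
  would be positive and the point would lie in E. With E empty, v is therefore \<le> 0 on a whole
  segment, hence below the majorant of that segment, which fails far away.\<close>

lemma E_set_nonempty:
  assumes N: "N \<ge> 1" and L: "b 0 - a 0 \<ge> 1"
    and small: "\<And>i. Suc i \<ge> N \<Longrightarrow> exp (- decay i / 2) \<le> 1/4"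
    and sm: "summable (\<lambda>i. 1 / - ln (radius N i))" and S: "(\<Sum>i. 1 / - ln (radius N i)) < 1/2"
  shows "E_set a b c N - {of_real (a 0), of_real (b 0)} \<noteq> {}"
proof
  assume empty: "E_set a b c N - {of_real (a 0), of_real (b 0)} = {}"
  define l where "l = b 0 - a 0"
  have l: "l \<ge> 1" using L by (simp add: l_def)
  let ?S = "\<Sum>i. 1 / - ln (radius N i)"
  have r: "0 < radius N i" "radius N i < 1" for i using decay_pos[of i] by (auto simp: radius_def)
  have S0: "?S > 0"
  proof (rule suminf_pos[OF sm])
    show "0 < 1 / - ln (radius N i)" for i using r[of i] by (simp add: ln_less_zero)
  qed
  obtain v where v: "subharmonic v" "log_growth v" "\<forall>z\<in>F_set a b c N. v z \<le> 0"
    "\<And>z T. T > 0 \<Longrightarrow> T \<le> norm (z - of_real (a 0)) \<Longrightarrow> (\<And>i. T \<le> norm (z - of_real (b (Suc i)))) \<Longrightarrow>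
       ereal (ln T + 1 / ?S - ln (5/4 * l)) \<le> v z"
  proof (rule disc_potential[of "radius N" l "\<lambda>i. of_real (b (Suc i))" "of_real (a 0)" "F_set a b c N" "5/4 * l"])
    show "norm (complex_of_real (b (Suc i)) - of_real (a 0)) \<le> l" for i
      using dist_centres(2)[of i] by (simp add: l_def flip: of_real_diff)
    show "\<exists>j. norm (z - complex_of_real (b (Suc j))) \<le> radius N j" if "z \<in> F_set a b c N" for z
      using F_set_covered(1)[OF N that L small] .
    show "norm (z - complex_of_real (b (Suc i))) \<le> 5/4 * l" if "z \<in> F_set a b c N" for z i
      unfolding l_def using F_set_covered(2)[OF N that L small] .
  qed (use r sm l in auto)
  \<comment> \<open>Cutting off l / 8 at each side keeps the segment away from a 0 and b 0, the two
    points excluded from E, and leaves the length 3/4 l.\<close>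
  define \<alpha> \<beta> where "\<alpha> = a 0 + l / 8" and "\<beta> = b 0 - l / 8"
  have diff: "\<beta> - \<alpha> = 3/4 * l" by (simp add: \<alpha>_def \<beta>_def l_def field_simps)
  then have less: "\<alpha> < \<beta>" using l by simp
  have "v z \<le> 0" if z: "z \<in> seg \<alpha> \<beta>" for z
  proof (rule ccontr)
    assume pos: "\<not> v z \<le> 0"
    then have nF: "z \<notin> F_set a b c N" using v(3) by blast
    obtain x where x: "z = of_real x" "\<alpha> \<le> x" "x \<le> \<beta>" using z by auto
    have ab: "a 0 < x" "x < b 0" using x l by (auto simp: \<alpha>_def \<beta>_def)
    have gap: "\<not> (a i \<le> x \<and> x \<le> b i)" if "i \<ge> 1" for i
    proof
      assume "a i \<le> x \<and> x \<le> b i"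
      then have "z \<in> seg (a i) (b i)" using x(1) by auto
      then show False using seg_subset_F[OF that, of N] nF by blast
    qed
    have "seg x (b 0) \<subseteq> J_set a b c N" using ab by (auto simp: J_set_def)
    then have "green_function (J_set a b c N) z = 0"
      unfolding x(1) using ab by (intro green_function_seg_end)
    moreover have "green_function (F_set a b c N) z > 0"
      using green_function_upper[OF v(1-3), of z] pos by (meson less_le_trans not_le)
    ultimately have "u_fun a b c N z > 0" by (simp add: u_fun_pos_iff)
    moreover have "z \<in> cantor_set a b"
      unfolding x(1) cantor_set_iff using ab gap by (meson less_imp_le)
    moreover have "z \<noteq> of_real (b n)" if "n \<in> {1..<N}" for n
    proof
      assume "z = of_real (b n)"
      then have "x = b n" using x(1) by simp
      then show False using gap[of n] that a_less_b[of n] by auto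
    qed
    ultimately have "z \<in> E_set a b c N" unfolding E_set_iff by blast
    moreover have "z \<noteq> of_real (a 0)" "z \<noteq> of_real (b 0)" using x(1) ab by auto
    ultimately show False using empty by blast
  qed
  then have upper: "v w \<le> ereal (seg_majorant \<alpha> \<beta> w)" for w
    using le_seg_majorant[OF less v(1,2)] by blast
  \<comment> \<open>A finite substitute for infinity. There v is at least ln (100 / (5/4)) + 1 / S =
    ln 80 + 1 / S, and the majorant is ln (2 * 201 / (3/4)) = ln 536. The quotient 6.7 is close to
    its limit 20/3 and still below exp 2.\<close>
  define y where "y = b 0 + 100 * l"
  have "y - \<alpha> = 100 * l + 7/8 * l" "y - \<beta> = 100 * l + l / 8"
    by (simp_all add: y_def \<alpha>_def \<beta>_def l_def field_simps)
  then have "norm (complex_of_real y - of_real \<alpha>) = 100 * l + 7/8 * l"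
    "norm (complex_of_real y - of_real \<beta>) = 100 * l + l / 8"
    using l by (simp_all only: of_real_diff[symmetric] norm_of_real)
  then have "2 * (norm (complex_of_real y - of_real \<alpha>) + norm (complex_of_real y - of_real \<beta>)) / (\<beta> - \<alpha>) = 536"
    using l by (simp add: diff field_simps)
  then have maj: "seg_majorant \<alpha> \<beta> (of_real y) = ln 536" by (simp add: seg_majorant_def)
  have "ereal (ln (100 * l) + 1 / ?S - ln (5/4 * l)) \<le> v (of_real y)"
  proof (rule v(4))
    show "100 * l \<le> norm (complex_of_real y - of_real (a 0))"
      using l a_less_b[of 0] unfolding of_real_diff[symmetric] norm_of_real by (simp add: y_def)
    show "100 * l \<le> norm (complex_of_real y - of_real (b (Suc i)))" for i
      using l inside[of "Suc i"] unfolding of_real_diff[symmetric] norm_of_real by (simp add: y_def)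
  qed (use l in auto)
  also have "\<dots> \<le> ereal (ln 536)" using upper[of "of_real y"] maj by simp
  finally have "ln (100 * l) + 1 / ?S - ln (5/4 * l) \<le> ln 536" by simp
  moreover have "ln (100 * l) = ln 80 + ln (5/4 * l)"
    using l by (simp flip: ln_mult_pos)
  moreover have "ln (536::real) = ln 80 + ln (67 / 10)"
    by (simp flip: ln_mult_pos)
  ultimately have "1 / ?S \<le> ln (67 / 10)" by simp
  moreover have "1 / ?S > 2" using S S0 by (simp add: field_simps)
  moreover have "ln (67 / 10) < (2::real)"
    using exp_2_gt by (metis exp_gt_zero ln_exp ln_less_cancel_iff divide_pos_pos zero_less_numeral)
  ultimately show False by linarith
qed

text \<open>Late radii are square roots of the gap lengths, which doubles 1 / - ln r. The sum over
  the discs thus exceeds the sum of 1 / \<open>decay\<close> by a tail of the latter, and the strict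
  bound 1/2 leaves room for this tail.\<close>

lemma eventually_E_set_nonempty:
  assumes sm: "summable (\<lambda>i. 1 / decay i)" and half: "(\<Sum>i. 1 / decay i) < 1/2" and L: "b 0 - a 0 \<ge> 1"
  shows "\<forall>\<^sub>F N in sequentially. E_set a b c N - {of_real (a 0), of_real (b 0)} \<noteq> {}"
proof -
  have "(\<lambda>i. exp (- decay i / 2)) \<longlonglongrightarrow> 0"
    using summable_LIMSEQ_zero[OF summable_exp_half] by (simp add: decay_def)
  then have "\<forall>\<^sub>F i in sequentially. exp (- decay i / 2) < 1/4" by (rule order_tendstoD) simp
  then obtain N1 where N1: "\<And>i. i \<ge> N1 \<Longrightarrow> exp (- decay i / 2) < 1/4"
    unfolding eventually_sequentially by blast
  obtain N2 where N2: "\<And>n. n \<ge> N2 \<Longrightarrow> norm (\<Sum>i. 1 / decay (i + n)) < 1/2 - (\<Sum>i. 1 / decay i)"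
    using suminf_exist_split[OF _ sm, of "1/2 - (\<Sum>i. 1 / decay i)"] half by auto
  show ?thesis
  proof (rule eventually_sequentiallyI[of "Suc (max N1 N2)"])
    fix N assume N: "Suc (max N1 N2) \<le> N"
    then obtain m where m: "N = Suc m" "m \<ge> N1" "m \<ge> N2" by (cases N) auto
    define f where "f i = (if Suc i < N then 0 else 1 / decay i)" for i
    have smf: "summable f"
      using decay_pos by (intro summable_comparison_test'[OF sm, of 0]) (auto simp: f_def less_imp_le)
    have eq: "1 / - ln (radius N i) = 1 / decay i + f i" for i
      using decay_pos[of i] by (auto simp: radius_def f_def)
    have "suminf f = (\<Sum>i. f (i + m)) + (\<Sum>i<m. f i)" by (rule suminf_split_initial_segment[OF smf])
    also have "(\<Sum>i<m. f i) = 0" using m by (intro sum.neutral) (auto simp: f_def)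
    also have "(\<lambda>i. f (i + m)) = (\<lambda>i. 1 / decay (i + m))" using m by (auto simp: f_def)
    finally have "suminf f < 1/2 - (\<Sum>i. 1 / decay i)" using N2[OF m(3)] by simp
    then have S: "(\<Sum>i. 1 / - ln (radius N i)) < 1/2"
      unfolding eq using suminf_add[OF sm smf] by simp
    show "E_set a b c N - {of_real (a 0), of_real (b 0)} \<noteq> {}"
    proof (rule E_set_nonempty[OF _ L _ _ S])
      show "summable (\<lambda>i. 1 / - ln (radius N i))" unfolding eq by (intro summable_add sm smf)
      show "exp (- decay i / 2) \<le> 1/4" if "Suc i \<ge> N" for i
        using N1[of i] that m by simp
    qed (use m in simp)
  qed
qed

end

text \<open>Nonemptiness is what requires large \<open>N\<close>. The bound on
  \<open>b 0 - a 0\<close> enters it because the disc radii, at most 1/4 from some index on, must be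
  small against the length of the interval, and because the extent 5/4 l must have a nonnegative
  logarithm.\<close>

theorem theorem4p4:
  fixes a b c :: "nat \<Rightarrow> real" and gp gm :: "complex \<Rightarrow> complex"
  assumes "cantor_data a b"
    and "\<forall>j\<ge>1. 0 < c j"
    and "mono_on {1..} c"
    and "filterlim c at_top sequentially"
    and "\<forall>j\<ge>1. b j - a j = exp (- (real j * c j))"
    and "summable (\<lambda>j. 1 / (real (Suc j) * c (Suc j)))"
    and "(\<Sum>j. 1 / (real (Suc j) * c (Suc j))) < 1 / 2"
    and "sqrt_branch a b 1 gp"
    and "sqrt_branch a b (-1) gm"
  shows "(\<forall>N\<ge>1.
      finely_extends_over (f_ab a b) (- cantor_set a b)
        (E_set a b c N - {of_real (a 0)}) \<and>
      finely_extends_over (flip_lower gp) (- \<real>)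
        (E_set a b c N - {of_real (a 0), of_real (b 0)}) \<and>
      finely_extends_over (flip_lower gm) (- \<real>)
        (E_set a b c N - {of_real (a 0), of_real (b 0)}))
    \<and> (b 0 - a 0 \<ge> 1 \<longrightarrow>
      (\<forall>\<^sub>F N in sequentially. E_set a b c N - {of_real (a 0), of_real (b 0)} \<noteq> {}))"
proof -
  interpret exponential_cantor_data a b c using assms(1-3,5) by unfold_locales
  show ?thesis
    using f_ab_extends flip_lower_extends[OF assms(8)] flip_lower_extends[OF assms(9)]
      eventually_E_set_nonempty assms(6,7) unfolding decay_def by blast
qed

end
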